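(* oTCC on directed or undirected, strict or non-strict temporal graphs can be solved in time $\mathcal{O}(n^{2\,\mathsf{tpn}+1})$, where $n$ is the number of vertices and $\mathsf{tpn}$ is the temporal path number of the input temporal graph.
   Context: A temporal graph $\mathcal{G}=(V,E,\lambda)$ consists of a finite static graph $(V,E)$ (directed or undirected) and a labeling $\lambda$ assigning to each edge a finite set of positive integer time labels; a temporal edge is a pair $(e,t)$ with $t\in\lambda(e)$. A temporal path is a sequence of temporal edges forming a path in the static graph (following directions if directed) with non-decreasing labels (strictly increasing in the strict setting); in a strict (resp. non-strict) temporal graph reachability uses only strict (resp. non-strict) temporal paths. $u$ reaches $v$ if there is a temporal path from $u$ to $v$. Problem oTCC: given $\mathcal{G}$ and $s\in\mathbb{N}$, decide whether there is $X\subseteq V$ of size $s$ that is inclusion-maximal among sets in which every $u\in X$ reaches every $v\in X$. $\mathcal{G}$ is a $k$-path graph if there is a collection of $k$ temporal paths such that every temporal edge lies in exactly one of them; the temporal path number $\mathsf{tpn}$ is the minimum such $k$. *)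

theory Defs
  imports Main
begin

section \<open>Temporal graphs\<close>

datatype 'v edge = Arc 'v 'v | Link "'v set"

text \<open>\<open>joins e u v\<close>: the edge \<open>e\<close> can be traversed from \<open>u\<close> to \<open>v\<close>.\<close>

definition joins :: "'v edge \<Rightarrow> 'v \<Rightarrow> 'v \<Rightarrow> bool" where
  "joins e u v \<longleftrightarrow> e = Arc u v \<or> e = Link {u, v}"

record 'v tgraph =
  verts :: "'v set"
  edges :: "'v edge set"
  labels :: "'v edge \<Rightarrow> nat set"

text \<open>Static graphs are finite and simple: no loops, no parallel edges (antiparallel arcs are
  allowed). The values of \<open>labels\<close> outside \<open>edges\<close> are irrelevant.\<close>

definition temporal_graph :: "bool \<Rightarrow> 'v tgraph \<Rightarrow> bool" where
  "temporal_graph directed G \<longleftrightarrow>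
     finite (verts G) \<and>
     (\<forall>e \<in> edges G. \<exists>u v. u \<in> verts G \<and> v \<in> verts G \<and> u \<noteq> v \<and>
        e = (if directed then Arc u v else Link {u, v})) \<and>
     (\<forall>e \<in> edges G. finite (labels G e) \<and> 0 \<notin> labels G e)"

definition temporal_edges :: "'v tgraph \<Rightarrow> ('v edge \<times> nat) set" where
  "temporal_edges G = {(e, t). e \<in> edges G \<and> t \<in> labels G e}"

text \<open>\<open>ws\<close> is the vertex sequence of the path and \<open>ps\<close> its sequence of temporal edges. With
  \<open>ps = []\<close> this is the trivial path, so every vertex reaches itself.\<close>

definition temporal_path ::
  "bool \<Rightarrow> 'v tgraph \<Rightarrow> 'v list \<Rightarrow> ('v edge \<times> nat) list \<Rightarrow> bool" where
  "temporal_path strict G ws ps \<longleftrightarrow>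
     length ws = length ps + 1 \<and> distinct ws \<and> set ws \<subseteq> verts G \<and>
     set ps \<subseteq> temporal_edges G \<and>
     (\<forall>i < length ps. joins (fst (ps ! i)) (ws ! i) (ws ! (i + 1))) \<and>
     sorted_wrt (if strict then (<) else (\<le>)) (map snd ps)"

definition reaches :: "bool \<Rightarrow> 'v tgraph \<Rightarrow> 'v \<Rightarrow> 'v \<Rightarrow> bool" where
  "reaches strict G u v \<longleftrightarrow>
     (\<exists>ws ps. temporal_path strict G ws ps \<and> hd ws = u \<and> last ws = v)"

section \<open>Open temporal connected components\<close>

definition temporally_connected :: "bool \<Rightarrow> 'v tgraph \<Rightarrow> 'v set \<Rightarrow> bool" where
  "temporally_connected strict G X \<longleftrightarrow>
     X \<subseteq> verts G \<and> (\<forall>u \<in> X. \<forall>v \<in> X. reaches strict G u v)"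

definition open_tcc :: "bool \<Rightarrow> 'v tgraph \<Rightarrow> 'v set \<Rightarrow> bool" where
  "open_tcc strict G X \<longleftrightarrow>
     temporally_connected strict G X \<and>
     (\<forall>Y. temporally_connected strict G Y \<and> X \<subseteq> Y \<longrightarrow> Y = X)"

definition oTCC :: "bool \<Rightarrow> 'v tgraph \<Rightarrow> nat \<Rightarrow> bool" where
  "oTCC strict G s \<longleftrightarrow> (\<exists>X. open_tcc strict G X \<and> card X = s)"

section \<open>Temporal path number\<close>

definition k_path_graph :: "bool \<Rightarrow> 'v tgraph \<Rightarrow> nat \<Rightarrow> bool" where
  "k_path_graph strict G k \<longleftrightarrow>
     (\<exists>Ps. length Ps = k \<and>
        (\<forall>ps \<in> set Ps. \<exists>ws. temporal_path strict G ws ps) \<and>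
        (\<forall>te \<in> temporal_edges G. \<exists>!i. i < k \<and> te \<in> set (Ps ! i)))"

definition tpn :: "bool \<Rightarrow> 'v tgraph \<Rightarrow> nat" where
  "tpn strict G = (LEAST k. k_path_graph strict G k)"

text \<open>The minimum is over a nonempty set: every temporal edge is a path by itself.\<close>

lemma finite_temporal_edges:
  assumes "temporal_graph directed G"
  shows "finite (temporal_edges G)"
proof -
  have "edges G \<subseteq> (\<lambda>(u, v). if directed then Arc u v else Link {u, v}) ` (verts G \<times> verts G)"
    using assms unfolding temporal_graph_def by fastforce
  then have "finite (edges G)"
    using assms unfolding temporal_graph_def by (meson finite_SigmaI finite_imageI finite_subset)
  moreover have "temporal_edges G = Sigma (edges G) (labels G)"
    by (auto simp: temporal_edges_def)
  ultimately show ?thesis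
    using assms unfolding temporal_graph_def by auto
qed

lemma k_path_graph_card:
  assumes "temporal_graph directed G"
  shows "k_path_graph strict G (card (temporal_edges G))"
proof -
  obtain xs where xs: "set xs = temporal_edges G" "distinct xs"
    using finite_distinct_list[OF finite_temporal_edges[OF assms]] by blast
  have path: "\<exists>ws. temporal_path strict G ws [p]" if p: "p \<in> temporal_edges G" for p
  proof -
    obtain u v where "u \<in> verts G" "v \<in> verts G" "u \<noteq> v" "joins (fst p) u v"
      using p assms unfolding temporal_graph_def temporal_edges_def joins_def
      by (cases directed) fastforce+
    then have "temporal_path strict G [u, v] [p]"
      using p by (auto simp: temporal_path_def)
    then show ?thesis by blast
  qed
  have "\<exists>!i. i < length xs \<and> p \<in> set (map (\<lambda>p. [p]) xs ! i)" if "p \<in> temporal_edges G" for p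
  proof -
    have "\<exists>!i. i < length xs \<and> xs ! i = p"
      using that xs by (simp add: distinct_Ex1)
    then show ?thesis by (rule ex1E) (auto intro!: ex1I)
  qed
  then show ?thesis
    unfolding k_path_graph_def using path xs
    by (intro exI[of _ "map (\<lambda>p. [p]) xs"]) (auto simp: distinct_card[symmetric])
qed

lemma k_path_graph_tpn:
  assumes "temporal_graph directed G"
  shows "k_path_graph strict G (tpn strict G)"
  unfolding tpn_def using k_path_graph_card[OF assms] by (rule LeastI)

section \<open>Model of computation\<close>

text \<open>
  A random access machine under the uniform cost criterion, with structured control flow in place
  of jumps: unboundedly many registers hold natural numbers, registers can be addressed
  indirectly, and the arithmetic operations are addition and truncated subtraction only. There
  is deliberately no multiplication, since unit-cost multiplication of unbounded integers is not
  a realistic primitive. One unit of time is charged for every executed instruction and every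
  node of an evaluated expression.
\<close>

type_synonym mem = "nat \<Rightarrow> nat"

datatype exp = Const nat | Reg exp | Plus exp exp | Minus exp exp

datatype test = Less exp exp | Not test | And test test

datatype com = Skip | Store exp exp | Seq com com | Cond test com com | While test com

fun val :: "exp \<Rightarrow> mem \<Rightarrow> nat" where
  "val (Const k) \<sigma> = k"
| "val (Reg a) \<sigma> = \<sigma> (val a \<sigma>)"
| "val (Plus a b) \<sigma> = val a \<sigma> + val b \<sigma>"
| "val (Minus a b) \<sigma> = val a \<sigma> - val b \<sigma>"

fun holds :: "test \<Rightarrow> mem \<Rightarrow> bool" where
  "holds (Less a b) \<sigma> \<longleftrightarrow> val a \<sigma> < val b \<sigma>"
| "holds (Not p) \<sigma> \<longleftrightarrow> \<not> holds p \<sigma>"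
| "holds (And p q) \<sigma> \<longleftrightarrow> holds p \<sigma> \<and> holds q \<sigma>"

fun exp_cost :: "exp \<Rightarrow> nat" where
  "exp_cost (Const k) = 1"
| "exp_cost (Reg a) = 1 + exp_cost a"
| "exp_cost (Plus a b) = 1 + exp_cost a + exp_cost b"
| "exp_cost (Minus a b) = 1 + exp_cost a + exp_cost b"

fun test_cost :: "test \<Rightarrow> nat" where
  "test_cost (Less a b) = 1 + exp_cost a + exp_cost b"
| "test_cost (Not p) = 1 + test_cost p"
| "test_cost (And p q) = 1 + test_cost p + test_cost q"

text \<open>\<open>exec P \<sigma> t \<tau>\<close>: started in memory \<open>\<sigma>\<close>, the program \<open>P\<close> halts after time \<open>t\<close> in memory \<open>\<tau>\<close>.
  \<open>Store a b\<close> writes the value of \<open>b\<close> to the register whose address is the value of \<open>a\<close>.\<close>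

inductive exec :: "com \<Rightarrow> mem \<Rightarrow> nat \<Rightarrow> mem \<Rightarrow> bool" where
  skip: "exec Skip \<sigma> 1 \<sigma>"
| store: "exec (Store a b) \<sigma> (1 + exp_cost a + exp_cost b) (\<sigma>(val a \<sigma> := val b \<sigma>))"
| seq: "exec P \<sigma> t \<sigma>' \<Longrightarrow> exec Q \<sigma>' t' \<sigma>'' \<Longrightarrow> exec (Seq P Q) \<sigma> (t + t') \<sigma>''"
| cond_true: "holds p \<sigma> \<Longrightarrow> exec P \<sigma> t \<sigma>' \<Longrightarrow> exec (Cond p P Q) \<sigma> (1 + test_cost p + t) \<sigma>'"
| cond_false: "\<not> holds p \<sigma> \<Longrightarrow> exec Q \<sigma> t \<sigma>' \<Longrightarrow> exec (Cond p P Q) \<sigma> (1 + test_cost p + t) \<sigma>'"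
| while_false: "\<not> holds p \<sigma> \<Longrightarrow> exec (While p P) \<sigma> (1 + test_cost p) \<sigma>"
| while_true: "holds p \<sigma> \<Longrightarrow> exec P \<sigma> t \<sigma>' \<Longrightarrow> exec (While p P) \<sigma>' t' \<sigma>'' \<Longrightarrow>
    exec (While p P) \<sigma> (1 + test_cost p + t + t') \<sigma>''"

inductive_cases exec_elims:
  "exec Skip \<sigma> t \<tau>" "exec (Store a b) \<sigma> t \<tau>" "exec (Seq P Q) \<sigma> t \<tau>"
  "exec (Cond p P Q) \<sigma> t \<tau>" "exec (While p P) \<sigma> t \<tau>"

lemma exec_deterministic:
  "exec P \<sigma> t \<tau> \<Longrightarrow> exec P \<sigma> t' \<tau>' \<Longrightarrow> t = t' \<and> \<tau> = \<tau>'"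
proof (induction arbitrary: t' \<tau>' rule: exec.induct)
  case skip then show ?case by (rule exec_elims(1)) simp
next
  case store then show ?case by (rule exec_elims(2)) simp
next
  case seq from seq.prems show ?case by (rule exec_elims(3)) (auto dest!: seq.IH)
next
  case cond_true from cond_true.prems cond_true.hyps show ?case
    by (elim exec_elims(4)) (auto dest!: cond_true.IH)
next
  case cond_false from cond_false.prems cond_false.hyps show ?case
    by (elim exec_elims(4)) (auto dest!: cond_false.IH)
next
  case while_false from while_false.prems while_false.hyps show ?case
    by cases auto
next
  case while_true from while_true.prems show ?case
    by cases (use while_true.hyps in \<open>auto dest!: while_true.IH\<close>)
qed

section \<open>Input encoding\<close>

text \<open>
  The input consists of the number \<open>n\<close> of vertices, the number of temporal edges, the target
  size \<open>s\<close>, and one triple (tail, head, label) per temporal edge, where the vertices are numbered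
  \<open>0, \<dots>, n - 1\<close>. Numbering of the vertices and order of the temporal edges are arbitrary; an
  undirected temporal edge is listed once, with its endpoints in either order. All registers
  beyond the input are \<open>0\<close>.
\<close>

definition encodes :: "'v tgraph \<Rightarrow> nat \<Rightarrow> mem \<Rightarrow> bool" where
  "encodes G s \<sigma> \<longleftrightarrow>
     (\<exists>vs tes rs.
        distinct vs \<and> set vs = verts G \<and>
        distinct tes \<and> set tes = temporal_edges G \<and>
        list_all2 (\<lambda>(e, t) (i, j, l).
          i < length vs \<and> j < length vs \<and> joins e (vs ! i) (vs ! j) \<and> l = t) tes rs \<and>
        (let xs = [length vs, length tes, s] @ concat (map (\<lambda>(i, j, l). [i, j, l]) rs)
         in \<sigma> = (\<lambda>a. if a < length xs then xs ! a else 0)))"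

end

theory Submission
  imports Defs Complex_Main "HOL-Library.FuncSet" "HOL-Library.Nat_Bijection"
begin

text \<open>
  Let \<open>R u\<close> be the set of vertices reached from \<open>u\<close>. A maximal clique \<open>X\<close> of mutual reachability is
  determined by its common out-neighbourhood \<open>W = \<Inter>u\<in>X. R u\<close>, namely \<open>X = {u \<in> W. W \<subseteq> R u}\<close>. Hence it
  suffices to enumerate all intersections of sets \<open>R u\<close> (as bit codes that also serve as addresses
  of the flags used to detect duplicates) and to test the clique that each of them yields, at a cost
  of \<open>O(n\<^sup>2)\<close> per intersection.

  The number of intersections is bounded through a decomposition into \<open>k = tpn\<close> temporal paths. For
  each path let \<open>a\<close> be the start of its longest suffix inside \<open>W\<close>; there are at most
  \<open>(n + 1)\<^sup>k\<close> choices of starts. A vertex of \<open>W\<close> outside these suffixes can only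
  exist in strict undirected graphs, and there several paths must leave it simultaneously, carrying
  between them all of the vertices whose out-neighbourhoods are intersected. The paths reachable
  from these have no common member, which allows at most \<open>k log k\<close> such junctions, so at most
  \<open>k\<^sup>k\<close> sets \<open>W\<close> share the same starts.
\<close>

section \<open>Temporal walks\<close>

text \<open>The program never computes the temporal path number; a decomposition exists only in the
  analysis. The exponent leaves room for \<open>n ^ (2 * k - 1)\<close> intersections at quadratic
  cost each, whereas the count is about \<open>(n + 1) ^ k * k ^ k\<close>. This fits because
  \<open>k ^ k \<le> n ^ (k - 1)\<close> as long as \<open>2 * k \<le> n\<close>; beyond that, the
  trivial bound \<open>2 ^ n\<close> is small enough.

  The machine has neither multiplication nor bit operations, so intersecting two codes takes linear
  time, and only a constant number of such operations can be afforded per pair of an intersection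
  and a vertex.

  Strict undirected graphs are the obstacle because a path of the decomposition may be used against
  its direction: whoever arrives at a vertex by traversing an edge with label \<open>t\<close>
  backwards comes too late to leave by any edge with label \<open>t\<close>. The bound on the
  junctions rests on a potential, the product over all \<open>k\<close> paths of the size of a set
  of paths attached to each: it starts at 1, never exceeds \<open>k ^ k\<close> and doubles at every
  junction.\<close>

definition before :: "bool \<Rightarrow> nat \<Rightarrow> nat \<Rightarrow> bool" where
  "before strict t l \<longleftrightarrow> (if strict then t < l else t \<le> l)"

lemma before_imp_le: "before strict t l \<Longrightarrow> t \<le> l"
  by (auto simp: before_def split: if_splits)

lemma before_le_trans: "t \<le> t' \<Longrightarrow> before strict t' l \<Longrightarrow> before strict t l"
  by (auto simp: before_def split: if_splits)

lemma before_0: "0 < l \<Longrightarrow> before strict 0 l"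
  by (simp add: before_def)

text \<open>\<open>arrives strict G u h v t\<close>: some temporal walk with at most \<open>h\<close> edges leads from \<open>u\<close> to \<open>v\<close> and
  its last label is \<open>t\<close>, where \<open>t = 0\<close> stands for the trivial walk.\<close>

inductive arrives :: "bool \<Rightarrow> 'v tgraph \<Rightarrow> 'v \<Rightarrow> nat \<Rightarrow> 'v \<Rightarrow> nat \<Rightarrow> bool"
  for strict G u where
  start: "u \<in> verts G \<Longrightarrow> arrives strict G u h u 0"
| step: "arrives strict G u h v t \<Longrightarrow> (e, l) \<in> temporal_edges G \<Longrightarrow> joins e v w \<Longrightarrow>
    before strict t l \<Longrightarrow> arrives strict G u (Suc h) w l"

lemma label_pos: "temporal_graph directed G \<Longrightarrow> (e, l) \<in> temporal_edges G \<Longrightarrow> 0 < l"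
  by (auto simp: temporal_graph_def temporal_edges_def intro: Suc_leI ccontr)

lemma joins_verts:
  assumes "temporal_graph directed G" "(e, l) \<in> temporal_edges G" "joins e v w"
  shows "v \<in> verts G" "w \<in> verts G" "v \<noteq> w"
proof -
  obtain a b where "a \<in> verts G" "b \<in> verts G" "a \<noteq> b"
      "e = (if directed then Arc a b else Link {a, b})"
    using assms by (auto simp: temporal_graph_def temporal_edges_def)
  with assms(3) show "v \<in> verts G" "w \<in> verts G" "v \<noteq> w"
    by (auto simp: joins_def doubleton_eq_iff split: if_splits)
qed

lemma joins_unique:
  assumes "temporal_graph directed G" "(e, l) \<in> temporal_edges G" "joins e v w" "joins e a b"
  shows "v = a \<and> w = b \<or> \<not> directed \<and> v = b \<and> w = a"
proof -
  obtain x y where "e = (if directed then Arc x y else Link {x, y})"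
    using assms by (auto simp: temporal_graph_def temporal_edges_def)
  with assms(3,4) show ?thesis
    by (auto simp: joins_def doubleton_eq_iff split: if_splits)
qed

lemma arrives_mono: "arrives strict G u h v t \<Longrightarrow> h \<le> h' \<Longrightarrow> arrives strict G u h' v t"
proof (induction arbitrary: h' rule: arrives.induct)
  case (start h)
  then show ?case by (simp add: arrives.start)
next
  case (step h v t e l w)
  then obtain h'' where "h' = Suc h''" "h \<le> h''" by (cases h') auto
  with step show ?case by (auto intro: arrives.step)
qed

lemma arrives_target:
  "temporal_graph directed G \<Longrightarrow> arrives strict G u h v t \<Longrightarrow> v \<in> verts G"
  by (erule arrives.cases) (auto dest: joins_verts)

lemma arrives_time_0:
  "temporal_graph directed G \<Longrightarrow> arrives strict G u h v t \<Longrightarrow> t = 0 \<Longrightarrow> v = u"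
  by (erule arrives.cases) (auto dest: label_pos)

lemma path_last: "temporal_path strict G ws ps \<Longrightarrow> ws ! length ps = last ws"
  by (cases "ws = []") (auto simp: temporal_path_def last_conv_nth)

lemma path_labels:
  "temporal_path strict G ws ps \<Longrightarrow> i < j \<Longrightarrow> j < length ps \<Longrightarrow> before strict (snd (ps ! i)) (snd (ps ! j))"
  by (auto simp: temporal_path_def before_def sorted_wrt_iff_nth_less)

lemma path_arrives:
  assumes G: "temporal_graph directed G" and P: "temporal_path strict G ws ps" and i: "i \<le> length ps"
  shows "arrives strict G (hd ws) i (ws ! i) (if i = 0 then 0 else snd (ps ! (i - 1)))"
  using i
proof (induction i)
  case 0
  have "ws \<noteq> []" "set ws \<subseteq> verts G" using P by (auto simp: temporal_path_def)
  then have "hd ws \<in> verts G" by (metis hd_in_set subsetD)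
  with \<open>ws \<noteq> []\<close> show ?case by (simp add: arrives.start flip: hd_conv_nth)
next
  case (Suc i)
  obtain e l where p: "ps ! i = (e, l)" by force
  have e: "(e, l) \<in> temporal_edges G"
    using P Suc.prems p nth_mem[of i ps] by (auto simp: temporal_path_def)
  have j: "joins e (ws ! i) (ws ! Suc i)"
  proof -
    have "joins (fst (ps ! i)) (ws ! i) (ws ! (i + 1))"
      using P Suc.prems unfolding temporal_path_def by (meson Suc_le_lessD)
    with p show ?thesis by simp
  qed
  have "before strict (if i = 0 then 0 else snd (ps ! (i - 1))) l"
  proof (cases i)
    case 0
    then show ?thesis using label_pos[OF G e] by (simp add: before_0)
  next
    case (Suc i')
    then show ?thesis using path_labels[OF P, of i' i] Suc.prems p by simp
  qed
  from arrives.step[OF _ e j this] Suc p show ?case by simp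
qed

text \<open>A walk becomes a path by cutting it back whenever it returns to a vertex. Cutting may
  make the last label earlier, hence the conclusion bounds all labels by \<open>t\<close> instead of
  fixing the last one; this bound is what allows the next edge to be appended.\<close>

lemma arrives_path:
  assumes G: "temporal_graph directed G" and "arrives strict G u h v t"
  shows "\<exists>ws ps. temporal_path strict G ws ps \<and> hd ws = u \<and> last ws = v \<and> (\<forall>p \<in> set ps. snd p \<le> t)"
  using assms(2)
proof induction
  case (start h)
  then have "temporal_path strict G [u] [] \<and> hd [u] = u \<and> last [u] = u"
    by (simp add: temporal_path_def)
  then show ?case by force
next
  case (step h v t e l w)
  then obtain ws ps where P: "temporal_path strict G ws ps" "hd ws = u" "last ws = v"
    and le: "\<forall>p \<in> set ps. snd p \<le> t" by blast
  then have ne: "ws \<noteq> []" by (auto simp: temporal_path_def)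
  show ?case
  proof (cases "w \<in> set ws")
    case True
    then obtain i where i: "i < length ws" "w = ws ! i" by (auto simp: in_set_conv_nth)
    have "temporal_path strict G (take (Suc i) ws) (take i ps)"
      using P(1) i by (auto simp: temporal_path_def take_map[symmetric] sorted_wrt_take
          dest: in_set_takeD)
    moreover have "hd (take (Suc i) ws) = u" using P ne by simp
    moreover have "last (take (Suc i) ws) = w" using i by (simp add: take_Suc_conv_app_nth)
    moreover have "\<forall>p \<in> set (take i ps). snd p \<le> l"
      using le before_imp_le[OF step.hyps(4)] by (meson in_set_takeD order_trans)
    ultimately show ?thesis by blast
  next
    case False
    have len: "length ws = Suc (length ps)" using P by (simp add: temporal_path_def)
    have lw: "ws ! length ps = v" using P(3) len ne by (simp add: last_conv_nth)
    have "temporal_path strict G (ws @ [w]) (ps @ [(e, l)])"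
      unfolding temporal_path_def
    proof (intro conjI)
      show "set (ws @ [w]) \<subseteq> verts G"
        using P(1) joins_verts[OF G step.hyps(2,3)] by (auto simp: temporal_path_def)
      show "\<forall>i < length (ps @ [(e, l)]). joins (fst ((ps @ [(e, l)]) ! i)) ((ws @ [w]) ! i) ((ws @ [w]) ! (i + 1))"
        using P(1) lw len step.hyps(3) by (auto simp: temporal_path_def nth_append less_Suc_eq)
      show "sorted_wrt (if strict then (<) else (\<le>)) (map snd (ps @ [(e, l)]))"
        using P(1) le step.hyps(4)
        by (auto simp: temporal_path_def before_def sorted_wrt_append split: if_splits)
    qed (use P(1) False step.hyps(2) in \<open>auto simp: temporal_path_def\<close>)
    moreover have "\<forall>p \<in> set (ps @ [(e, l)]). snd p \<le> l"
      using le before_imp_le[OF step.hyps(4)] by auto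
    ultimately show ?thesis using P(2) ne by (intro exI[of _ "ws @ [w]"] exI[of _ "ps @ [(e, l)]"]) simp
  qed
qed

lemma reaches_iff_arrives:
  assumes "temporal_graph directed G"
  shows "reaches strict G u v \<longleftrightarrow> (\<exists>h t. arrives strict G u h v t)"
proof
  assume "reaches strict G u v"
  then obtain ws ps where P: "temporal_path strict G ws ps" "hd ws = u" "last ws = v"
    by (auto simp: reaches_def)
  then have "ws ! length ps = v" by (simp add: path_last)
  with path_arrives[OF assms P(1), of "length ps"] P(2) show "\<exists>h t. arrives strict G u h v t" by auto
next
  assume "\<exists>h t. arrives strict G u h v t"
  then show "reaches strict G u v" using arrives_path[OF assms] by (fastforce simp: reaches_def)
qed

text \<open>A path visits distinct vertices. This is why as many rounds of relaxation as there are
  vertices find everything reachable.\<close>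

lemma reaches_arrives_card:
  assumes G: "temporal_graph directed G" and "reaches strict G u v"
  shows "\<exists>t. arrives strict G u (card (verts G)) v t"
proof -
  obtain ws ps where P: "temporal_path strict G ws ps" "hd ws = u" "last ws = v"
    using assms(2) by (auto simp: reaches_def)
  then have "ws ! length ps = v" by (simp add: path_last)
  moreover have "length ps \<le> card (verts G)"
    using P(1) G card_mono[of "verts G" "set ws"]
    by (auto simp: temporal_path_def temporal_graph_def distinct_card)
  ultimately show ?thesis
    using path_arrives[OF G P(1), of "length ps"] P(2) arrives_mono by (metis order_refl)
qed

lemma reaches_refl: "temporal_graph directed G \<Longrightarrow> v \<in> verts G \<Longrightarrow> reaches strict G v v"
  by (auto simp: reaches_iff_arrives intro: arrives.start)

section \<open>Counting the common out-neighbourhoods\<close>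

text \<open>Every element of the union is missed by some \<open>F A\<close>, so the deficiencies
  \<open>1 - card (F A) / u\<close> add up to at least 1. Applying
  \<open>x \<le> exp (x - 1)\<close> to each density \<open>card (F A) / u\<close> bounds their
  product by \<open>exp (- 1)\<close>, which is at most 1/2.\<close>

lemma prod_doubling:
  fixes F :: "'a \<Rightarrow> 'b set"
  assumes T: "finite T" "T \<noteq> {}" and fin: "\<And>A. A \<in> T \<Longrightarrow> finite (F A)"
    and empty: "(\<Inter>A\<in>T. F A) = {}"
  shows "2 * (\<Prod>A\<in>T. card (F A)) \<le> (\<Prod>A\<in>T. card (\<Union>A\<in>T. F A))"
proof -
  define U where "U = (\<Union>A\<in>T. F A)"
  define u where "u = real (card U)"
  have U: "finite U" using T fin by (auto simp: U_def)
  show ?thesis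
  proof (cases "U = {}")
    case True
    then have "\<And>A. A \<in> T \<Longrightarrow> F A = {}" by (auto simp: U_def)
    with T show ?thesis by (auto simp: prod_zero_iff)
  next
    case False
    then have u: "0 < u" using U by (auto simp: u_def card_gt_0_iff)
    have "card U \<le> card (\<Union>A\<in>T. U - F A)"
      using empty T U by (intro card_mono) auto
    also have "\<dots> \<le> (\<Sum>A\<in>T. card (U - F A))" using T by (intro card_UN_le)
    finally have "u \<le> (\<Sum>A\<in>T. real (card (U - F A)))"
      unfolding u_def by (metis of_nat_le_iff of_nat_sum)
    also have "\<dots> = (\<Sum>A\<in>T. u - card (F A))"
    proof (intro sum.cong refl)
      fix A assume "A \<in> T"
      then have "F A \<subseteq> U" by (auto simp: U_def)
      then show "real (card (U - F A)) = u - card (F A)"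
        using U by (simp add: u_def card_Diff_subset finite_subset of_nat_diff card_mono)
    qed
    also have "\<dots> = u * (\<Sum>A\<in>T. 1 - card (F A) / u)"
      unfolding sum_distrib_left using u by (intro sum.cong) (auto simp: right_diff_distrib)
    finally have "1 \<le> (\<Sum>A\<in>T. 1 - card (F A) / u)" using u by simp
    moreover have "(\<Prod>A\<in>T. card (F A) / u) \<le> (\<Prod>A\<in>T. exp (- (1 - card (F A) / u)))"
    proof (intro prod_mono conjI)
      fix A
      show "0 \<le> card (F A) / u" using u by simp
      show "card (F A) / u \<le> exp (- (1 - card (F A) / u))"
        using exp_ge_add_one_self[of "- (1 - card (F A) / u)"] by simp
    qed
    moreover have "(\<Prod>A\<in>T. exp (- (1 - card (F A) / u))) = exp (- (\<Sum>A\<in>T. 1 - card (F A) / u))"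
      using T by (simp only: exp_sum[symmetric] sum_negf)
    ultimately have "(\<Prod>A\<in>T. card (F A) / u) \<le> exp (- 1)"
      by (smt (verit) exp_le_cancel_iff)
    also have "\<dots> \<le> 1 / 2"
      using exp_ge_add_one_self[of 1] by (simp add: exp_minus field_simps)
    finally have "2 * (\<Prod>A\<in>T. real (card (F A))) \<le> (\<Prod>A\<in>T. u)"
      using u by (simp add: prod_dividef field_simps)
    then have "real (2 * (\<Prod>A\<in>T. card (F A))) \<le> real (\<Prod>A\<in>T. card U)"
      by (simp add: u_def)
    then show ?thesis unfolding U_def of_nat_le_iff .
  qed
qed

text \<open>Read in order of decreasing time, every event \<open>v\<close> merges the sets of the members of \<open>T v\<close>,
  and each merge at least doubles the product of the cardinalities.\<close>

lemma merge_count: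
  fixes t :: "'a \<Rightarrow> nat" and T :: "'a \<Rightarrow> 'b set" and F :: "'a \<Rightarrow> 'b \<Rightarrow> 'b set"
  assumes K: "finite K" and S: "finite S"
    and T: "\<And>v. v \<in> S \<Longrightarrow> T v \<subseteq> K" "\<And>v. v \<in> S \<Longrightarrow> T v \<noteq> {}"
    and F: "\<And>v A. v \<in> S \<Longrightarrow> A \<in> T v \<Longrightarrow> A \<in> F v A \<and> F v A \<subseteq> K"
    and empty: "\<And>v. v \<in> S \<Longrightarrow> (\<Inter>A\<in>T v. F v A) = {}"
    and distinct: "\<And>v v' A. v \<in> S \<Longrightarrow> v' \<in> S \<Longrightarrow> A \<in> T v \<Longrightarrow> A \<in> T v' \<Longrightarrow> t v = t v' \<Longrightarrow> v = v'"
    and mono: "\<And>v v' A B. v \<in> S \<Longrightarrow> v' \<in> S \<Longrightarrow> A \<in> T v \<Longrightarrow> A \<in> T v' \<Longrightarrow> t v' < t v \<Longrightarrow> B \<in> T v \<Longrightarrow>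
      F v B \<subseteq> F v' A"
  shows "2 ^ card S \<le> card K ^ card K"
proof -
  \<comment> \<open>\<open>H A\<close> is the set currently attached to \<open>A\<close>: a
    singleton at the beginning, later the union created by an event that involves \<open>A\<close>.
    The induction splits off the event of least time, which is the last one to be merged.\<close>
  have "\<exists>H. (\<forall>A \<in> K. A \<in> H A \<and> H A \<subseteq> K \<and> (H A = {A} \<or> (\<exists>v \<in> S'. A \<in> T v \<and> H A = (\<Union>B\<in>T v. F v B)))) \<and>
      2 ^ card S' \<le> (\<Prod>A\<in>K. card (H A))" if "finite S'" "S' \<subseteq> S" for S'
    using that
  proof (induction "card S'" arbitrary: S')
    case 0
    then show ?case by (intro exI[of _ "\<lambda>A. {A}"]) simp
  next
    case (Suc c)
    then have "S' \<noteq> {}" by auto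
    with Suc.prems obtain v where v: "v \<in> S'" and least: "\<And>v'. v' \<in> S' \<Longrightarrow> t v \<le> t v'"
      using arg_min_if_finite[of S' t] by (metis linorder_not_less)
    define S'' where "S'' = S' - {v}"
    have S'': "finite S''" "S'' \<subseteq> S" "card S'' = c" "S'' \<subseteq> S'"
      using Suc v by (auto simp: S''_def)
    from Suc.hyps(1)[of S''] S'' obtain H
      where H: "\<And>A. A \<in> K \<Longrightarrow> A \<in> H A \<and> H A \<subseteq> K \<and>
          (H A = {A} \<or> (\<exists>v \<in> S''. A \<in> T v \<and> H A = (\<Union>B\<in>T v. F v B)))"
        and prod: "2 ^ c \<le> (\<Prod>A\<in>K. card (H A))" by blast
    have vS: "v \<in> S" using v Suc.prems by auto
    \<comment> \<open>Either \<open>A\<close> has not been merged yet, or its set stems from a later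
      event \<open>v'\<close>, and then \<open>mono\<close> puts each \<open>F v' B\<close> inside
      \<open>F v A\<close>.\<close>
    have HF: "H A \<subseteq> F v A" if A: "A \<in> T v" for A
    proof -
      consider "H A = {A}" | v' where "v' \<in> S''" "A \<in> T v'" "H A = (\<Union>B\<in>T v'. F v' B)"
        using H T(1)[OF vS] A by blast
      then show ?thesis
      proof cases
        case 1
        then show ?thesis using F[OF vS A] by simp
      next
        case 2
        have "t v \<noteq> t v'" using distinct[OF vS _ A 2(2)] 2(1) S'' by (auto simp: S''_def)
        with least[of v'] 2(1) S'' have "t v < t v'" by force
        then show ?thesis using mono[of v' v A] 2 A vS S'' by blast
      qed
    qed
    define U where "U = (\<Union>B\<in>T v. F v B)"
    define H' where "H' A = (if A \<in> T v then U else H A)" for A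
    have Tv: "finite (T v)" using T(1)[OF vS] K finite_subset by blast
    have finF: "finite (F v A)" if "A \<in> T v" for A using F[OF vS that] K finite_subset by blast
    have 1: "\<forall>A \<in> K. A \<in> H' A \<and> H' A \<subseteq> K \<and> (H' A = {A} \<or> (\<exists>v \<in> S'. A \<in> T v \<and> H' A = (\<Union>B\<in>T v. F v B)))"
    proof
      fix A assume A: "A \<in> K"
      show "A \<in> H' A \<and> H' A \<subseteq> K \<and> (H' A = {A} \<or> (\<exists>v \<in> S'. A \<in> T v \<and> H' A = (\<Union>B\<in>T v. F v B)))"
      proof (cases "A \<in> T v")
        case True
        then have "A \<in> U" "U \<subseteq> K" using F[OF vS] unfolding U_def by blast+
        then show ?thesis using True v by (auto simp: H'_def U_def)
      next
        case False
        then show ?thesis using H[OF A] S''(4) unfolding H'_def by auto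
      qed
    qed
    have split: "(\<Prod>A\<in>K. card (h A)) = (\<Prod>A\<in>T v. card (h A)) * (\<Prod>A\<in>K - T v. card (h A))" for h :: "'b \<Rightarrow> 'b set"
      using prod.subset_diff[OF T(1)[OF vS] K, of "\<lambda>A. card (h A)"] by (simp add: mult.commute)
    \<comment> \<open>The sets attached so far lie inside the sets \<open>F v A\<close>, and all
      members of \<open>T v\<close> receive the union of the latter; \<open>prod_doubling\<close>
      yields the factor 2.\<close>
    have "2 * (\<Prod>A\<in>T v. card (H A)) \<le> 2 * (\<Prod>A\<in>T v. card (F v A))"
      using HF finF by (intro mult_left_mono prod_mono) (auto intro: card_mono)
    also have "\<dots> \<le> (\<Prod>A\<in>T v. card (H' A))"
      using prod_doubling[OF Tv T(2)[OF vS] finF empty[OF vS]] by (simp add: H'_def U_def)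
    finally have "2 * (\<Prod>A\<in>K. card (H A)) \<le> (\<Prod>A\<in>K. card (H' A))"
      unfolding split[of H] split[of H'] by (simp add: H'_def mult.assoc[symmetric])
    with prod have "2 ^ card S' \<le> (\<Prod>A\<in>K. card (H' A))" by (simp add: Suc.hyps(2)[symmetric])
    with 1 show ?case by blast
  qed
  from this[OF S order_refl] obtain H
    where H: "\<And>A. A \<in> K \<Longrightarrow> H A \<subseteq> K" "2 ^ card S \<le> (\<Prod>A\<in>K. card (H A))" by blast
  have "(\<Prod>A\<in>K. card (H A)) \<le> (\<Prod>A\<in>K. card K)"
    using H K by (intro prod_mono) (auto intro: card_mono)
  with H show ?thesis by simp
qed

section \<open>Travelling along the paths of a decomposition\<close>

definition common :: "bool \<Rightarrow> 'v tgraph \<Rightarrow> 'v set \<Rightarrow> 'v set" where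
  "common strict G U = {v \<in> verts G. \<forall>u \<in> U. reaches strict G u v}"

locale path_cover =
  fixes directed strict :: bool and G :: "'v tgraph"
    and ws :: "nat \<Rightarrow> 'v list" and ps :: "nat \<Rightarrow> ('v edge \<times> nat) list" and k :: nat
  assumes G: "temporal_graph directed G"
    and path: "A < k \<Longrightarrow> temporal_path strict G (ws A) (ps A)"
    and cover: "temporal_edges G \<subseteq> (\<Union>A<k. set (ps A))"
begin

abbreviation "len A \<equiv> length (ps A)"
abbreviation "vtx A j \<equiv> ws A ! j"
abbreviation "lab A j \<equiv> snd (ps A ! j)"

definition present :: "'v \<Rightarrow> 'v \<Rightarrow> nat \<Rightarrow> bool" where
  "present u v t \<longleftrightarrow> (\<exists>h. arrives strict G u h v t)"

lemma present_start: "u \<in> verts G \<Longrightarrow> present u u 0"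
  by (auto simp: present_def intro: arrives.start)

lemma reaches_present: "reaches strict G u v \<longleftrightarrow> (\<exists>t. present u v t)"
  by (auto simp: present_def reaches_iff_arrives[OF G])

lemma vtx_verts: "A < k \<Longrightarrow> j \<le> len A \<Longrightarrow> vtx A j \<in> verts G"
  using path[of A] nth_mem[of j "ws A"] by (auto simp: temporal_path_def)

lemma vtx_inj: "A < k \<Longrightarrow> i \<le> len A \<Longrightarrow> j \<le> len A \<Longrightarrow> vtx A i = vtx A j \<Longrightarrow> i = j"
  using path[of A] by (auto simp: temporal_path_def nth_eq_iff_index_eq)

lemma len_less: "A < k \<Longrightarrow> len A < card (verts G)"
  using path[of A] G card_mono[of "verts G" "set (ws A)"]
  by (auto simp: temporal_path_def temporal_graph_def distinct_card)

lemma lab_mono: "A < k \<Longrightarrow> i < j \<Longrightarrow> j < len A \<Longrightarrow> before strict (lab A i) (lab A j)"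
  using path_labels[OF path] by blast

lemma edge:
  assumes "A < k" "j < len A"
  shows "(fst (ps A ! j), lab A j) \<in> temporal_edges G" "joins (fst (ps A ! j)) (vtx A j) (vtx A (Suc j))"
  using path[OF assms(1)] assms(2) nth_mem[of j "ps A"] by (auto simp: temporal_path_def)

lemma forward:
  assumes "A < k" "j < len A" "present u (vtx A j) t" "before strict t (lab A j)"
  shows "present u (vtx A (Suc j)) (lab A j)"
  using assms edge[of A j] arrives.step unfolding present_def by metis

text \<open>Boarding path \<open>A\<close> once is enough: its labels are ordered, so every further
  edge can be taken after the preceding one.\<close>

lemma ride:
  assumes "A < k" "j < len A" "present u (vtx A j) t" "before strict t (lab A j)" "j < i" "i \<le> len A"
  shows "present u (vtx A i) (lab A (i - 1))"
  using assms(5,6)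
proof (induction i)
  case (Suc i)
  show ?case
  proof (cases "i = j")
    case True
    then show ?thesis using forward[OF assms(1-4)] by simp
  next
    case False
    with Suc have "present u (vtx A i) (lab A (i - 1))" "j < i" by auto
    then show ?thesis using forward[OF assms(1), of i] lab_mono[OF assms(1), of "i - 1" i] Suc by auto
  qed
qed simp

text \<open>The decomposition orients every temporal edge along the path that contains it. A walk in
  an undirected graph may use the edge against this orientation, whence the second
  alternative.\<close>

lemma last_edge:
  assumes "present u v t" "v \<noteq> u \<or> 0 < t"
  obtains A j t0 where "A < k" "j < len A" "lab A j = t" "before strict t0 t"
    "v = vtx A (Suc j) \<and> present u (vtx A j) t0 \<or> \<not> directed \<and> v = vtx A j \<and> present u (vtx A (Suc j)) t0"
proof -
  obtain h where "arrives strict G u h v t" using assms(1) by (auto simp: present_def)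
  then obtain h' w t0 e where w: "arrives strict G u h' w t0" "(e, t) \<in> temporal_edges G"
      "joins e w v" "before strict t0 t"
    by cases (use assms(2) in auto)
  obtain A j where A: "A < k" "j < len A" "ps A ! j = (e, t)"
  proof -
    obtain A where "A < k" "(e, t) \<in> set (ps A)" using cover w(2) by auto
    then show thesis using that by (auto simp: in_set_conv_nth)
  qed
  have "joins e (vtx A j) (vtx A (Suc j))" using edge(2)[OF A(1,2)] A(3) by simp
  from joins_unique[OF G w(2,3) this] show thesis
    using that[OF A(1,2), of t0] A(3) w by (auto simp: present_def)
qed

text \<open>Each path of the decomposition has fewer edges than there are vertices. This bounds the
  time for the reachability table in terms of \<open>k\<close>.\<close>

lemma card_temporal_edges: "card (temporal_edges G) \<le> k * card (verts G)"
proof -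
  have "card (temporal_edges G) \<le> card (\<Union>A<k. set (ps A))"
    using cover by (intro card_mono) auto
  also have "\<dots> \<le> (\<Sum>A<k. card (set (ps A)))" by (intro card_UN_le) simp
  also have "\<dots> \<le> (\<Sum>A<k. card (verts G))"
    using len_less by (intro sum_mono order_trans[OF card_length]) (simp add: less_imp_le)
  finally show ?thesis by simp
qed

section \<open>Suffixes inside a common out-neighbourhood, and junctions\<close>

definition good_from :: "'v set \<Rightarrow> nat \<Rightarrow> nat" where
  "good_from W A = (LEAST a. \<forall>j. a \<le> j \<and> j \<le> len A \<longrightarrow> vtx A j \<in> W)"

text \<open>The value \<open>Suc (len A)\<close> qualifies vacuously and stands for the empty
  suffix. As \<open>len A\<close> is smaller than the number \<open>n\<close> of vertices, there are
  \<open>n + 1\<close> possible starts per path.\<close>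

lemma good_from_le: "good_from W A \<le> Suc (len A)"
  unfolding good_from_def by (rule Least_le) auto

lemma good_from: "good_from W A \<le> j \<Longrightarrow> j \<le> len A \<Longrightarrow> vtx A j \<in> W"
  unfolding good_from_def
  using LeastI[where k = "Suc (len A)" and P = "\<lambda>a. \<forall>j. a \<le> j \<and> j \<le> len A \<longrightarrow> vtx A j \<in> W"]
  by (meson not_less_eq_eq order_trans)

text \<open>Otherwise the suffix could start one position earlier. This missing vertex is what the
  later arguments contradict: as soon as everybody in \<open>U\<close> reaches it, it would belong
  to \<open>W\<close>.\<close>

lemma before_good_from:
  assumes "0 < good_from W A"
  shows "vtx A (good_from W A - 1) \<notin> W"
proof
  assume *: "vtx A (good_from W A - 1) \<in> W"
  have "\<forall>j. good_from W A - 1 \<le> j \<and> j \<le> len A \<longrightarrow> vtx A j \<in> W"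
  proof (intro allI impI)
    fix j assume j: "good_from W A - 1 \<le> j \<and> j \<le> len A"
    show "vtx A j \<in> W"
      using * j good_from[of W A j] by (cases "j = good_from W A - 1") auto
  qed
  then have "good_from W A \<le> good_from W A - 1"
    unfolding good_from_def by (rule Least_le)
  with assms show False by simp
qed

definition suffixes :: "(nat \<Rightarrow> nat) \<Rightarrow> 'v set" where
  "suffixes a = {vtx A j | A j. A < k \<and> a A \<le> j \<and> j \<le> len A}"

text \<open>\<open>transfers A i B j\<close>: whoever has travelled along path \<open>A\<close> up to its \<open>i\<close>-th vertex can get onto
  path \<open>B\<close> so as to travel along it up to its \<open>j\<close>-th vertex.\<close>

inductive transfers :: "nat \<Rightarrow> nat \<Rightarrow> nat \<Rightarrow> nat \<Rightarrow> bool" for A i where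
  refl: "transfers A i A i"
| stay: "transfers A i B j \<Longrightarrow> j < len B \<Longrightarrow> transfers A i B (Suc j)"
| change: "transfers A i B j \<Longrightarrow> 0 < j \<Longrightarrow> C < k \<Longrightarrow> j' < len C \<Longrightarrow> vtx B j = vtx C j' \<Longrightarrow>
    before strict (lab B (j - 1)) (lab C j') \<Longrightarrow> transfers A i C (Suc j')"

lemma transfers_trans:
  assumes "transfers B j C l" "transfers A i B j"
  shows "transfers A i C l"
  using assms by (induction rule: transfers.induct) (auto intro: transfers.stay transfers.change)

lemma transfers_along: "i \<le> j \<Longrightarrow> j \<le> len A \<Longrightarrow> transfers A i A j"
proof (induction j)
  case (Suc j)
  then show ?case by (cases "i = Suc j") (auto intro: transfers.intros)
qed (auto intro: transfers.refl)

text \<open>Only the time of presence is bounded by the label of the edge into position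
  \<open>i\<close>; that edge itself may not have been used. This covers a traveller who waits at
  position \<open>i\<close> in order to traverse the edge backwards.\<close>

definition on :: "'v \<Rightarrow> nat \<Rightarrow> nat \<Rightarrow> bool" where
  "on u A i \<longleftrightarrow> A < k \<and> 0 < i \<and> i \<le> len A \<and> (\<exists>t. t \<le> lab A (i - 1) \<and> present u (vtx A i) t)"

lemma on_transfers: "transfers A i B j \<Longrightarrow> on u A i \<Longrightarrow> on u B j"
proof (induction rule: transfers.induct)
  case (stay B j)
  then obtain t where t: "B < k" "0 < j" "t \<le> lab B (j - 1)" "present u (vtx B j) t" by (auto simp: on_def)
  then have "before strict t (lab B j)"
    using before_le_trans lab_mono[of B "j - 1" j] stay.hyps(2) by (meson diff_less less_numeral_extra(1))
  from forward[OF t(1) stay.hyps(2) t(4) this] show ?case using t stay.hyps by (auto simp: on_def)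
next
  case (change B j C j')
  then obtain t where t: "t \<le> lab B (j - 1)" "present u (vtx B j) t" by (auto simp: on_def)
  then have "before strict t (lab C j')" using before_le_trans change.hyps by blast
  from forward[OF change.hyps(3,4) _ this] show ?case using t change.hyps by (auto simp: on_def)
qed

text \<open>Meaningful only if \<open>v\<close> lies on path \<open>A\<close>, where it occurs once;
  \<open>outs\<close> therefore checks that the vertex at this position is \<open>v\<close>.\<close>

definition pos :: "nat \<Rightarrow> 'v \<Rightarrow> nat" where
  "pos A v = (LEAST j. vtx A j = v)"

lemma pos_vtx: "A < k \<Longrightarrow> j \<le> len A \<Longrightarrow> pos A (vtx A j) = j"
  unfolding pos_def
  using vtx_inj[of A j] by (intro Least_equality) (auto intro: ccontr simp: not_le, metis less_imp_le nle_le order_trans)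

definition outs :: "'v \<Rightarrow> nat \<Rightarrow> nat set" where
  "outs v t = {A. A < k \<and> pos A v < len A \<and> vtx A (pos A v) = v \<and> lab A (pos A v) = t}"

text \<open>The position \<open>a B - 1\<close> is that of the last vertex before the suffix of
  \<open>B\<close>, the one known to lie outside the common out-neighbourhood.\<close>

definition targets :: "(nat \<Rightarrow> nat) \<Rightarrow> nat \<Rightarrow> nat \<Rightarrow> nat set" where
  "targets a A i = {B. B < k \<and> 0 < a B \<and> transfers A i B (a B - 1)}"

text \<open>The condition mentions only the starts \<open>a\<close>, neither \<open>U\<close> nor
  its common out-neighbourhood. Hence all out-neighbourhoods with the same starts draw their
  remaining vertices from one set, whose size can be bounded.\<close>

definition junction :: "(nat \<Rightarrow> nat) \<Rightarrow> 'v \<Rightarrow> nat \<Rightarrow> bool" where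
  "junction a v t \<longleftrightarrow> strict \<and> outs v t \<noteq> {} \<and> (\<forall>A \<in> outs v t. Suc (pos A v) < a A) \<and>
     (\<Inter>A\<in>outs v t. targets a A (Suc (pos A v))) = {}"

definition junctions :: "(nat \<Rightarrow> nat) \<Rightarrow> 'v set" where
  "junctions a = {v \<in> verts G. \<exists>t. junction a v t}"

text \<open>Let \<open>t\<close> be the time at which the last member of \<open>U\<close> gets to \<open>v\<close>. Every path leaving \<open>v\<close> later
  than \<open>t\<close> would take all of \<open>U\<close> along, so \<open>t\<close> is the label of an edge leaving \<open>v\<close> on some path, and
  those who are late have traversed such an edge backwards.\<close>

lemma common_minus_suffixes:
  assumes U: "U \<subseteq> verts G" "\<not> U \<subseteq> {v}" and v: "v \<in> common strict G U"
    and a: "\<And>A. A < k \<Longrightarrow> a A = good_from (common strict G U) A" and nv: "v \<notin> suffixes a"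
  shows "v \<in> junctions a"
proof -
  let ?W = "common strict G U"
  have finU: "finite (U - {v})" using U G by (auto simp: temporal_graph_def intro: finite_subset)
  define early where "early u = (LEAST t. present u v t)" for u
  have early: "present u v (early u)" if "u \<in> U" for u
    unfolding early_def using v that reaches_present by (auto simp: common_def intro: LeastI_ex)
  define t where "t = Max (early ` (U - {v}))"
  have le_t: "early u \<le> t" if "u \<in> U" "u \<noteq> v" for u
    using that finU by (auto simp: t_def)
  obtain u0 where u0: "u0 \<in> U" "u0 \<noteq> v" "early u0 = t"
  proof -
    have "t \<in> early ` (U - {v})" unfolding t_def using finU U by (intro Max_in) auto
    then show thesis using that by auto
  qed
  \<comment> \<open>Any path through \<open>v\<close> continues at least to the missing vertex
    before its suffix: \<open>v\<close> is in the common out-neighbourhood but in no suffix, so it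
    comes strictly earlier than that vertex.\<close>
  have bad: "Suc j < a A \<and> j < len A" if "A < k" "j \<le> len A" "vtx A j = v" for A j
  proof -
    have "j < a A" using nv that by (auto simp: suffixes_def not_le[symmetric])
    moreover have "j \<noteq> a A - 1"
      using before_good_from[of ?W A] v that a \<open>j < a A\<close> by auto
    ultimately show ?thesis using good_from_le[of ?W A] a that by force
  qed
  have late: "\<not> before strict t (lab A j)" if A: "A < k" "j \<le> len A" "vtx A j = v" for A j
  proof
    assume b: "before strict t (lab A j)"
    have aA: "Suc j < a A" "j < len A" "a A - 1 \<le> len A"
      using bad[OF A] good_from_le[of ?W A] a A by auto
    have "reaches strict G u (vtx A (a A - 1))" if u: "u \<in> U" for u
    proof -
      obtain t' where "present u v t'" "t' \<le> t"
      proof (cases "u = v")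
        case True
        then show thesis using that[of 0] present_start u U by auto
      qed (use that early le_t u in blast)
      then show ?thesis
        using ride[OF A(1) aA(2), of u t' "a A - 1"] A(3) b before_le_trans[of t' t] aA
        by (fastforce simp: reaches_present)
    qed
    then have "vtx A (a A - 1) \<in> ?W" using vtx_verts A aA by (auto simp: common_def)
    moreover have "vtx A (a A - 1) \<notin> ?W" using before_good_from[of ?W A] a A aA by auto
    ultimately show False by simp
  qed
  \<comment> \<open>Entering \<open>v\<close> along a path would allow that path to be continued in
    time, against \<open>late\<close>. After entering \<open>v\<close> backwards, the non-strict
    setting would even allow the same edge to be taken forwards, so only the strict case
    remains.\<close>
  have last_step: "strict \<and> (\<exists>A \<in> outs v t. on u A (Suc (pos A v)))" if u: "u \<in> U" "u \<noteq> v" "early u = t" for u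
  proof -
    have "present u v t" using early u by blast
    then obtain A j t0 where A: "A < k" "j < len A" "lab A j = t" "before strict t0 t"
      and c: "v = vtx A (Suc j) \<and> present u (vtx A j) t0 \<or> \<not> directed \<and> v = vtx A j \<and> present u (vtx A (Suc j)) t0"
      using last_edge u by metis
    from c show ?thesis
    proof
      assume f: "v = vtx A (Suc j) \<and> present u (vtx A j) t0"
      then have "Suc j < len A" using bad[of A "Suc j"] A by auto
      then show ?thesis using late[of A "Suc j"] lab_mono[of A j "Suc j"] A f by auto
    next
      assume f: "\<not> directed \<and> v = vtx A j \<and> present u (vtx A (Suc j)) t0"
      then have "strict" using late[of A j] A by (auto simp: before_def split: if_splits)
      moreover have "pos A v = j" using pos_vtx f A by simp
      moreover have "on u A (Suc j)"
        using f A(1,2,3) before_imp_le[OF A(4)] by (auto simp: on_def)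
      moreover have "A \<in> outs v t" using f A \<open>pos A v = j\<close> by (simp add: outs_def)
      ultimately show ?thesis by blast
    qed
  qed
  \<comment> \<open>Those who are at \<open>v\<close> before time \<open>t\<close> take an edge that
    leaves \<open>v\<close> at time \<open>t\<close>. Those who arrive at time \<open>t\<close>
    itself came backwards over such an edge and were at its other end even earlier.\<close>
  have board: "\<exists>A \<in> outs v t. on u A (Suc (pos A v))" if u: "u \<in> U" for u
  proof (cases "u \<noteq> v \<and> early u = t")
    case False
    obtain A where A: "A \<in> outs v t" using last_step[OF u0] by auto
    have t0: "0 < t"
    proof (rule ccontr)
      assume "\<not> 0 < t"
      with early[OF u0(1)] u0(3) obtain h where "arrives strict G u0 h v 0" by (auto simp: present_def)
      with u0(2) arrives_time_0[OF G] show False by metis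
    qed
    obtain t' where t': "present u v t'" "t' < t"
    proof (cases "u = v")
      case True
      then show thesis using that[of 0] present_start u U t0 by auto
    qed (use that early le_t u False in \<open>metis le_neq_implies_less\<close>)
    have "present u (vtx A (Suc (pos A v))) t"
      using forward[of A "pos A v" u t'] A t' by (auto simp: outs_def before_def)
    then have "on u A (Suc (pos A v))" using A by (auto simp: outs_def on_def)
    then show ?thesis using A by blast
  qed (use last_step u in blast)
  have st: "strict" and ne: "outs v t \<noteq> {}" using last_step[OF u0] by blast+
  \<comment> \<open>A common target \<open>D\<close> would be reachable for all of \<open>U\<close>,
    whichever path each of them boards, up to the vertex before the suffix of
    \<open>D\<close>.\<close>
  have "(\<Inter>A\<in>outs v t. targets a A (Suc (pos A v))) = {}"
  proof (rule equals0I)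
    fix D assume D: "D \<in> (\<Inter>A\<in>outs v t. targets a A (Suc (pos A v)))"
    have DD: "D < k" "0 < a D" using D ne by (auto simp: targets_def)
    have "on u D (a D - 1)" if "u \<in> U" for u
      using board[OF that] D on_transfers by (auto simp: targets_def)
    moreover have "a D - 1 \<le> len D" using good_from_le[of ?W D] a DD by auto
    ultimately have "vtx D (a D - 1) \<in> ?W"
      unfolding common_def reaches_present on_def using vtx_verts DD by blast
    with before_good_from[of ?W D] a DD show False by auto
  qed
  moreover have "Suc (pos A v) < a A" if "A \<in> outs v t" for A
    using that bad[of A "pos A v"] by (auto simp: outs_def)
  ultimately have "junction a v t" using st ne unfolding junction_def by blast
  then show ?thesis using v by (auto simp: junctions_def common_def)
qed

text \<open>This is \<open>merge_count\<close> on the set of paths: the event at a junction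
  \<open>v\<close> involves the paths that leave \<open>v\<close> at its time, and the set of such a
  path consists of its targets. Strictness makes the label determine the position on a path, so one
  path cannot serve two junctions at the same time.\<close>

lemma card_junctions:
  assumes a: "\<And>A. A < k \<Longrightarrow> a A \<le> Suc (len A)"
  shows "2 ^ card (junctions a) \<le> k ^ k"
proof (cases strict)
  case False
  then have "junctions a = {}" unfolding junctions_def junction_def by blast
  then show ?thesis by (cases "k = 0") (simp_all add: Suc_leI)
next
  case True
  define t where "t v = (SOME t. junction a v t)" for v
  have t: "junction a v (t v)" if "v \<in> junctions a" for v
    unfolding t_def using that by (auto simp: junctions_def intro: someI_ex)
  define T where "T v = outs v (t v)" for v
  define F where "F v A = targets a A (Suc (pos A v))" for v A
  have "finite (junctions a)" using G by (auto simp: junctions_def temporal_graph_def)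
  then have "2 ^ card (junctions a) \<le> card {..<k} ^ card {..<k}"
  proof (rule merge_count[of "{..<k}" _ T F t, rotated])
    fix v assume v: "v \<in> junctions a"
    note j = t[OF v, unfolded junction_def]
    show "T v \<subseteq> {..<k}" "T v \<noteq> {}" "(\<Inter>A\<in>T v. F v A) = {}"
      using j by (auto simp: T_def F_def outs_def)
    {
      fix A assume A: "A \<in> T v"
      then have "Suc (pos A v) < a A" "A < k" using j by (auto simp: T_def outs_def)
      then have "transfers A (Suc (pos A v)) A (a A - 1)" "0 < a A" "A < k"
        using a[of A] by (auto intro!: transfers_along)
      then show "A \<in> F v A \<and> F v A \<subseteq> {..<k}" by (auto simp: F_def targets_def)
    }
    fix v' A assume v': "v' \<in> junctions a" and A: "A \<in> T v" "A \<in> T v'"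
    have *: "A < k" "pos A v < len A" "vtx A (pos A v) = v" "lab A (pos A v) = t v"
      "pos A v' < len A" "vtx A (pos A v') = v'" "lab A (pos A v') = t v'"
      using A by (auto simp: T_def outs_def)
    have less: "lab A i < lab A i'" if "i < i'" "i' < len A" for i i'
      using lab_mono[OF *(1) that] True by (simp add: before_def)
    {
      assume "t v = t v'"
      then show "v = v'" using * less[of "pos A v" "pos A v'"] less[of "pos A v'" "pos A v"]
        by (metis less_irrefl linorder_neqE_nat)
    }
    {
      fix B assume "t v' < t v" and B: "B \<in> T v"
      then have lt: "pos A v' < pos A v" using * less[of "pos A v" "pos A v'"]
        by (metis less_asym less_irrefl linorder_neqE_nat)
      \<comment> \<open>Path \<open>A\<close> leads from the earlier junction \<open>v'\<close> to
        \<open>v\<close>, arriving strictly before \<open>t v\<close>, so it is possible to change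
        to any path \<open>B\<close> that leaves \<open>v\<close> at that time.\<close>
      have "transfers A (Suc (pos A v')) A (pos A v)" using lt * by (intro transfers_along) auto
      moreover have "lab A (pos A v - 1) < t v" using less[of "pos A v - 1" "pos A v"] lt * by auto
      ultimately have "transfers A (Suc (pos A v')) B (Suc (pos B v))"
        using transfers.change[of A "Suc (pos A v')" A "pos A v" B "pos B v"] B * lt True
        by (auto simp: T_def outs_def before_def)
      then show "F v B \<subseteq> F v' A"
        by (auto simp: F_def targets_def intro: transfers_trans)
    }
  qed simp_all
  then show ?thesis by simp
qed

text \<open>Apart from degenerate cases, a common out-neighbourhood is given by the starts of its
  suffixes together with a subset of the junctions for these starts. The summand
  \<open>card (verts G) + 1\<close> accounts for intersections of at most one out-neighbourhood, to
  which \<open>common_minus_suffixes\<close> does not apply.\<close>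

theorem card_commons:
  "finite (common strict G ` Pow (verts G)) \<and>
   card (common strict G ` Pow (verts G)) \<le> (card (verts G) + 1) ^ k * k ^ k + card (verts G) + 1"
proof -
  let ?n = "card (verts G)"
  have V: "finite (verts G)" using G by (simp add: temporal_graph_def)
  define \<A> where "\<A> = {..<k} \<rightarrow>\<^sub>E {..?n}"
  define \<A>' where "\<A>' = {a \<in> \<A>. \<forall>A<k. a A \<le> Suc (len A)}"
  have finA: "finite \<A>" unfolding \<A>_def by (intro finite_PiE) auto
  have finJ: "finite (junctions a)" for a using V by (auto simp: junctions_def)
  define \<S> where "\<S> = (\<Union>a\<in>\<A>'. (\<lambda>Q. suffixes a \<union> Q) ` Pow (junctions a))"
  have "card \<S> \<le> (\<Sum>a\<in>\<A>'. card ((\<lambda>Q. suffixes a \<union> Q) ` Pow (junctions a)))"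
    unfolding \<S>_def using finA by (intro card_UN_le) (auto simp: \<A>'_def)
  also have "\<dots> \<le> (\<Sum>a\<in>\<A>'. k ^ k)"
  proof (intro sum_mono)
    fix a assume "a \<in> \<A>'"
    then have "2 ^ card (junctions a) \<le> k ^ k" by (intro card_junctions) (auto simp: \<A>'_def)
    moreover have "card ((\<lambda>Q. suffixes a \<union> Q) ` Pow (junctions a)) \<le> card (Pow (junctions a))"
      using finJ by (intro card_image_le) auto
    ultimately show "card ((\<lambda>Q. suffixes a \<union> Q) ` Pow (junctions a)) \<le> k ^ k"
      using finJ by (simp add: card_Pow)
  qed
  also have "\<dots> \<le> card \<A> * k ^ k" using finA by (simp add: card_mono \<A>'_def)
  also have "card \<A> = (?n + 1) ^ k" by (simp add: \<A>_def card_PiE)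
  finally have S: "card \<S> \<le> (?n + 1) ^ k * k ^ k" .
  have "common strict G ` Pow (verts G) \<subseteq>
    insert (common strict G {}) ((\<lambda>v. common strict G {v}) ` verts G) \<union> \<S>"
  proof
    fix W assume "W \<in> common strict G ` Pow (verts G)"
    then obtain U where U: "U \<subseteq> verts G" "W = common strict G U" by auto
    show "W \<in> insert (common strict G {}) ((\<lambda>v. common strict G {v}) ` verts G) \<union> \<S>"
    proof (cases "\<exists>v. U \<subseteq> {v}")
      case True
      then have "U = {} \<or> (\<exists>v. U = {v})" by auto
      with U show ?thesis by auto
    next
      case False
      define a where "a = restrict (good_from W) {..<k}"
      have "good_from W A \<le> ?n" if "A < k" for A
        using good_from_le[of W A] len_less[OF that] by simp
      then have a: "a \<in> \<A>'" using good_from_le by (auto simp: a_def \<A>'_def \<A>_def)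
      have "suffixes a \<subseteq> W" using good_from by (auto simp: suffixes_def a_def)
      moreover have "W - suffixes a \<subseteq> junctions a"
        using common_minus_suffixes[of U _ a] U False by (auto simp: a_def)
      ultimately have "W = suffixes a \<union> (W - suffixes a)" "W - suffixes a \<in> Pow (junctions a)" by auto
      then show ?thesis using a unfolding \<S>_def by blast
    qed
  qed
  moreover have finS: "finite \<S>" using finA finJ by (auto simp: \<S>_def \<A>'_def)
  ultimately have fin: "finite (common strict G ` Pow (verts G))"
    and "card (common strict G ` Pow (verts G)) \<le>
      card (insert (common strict G {}) ((\<lambda>v. common strict G {v}) ` verts G) \<union> \<S>)"
    using V by (auto intro: finite_subset card_mono)
  note this(2)
  also have "card (insert (common strict G {}) ((\<lambda>v. common strict G {v}) ` verts G) \<union> \<S>)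
      \<le> Suc ?n + card \<S>"
    using V card_image_le[OF V, of "\<lambda>v. common strict G {v}"]
    by (intro order_trans[OF card_Un_le] add_right_mono order_trans[OF card_insert_le_m1]) (auto simp: card_insert_if)
  finally show ?thesis using fin S by simp
qed

end

section \<open>Arithmetic behind the exponent of the running time\<close>

text \<open>From \<open>k \<le> 2 ^ (k - 1)\<close> follows
  \<open>k ^ k \<le> (2 * k) ^ (k - 1) \<le> n ^ (k - 1)\<close>. The second bound is Bernoulli's
  inequality for \<open>(1 - 1 / (n + 1)) ^ k\<close>, where \<open>2 * k \<le> n\<close> keeps the
  lower bound at 1/2 or more.\<close>

lemma linear_times_power_le:
  fixes n k :: nat
  assumes "1 \<le> k" "2 * k \<le> n"
  shows "n * k ^ k \<le> n ^ k" "(n + 1) ^ k \<le> 2 * n ^ k"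
proof -
  obtain j where j: "k = Suc j" using assms by (cases k) auto
  have "k \<le> 2 ^ j" using less_exp[of j] j by (simp only: Suc_leI)
  then have "k * k ^ j \<le> 2 ^ j * k ^ j" by simp
  also have "\<dots> = (2 * k) ^ j" by (simp add: power_mult_distrib)
  also have "\<dots> \<le> n ^ j" using assms by (intro power_mono) auto
  finally show "n * k ^ k \<le> n ^ k" using j by simp
  have "1 / 2 \<le> 1 + real k * (- 1 / (real n + 1))" using assms by (simp add: field_simps)
  also have "\<dots> \<le> (1 + (- 1 / (real n + 1))) ^ k"
    by (intro Bernoulli_inequality) (simp add: field_simps)
  also have "1 + (- 1 / (real n + 1)) = real n / (real n + 1)" by (simp add: field_simps)
  finally have "(real n + 1) ^ k \<le> 2 * real n ^ k" by (simp add: power_divide field_simps)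
  then have "real ((n + 1) ^ k) \<le> real (2 * n ^ k)" by (simp add: add.commute)
  then show "(n + 1) ^ k \<le> 2 * n ^ k" by (simp only: of_nat_le_iff)
qed

text \<open>For \<open>2 * k \<le> n\<close> the factor \<open>n\<close> saved by
  \<open>linear_times_power_le\<close> lowers the exponent from \<open>2 * k\<close> to
  \<open>2 * k - 1\<close>. For \<open>n < 2 * k\<close> the bound \<open>2 ^ n\<close> is at most
  \<open>4 ^ k\<close>, hence at most \<open>n ^ k\<close> once \<open>n\<close> is at least 4; the
  constant 8 is \<open>2 ^ 3\<close> and covers the smaller \<open>n\<close>.\<close>

lemma family_bound:
  fixes n k N :: nat
  assumes k: "1 \<le> k" and n: "2 \<le> n"
    and N: "N \<le> (n + 1) ^ k * k ^ k + n + 1" "N \<le> 2 ^ n"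
  shows "N * n ^ 2 \<le> 8 * n ^ (2 * k + 1)"
proof -
  have exp: "n ^ (2 * k + 1) = n ^ (2 * k - 1) * n ^ 2"
    using k by (subst power_add[symmetric]) (auto intro: arg_cong[where f = "(^) n"])
  have mono: "n ^ i \<le> n ^ j" if "i \<le> j" for i j using n that by (simp add: power_increasing)
  have "N \<le> 8 * n ^ (2 * k - 1)"
  proof (cases "2 * k \<le> n")
    case True
    note b = linear_times_power_le[OF k True]
    have split: "n ^ (2 * k - 1) * n = n ^ k * n ^ k"
      using k by (subst power_Suc2[symmetric], subst power_add[symmetric]) (simp add: mult_2)
    have "n * ((n + 1) ^ k * k ^ k) \<le> 2 * n ^ k * n ^ k"
      using mult_le_mono[OF b(2,1)] by (simp add: ac_simps)
    then have "n * ((n + 1) ^ k * k ^ k) \<le> n * (2 * n ^ (2 * k - 1))"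
      by (simp only: split mult.assoc mult.left_commute[of n 2] mult.commute[of n "n ^ _"])
    then have "n = 0 \<or> (n + 1) ^ k * k ^ k \<le> 2 * n ^ (2 * k - 1)" by (metis mult_le_cancel1 neq0_conv)
    then have "(n + 1) ^ k * k ^ k \<le> 2 * n ^ (2 * k - 1)" using n by auto
    moreover have "n \<le> n ^ (2 * k - 1)" using mono[of 1 "2 * k - 1"] k by simp
    ultimately show ?thesis using N n by linarith
  next
    case False
    show ?thesis
    proof (cases "n \<le> 3")
      case True
      then have "(2::nat) ^ n \<le> 8" using power_increasing[of n 3 "2::nat"] by simp
      moreover have "1 \<le> n ^ (2 * k - 1)" using n by simp
      ultimately show ?thesis using N(2) by linarith
    next
      case False
      have "(2::nat) ^ n \<le> 2 ^ (2 * k)" using \<open>\<not> 2 * k \<le> n\<close> by (intro power_increasing) auto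
      also have "\<dots> = 4 ^ k" by (simp add: power_mult)
      also have "\<dots> \<le> n ^ k" using False by (intro power_mono) auto
      also have "\<dots> \<le> n ^ (2 * k - 1)" using k by (intro mono) auto
      finally show ?thesis using N(2) by simp
    qed
  qed
  then have "N * n ^ 2 \<le> 8 * n ^ (2 * k - 1) * n ^ 2" by (rule mult_le_mono1)
  then show ?thesis unfolding exp by (simp only: mult.assoc)
qed

text \<open>Filling the reachability table takes time of order \<open>n ^ 2\<close> per temporal
  edge, and there are at most \<open>k * n\<close> of these. The factor \<open>k\<close> is absorbed
  through \<open>k \<le> 2 ^ (k - 1)\<close>.\<close>

lemma table_bound:
  fixes n k :: nat
  assumes k: "1 \<le> k" and n: "2 \<le> n"
  shows "k * n ^ 3 \<le> n ^ (2 * k + 1)"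
proof -
  obtain j where j: "k = Suc j" using k by (cases k) auto
  have "k \<le> 2 ^ j" using less_exp[of j] j by (simp only: Suc_leI)
  also have "\<dots> \<le> n ^ (2 * j)"
    using n power_mono[of 2 n j] power_increasing[of j "2 * j" n] by linarith
  finally have "k * n ^ 3 \<le> n ^ (2 * j) * n ^ 3" by simp
  also have "\<dots> = n ^ (2 * k + 1)" using j by (subst power_add[symmetric]) (rule arg_cong[where f = "(^) n"], simp)
  finally show ?thesis .
qed

section \<open>Random access machine programs\<close>

text \<open>The input registers \<open>0, \<dots>, 3m + 2\<close> are left alone. The registers above them hold 32
  interleaved infinite arrays, so that no multiplication by a variable is needed for addressing;
  \<open>f a j\<close> is the entry \<open>j\<close> of array \<open>a\<close>, and a scalar variable is entry \<open>0\<close> of its own array.\<close>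

definition layout :: "mem \<Rightarrow> (nat \<Rightarrow> nat \<Rightarrow> nat) \<Rightarrow> mem" where
  "layout inp f = (\<lambda>x. if x < 3 + 3 * inp 1 then inp x
     else f ((x - (3 + 3 * inp 1)) mod 32) ((x - (3 + 3 * inp 1)) div 32))"

definition base :: exp where
  "base = Plus (Const 3) (Plus (Reg (Const 1)) (Plus (Reg (Const 1)) (Reg (Const 1))))"

definition double :: "exp \<Rightarrow> exp" where
  "double e = Plus e e"

text \<open>Five doublings multiply the index by 32, the number of interleaved arrays.\<close>

definition get :: "nat \<Rightarrow> exp \<Rightarrow> exp" where
  "get a e = Reg (Plus (Plus base (Const a)) (double (double (double (double (double e))))))"

definition put :: "nat \<Rightarrow> exp \<Rightarrow> exp \<Rightarrow> com" where
  "put a e e' = Store (Plus (Plus base (Const a)) (double (double (double (double (double e)))))) e'"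

definition var :: "nat \<Rightarrow> exp" where
  "var a = Reg (Plus base (Const a))"

definition assign :: "nat \<Rightarrow> exp \<Rightarrow> com" where
  "assign a e = Store (Plus base (Const a)) e"

lemma layout_input: "x < 3 + 3 * inp 1 \<Longrightarrow> layout inp f x = inp x"
  by (simp add: layout_def)

lemma val_base [simp]: "val base (layout inp f) = 3 + 3 * inp 1"
  by (simp add: base_def layout_def)

lemma val_double [simp]: "val (double e) \<sigma> = 2 * val e \<sigma>"
  by (simp add: double_def)

lemma layout_cell: "a < 32 \<Longrightarrow> layout inp f (3 + 3 * inp 1 + a + 32 * j) = f a j"
  by (simp add: layout_def)

lemma layout_cell_0: "a < 32 \<Longrightarrow> layout inp f (3 + 3 * inp 1 + a) = f a 0"
  using layout_cell[of a inp f 0] by simp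

lemma layout_update:
  assumes "a < 32"
  shows "(layout inp f)(3 + 3 * inp 1 + a + 32 * j := y) = layout inp (f(a := (f a)(j := y)))"
proof
  fix x
  show "((layout inp f)(3 + 3 * inp 1 + a + 32 * j := y)) x = layout inp (f(a := (f a)(j := y))) x"
  proof (cases "x < 3 + 3 * inp 1")
    case False
    define z where "z = x - (3 + 3 * inp 1)"
    have "x = 3 + 3 * inp 1 + a + 32 * j \<longleftrightarrow> z mod 32 = a \<and> z div 32 = j"
      using False assms unfolding z_def by auto
    then show ?thesis using False by (auto simp: layout_def z_def[symmetric])
  qed (auto simp: layout_def)
qed

lemma layout_update_0:
  "a < 32 \<Longrightarrow> (layout inp f)(3 + 3 * inp 1 + a := y) = layout inp (f(a := (f a)(0 := y)))"
  using layout_update[of a inp f 0 y] by simp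

lemma val_get [simp]: "a < 32 \<Longrightarrow> val (get a e) (layout inp f) = f a (val e (layout inp f))"
  using layout_cell[of a inp f] by (simp add: get_def)

lemma val_var [simp]: "a < 32 \<Longrightarrow> val (var a) (layout inp f) = f a 0"
  using layout_cell_0[of a inp f] by (simp add: var_def)

lemma layout_low [simp]:
  "layout inp f 0 = inp 0" "layout inp f (Suc 0) = inp 1" "layout inp f 2 = inp 2"
  by (simp_all add: layout_def)

section \<open>Program rules that bound the running time\<close>

text \<open>Total correctness with a time bound. The postcondition may itself be a
  \<open>runs\<close> statement, which is how sequences are handled without naming intermediate
  states.\<close>

definition runs :: "mem \<Rightarrow> com \<Rightarrow> (nat \<Rightarrow> nat \<Rightarrow> nat) \<Rightarrow> nat \<Rightarrow> ((nat \<Rightarrow> nat \<Rightarrow> nat) \<Rightarrow> bool) \<Rightarrow> bool" where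
  "runs inp P f T Q \<longleftrightarrow> (\<exists>t g. exec P (layout inp f) t (layout inp g) \<and> t \<le> T \<and> Q g)"

text \<open>Meaningful for programs without loops only: a loop counts as \<open>0\<close>.\<close>

fun straight_cost :: "com \<Rightarrow> nat" where
  "straight_cost Skip = 1"
| "straight_cost (Store a b) = 1 + exp_cost a + exp_cost b"
| "straight_cost (Seq P Q) = straight_cost P + straight_cost Q"
| "straight_cost (Cond p P Q) = 1 + test_cost p + straight_cost P + straight_cost Q"
| "straight_cost (While p P) = 0"

lemma runs_mono: "runs inp P f T Q \<Longrightarrow> T \<le> T' \<Longrightarrow> (\<And>g. Q g \<Longrightarrow> Q' g) \<Longrightarrow> runs inp P f T' Q'"
  unfolding runs_def by (meson le_trans)

lemma runs_seq:
  assumes "runs inp P f T (\<lambda>g. runs inp P' g T' Q)"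
  shows "runs inp (Seq P P') f (T + T') Q"
  using assms unfolding runs_def by (meson add_mono exec.seq)

lemma runs_cond:
  assumes "holds p (layout inp f) \<Longrightarrow> runs inp P f T Q" "\<not> holds p (layout inp f) \<Longrightarrow> runs inp P' f T' Q"
  shows "runs inp (Cond p P P') f (1 + test_cost p + T + T') Q"
proof (cases "holds p (layout inp f)")
  case True
  with assms obtain t g where "exec P (layout inp f) t (layout inp g)" "t \<le> T" "Q g"
    by (auto simp: runs_def)
  with True show ?thesis unfolding runs_def
    by (intro exI[of _ "1 + test_cost p + t"] exI[of _ g] conjI exec.cond_true) auto
next
  case False
  with assms obtain t g where "exec P' (layout inp f) t (layout inp g)" "t \<le> T'" "Q g"
    by (auto simp: runs_def)
  with False show ?thesis unfolding runs_def
    by (intro exI[of _ "1 + test_cost p + t"] exI[of _ g] conjI exec.cond_false) auto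
qed

lemma runs_put:
  assumes "a < 32" "Q (f(a := (f a)(val e (layout inp f) := val e' (layout inp f))))"
  shows "runs inp (put a e e') f (straight_cost (put a e e')) Q"
  unfolding runs_def
proof (intro exI conjI)
  let ?c = "Plus (Plus base (Const a)) (double (double (double (double (double e)))))"
  have v: "val ?c (layout inp f) = 3 + 3 * inp 1 + a + 32 * val e (layout inp f)" by simp
  show "exec (put a e e') (layout inp f) (straight_cost (put a e e'))
      (layout inp (f(a := (f a)(val e (layout inp f) := val e' (layout inp f)))))"
    using exec.store[of ?c e' "layout inp f"] assms(1)
    unfolding v layout_update[OF assms(1)] put_def by simp
qed (use assms in auto)

lemma runs_assign:
  assumes "a < 32" "Q (f(a := (f a)(0 := val e (layout inp f))))"
  shows "runs inp (assign a e) f (straight_cost (assign a e)) Q"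
  unfolding runs_def
proof (intro exI conjI)
  have v: "val (Plus base (Const a)) (layout inp f) = 3 + 3 * inp 1 + a" by simp
  show "exec (assign a e) (layout inp f) (straight_cost (assign a e))
      (layout inp (f(a := (f a)(0 := val e (layout inp f)))))"
    using exec.store[of "Plus base (Const a)" e "layout inp f"]
    unfolding v layout_update_0[OF assms(1)] assign_def by simp
qed (use assms in auto)

lemma runs_skip: "Q f \<Longrightarrow> runs inp Skip f (straight_cost Skip) Q"
  unfolding runs_def by (intro exI[of _ 1] exI[of _ f] conjI exec.skip) auto

lemma runs_straight_seq:
  "runs inp P f (straight_cost P) (\<lambda>g. runs inp P' g (straight_cost P') Q) \<Longrightarrow>
   runs inp (Seq P P') f (straight_cost (Seq P P')) Q"
  using runs_seq by simp

lemma runs_straight_cond: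
  "(holds p (layout inp f) \<Longrightarrow> runs inp P f (straight_cost P) Q) \<Longrightarrow>
   (\<not> holds p (layout inp f) \<Longrightarrow> runs inp P' f (straight_cost P') Q) \<Longrightarrow>
   runs inp (Cond p P P') f (straight_cost (Cond p P P')) Q"
  using runs_cond by simp

lemmas runs_straight = runs_straight_seq runs_straight_cond runs_assign runs_put runs_skip

text \<open>The index of \<open>I\<close> counts the completed iterations and \<open>M\<close>
  bounds their number; the summand 1 in \<open>M + 1\<close> pays for the last, failing
  test.\<close>

lemma runs_while:
  assumes "I 0 f"
    and step: "\<And>j g. I j g \<Longrightarrow> holds p (layout inp g) \<Longrightarrow> j < M \<and> runs inp P g T (I (Suc j))"
  shows "runs inp (While p P) f ((M + 1) * (T + 1 + test_cost p)) (\<lambda>g. \<exists>j. I j g \<and> \<not> holds p (layout inp g))"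
proof -
  have "I j g \<Longrightarrow> runs inp (While p P) g ((M - j + 1) * (T + 1 + test_cost p))
      (\<lambda>g. \<exists>j. I j g \<and> \<not> holds p (layout inp g))" for j g
  proof (induction "M - j" arbitrary: j g rule: less_induct)
    case less
    show ?case
    proof (cases "holds p (layout inp g)")
      case False
      then show ?thesis using less.prems exec.while_false[OF False] unfolding runs_def
        by (intro exI[of _ "1 + test_cost p"] exI[of _ g]) auto
    next
      case True
      with step[OF less.prems] obtain t h
        where j: "j < M" and h: "exec P (layout inp g) t (layout inp h)" "t \<le> T" "I (Suc j) h"
        by (auto simp: runs_def)
      have "M - Suc j < M - j" using j by simp
      from less.hyps[OF this h(3)] obtain t' h'
        where h': "exec (While p P) (layout inp h) t' (layout inp h')"
          "t' \<le> (M - Suc j + 1) * (T + 1 + test_cost p)" "\<exists>j. I j h' \<and> \<not> holds p (layout inp h')"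
        unfolding runs_def by blast
      have "(M - j + 1) * (T + 1 + test_cost p) = (M - Suc j + 1) * (T + 1 + test_cost p) + (T + 1 + test_cost p)"
        using j by (simp add: Suc_diff_Suc[symmetric])
      with h(2) h'(2) have "1 + test_cost p + t + t' \<le> (M - j + 1) * (T + 1 + test_cost p)" by linarith
      with exec.while_true[OF True h(1) h'(1)] h'(3) show ?thesis unfolding runs_def by blast
    qed
  qed
  from this[OF assms(1)] show ?thesis by simp
qed

definition for_loop :: "nat \<Rightarrow> exp \<Rightarrow> com \<Rightarrow> com" where
  "for_loop a e P = Seq (assign a (Const 0))
     (While (Less (var a) e) (Seq P (assign a (Plus (var a) (Const 1)))))"

definition for_cost :: "nat \<Rightarrow> exp \<Rightarrow> nat" where
  "for_cost a e = straight_cost (assign a (Const 0)) + 1 + test_cost (Less (var a) e) +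
     straight_cost (assign a (Plus (var a) (Const 1)))"

text \<open>The invariant speaks of the memory in which the counter already holds \<open>j\<close>.
  The body hands the counter back unchanged, and the invariant has to hold again after the
  increment.\<close>

lemma runs_for:
  assumes a: "a < 32" and init: "I 0 (f(a := (f a)(0 := 0)))"
    and I: "\<And>j g. I j g \<Longrightarrow> g a 0 = j \<and> val e (layout inp g) = N"
    and step: "\<And>j g. j < N \<Longrightarrow> I j g \<Longrightarrow>
      runs inp P g T (\<lambda>h. h a 0 = j \<and> I (Suc j) (h(a := (h a)(0 := Suc j))))"
  shows "runs inp (for_loop a e P) f ((N + 1) * (T + for_cost a e)) (I N)"
proof -
  let ?inc = "assign a (Plus (var a) (Const 1))"
  let ?J = "\<lambda>j g. I j g \<and> j \<le> N"
  have "runs inp (While (Less (var a) e) (Seq P ?inc)) (f(a := (f a)(0 := 0)))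
      ((N + 1) * (T + straight_cost ?inc + 1 + test_cost (Less (var a) e)))
      (\<lambda>g. \<exists>j. ?J j g \<and> \<not> holds (Less (var a) e) (layout inp g))"
  proof (rule runs_while)
    fix j g assume "?J j g" "holds (Less (var a) e) (layout inp g)"
    then have j: "j < N" "I j g" using I[of j g] a by auto
    from step[OF this] have "runs inp (Seq P ?inc) g (T + straight_cost ?inc) (?J (Suc j))"
      using a j by (intro runs_seq) (erule runs_mono, simp, intro runs_assign, auto)
    with j show "j < N \<and> runs inp (Seq P ?inc) g (T + straight_cost ?inc) (?J (Suc j))" by simp
  qed (use init in simp)
  then have "runs inp (While (Less (var a) e) (Seq P ?inc)) (f(a := (f a)(0 := 0)))
      ((N + 1) * (T + straight_cost ?inc + 1 + test_cost (Less (var a) e))) (I N)"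
  proof (rule runs_mono[OF _ order_refl])
    fix g assume "\<exists>j. ?J j g \<and> \<not> holds (Less (var a) e) (layout inp g)"
    then obtain j where j: "I j g" "j \<le> N" "\<not> g a 0 < val e (layout inp g)" using a by auto
    with I[OF j(1)] have "j = N" by simp
    with j show "I N g" by simp
  qed
  then have "runs inp (for_loop a e P) f (straight_cost (assign a (Const 0)) +
      (N + 1) * (T + straight_cost ?inc + 1 + test_cost (Less (var a) e))) (I N)"
    unfolding for_loop_def using a by (intro runs_seq runs_assign) auto
  then show ?thesis by (rule runs_mono) (auto simp: for_cost_def algebra_simps)
qed

abbreviation (input) "nE \<equiv> Reg (Const 0)"
abbreviation (input) "mE \<equiv> Reg (Const 1)"
abbreviation (input) "sE \<equiv> Reg (Const 2)"

abbreviation (input) "POW \<equiv> 0 :: nat"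
abbreviation (input) "ROW \<equiv> 1 :: nat"
abbreviation (input) "ARR \<equiv> 2 :: nat"
abbreviation (input) "LST \<equiv> 3 :: nat"
abbreviation (input) "FLG \<equiv> 4 :: nat"
abbreviation (input) "vZ \<equiv> 5 :: nat"
abbreviation (input) "vP \<equiv> 6 :: nat"
abbreviation (input) "vQ \<equiv> 7 :: nat"
abbreviation (input) "vT \<equiv> 8 :: nat"
abbreviation (input) "vU \<equiv> 9 :: nat"
abbreviation (input) "vV \<equiv> 10 :: nat"
abbreviation (input) "vE \<equiv> 11 :: nat"
abbreviation (input) "vR \<equiv> 12 :: nat"
abbreviation (input) "vI \<equiv> 13 :: nat"
abbreviation (input) "vN \<equiv> 14 :: nat"
abbreviation (input) "vC \<equiv> 15 :: nat"
abbreviation (input) "vX \<equiv> 16 :: nat"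
abbreviation (input) "vCnt \<equiv> 17 :: nat"
abbreviation (input) "vY \<equiv> 18 :: nat"
abbreviation (input) "vOk \<equiv> 19 :: nat"
abbreviation (input) "vAns \<equiv> 20 :: nat"
abbreviation (input) "vFull \<equiv> 21 :: nat"

section \<open>Set operations on bit codes by addition, subtraction and comparison\<close>

lemma encode_remove: "finite S \<Longrightarrow> j \<in> S \<Longrightarrow> set_encode S = 2 ^ j + set_encode (S - {j})"
  using set_encode_insert[of "S - {j}" j] by (simp add: insert_absorb)

lemma encode_lessThan: "set_encode {..<j} + 1 = 2 ^ j"
  by (induction j) (auto simp: lessThan_Suc)

lemma encode_mono: "finite T \<Longrightarrow> S \<subseteq> T \<Longrightarrow> set_encode S \<le> set_encode T"
  unfolding set_encode_def by (simp add: sum_mono2)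

text \<open>Consequently, a code of a subset of \<open>{..<Suc j}\<close> has bit \<open>j\<close>
  exactly if it is not below \<open>2 ^ j\<close>. This is how the machine reads bits.\<close>

lemma encode_less: "S \<subseteq> {..<j} \<Longrightarrow> set_encode S < 2 ^ j"
  using encode_mono[of "{..<j}" S] encode_lessThan[of j] by simp

lemma encode_eq_0: "finite S \<Longrightarrow> set_encode S = 0 \<longleftrightarrow> S = {}"
  using set_encode_eq[of S "{}"] by simp

text \<open>Bits are consumed from the top: the counter \<open>vT\<close> runs upwards, but the
  power compared with has exponent \<open>n - 1 - vT\<close>. A bit that is present is subtracted,
  so the next comparison again sees the leading position.\<close>

definition and_step :: com where
  "and_step = (let pw = get POW (Minus (Minus nE (Const 1)) (var vT)) in
     Seq (Cond (Less (var vP) pw) Skip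
            (Seq (Cond (Less (var vQ) pw) Skip (assign vZ (Plus (var vZ) pw)))
                 (assign vP (Minus (var vP) pw))))
         (Cond (Less (var vQ) pw) Skip (assign vQ (Minus (var vQ) pw))))"

definition and_com :: "exp \<Rightarrow> exp \<Rightarrow> com" where
  "and_com e e' = Seq (assign vP e) (Seq (assign vQ e') (Seq (assign vZ (Const 0))
     (for_loop vT nE and_step)))"

text \<open>A coefficient rather than a running time: the time is this constant multiplied by
  \<open>n + 1\<close>. The cost constants of the larger programs are coefficients of the same kind,
  so that each time bound is a single product.\<close>

definition and_cost :: "exp \<Rightarrow> exp \<Rightarrow> nat" where
  "and_cost e e' = straight_cost (assign vP e) + straight_cost (assign vQ e') +
     straight_cost (assign vZ (Const 0)) + straight_cost and_step + for_cost vT nE"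

lemma runs_and:
  assumes n: "inp 0 = n" and pow: "\<forall>v<n. f POW v = 2 ^ v"
    and S: "S \<subseteq> {..<n}" "val e (layout inp f) = set_encode S"
    and S': "S' \<subseteq> {..<n}" "val e' (layout inp (f(vP := (f vP)(0 := set_encode S)))) = set_encode S'"
  shows "runs inp (and_com e e') f ((n + 1) * and_cost e e')
    (\<lambda>g. g vZ 0 = set_encode (S \<inter> S') \<and> (\<forall>a. a \<notin> {vP, vQ, vZ, vT} \<longrightarrow> g a = f a))"
proof -
  \<comment> \<open>After \<open>j\<close> steps the elements from \<open>n - j\<close> on have been
    moved out of \<open>vP\<close> and \<open>vQ\<close>, and their common ones are in
    \<open>vZ\<close>.\<close>
  define I where "I j g \<longleftrightarrow> g vT 0 = j \<and> g vP 0 = set_encode (S \<inter> {..<n - j}) \<and>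
    g vQ 0 = set_encode (S' \<inter> {..<n - j}) \<and> g vZ 0 = set_encode (S \<inter> S' \<inter> {n - j..<n}) \<and>
    (\<forall>a. a \<notin> {vP, vQ, vZ, vT} \<longrightarrow> g a = f a)" for j g
  have fin: "finite S" "finite S'" using S S' finite_subset by auto
  have S0: "S \<inter> {..<n} = S" "S' \<inter> {..<n} = S'" using S S' by auto
  define f' where "f' = f(vP := (f vP)(0 := set_encode S), vQ := (f vQ)(0 := set_encode S'), vZ := (f vZ)(0 := 0))"
  have loop: "runs inp (for_loop vT nE and_step) f' ((n + 1) * (straight_cost and_step + for_cost vT nE)) (I n)"
  proof (rule runs_for[where I = I])
    show "I 0 (f'(vT := (f' vT)(0 := 0)))" using S0 by (auto simp: I_def f'_def)
  next
    fix j g assume "I j g"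
    then show "g vT 0 = j \<and> val nE (layout inp g) = n" using n by (simp add: I_def)
  next
    fix j g assume j: "j < n" and I: "I j g"
    define i where "i = n - Suc j"
    have i: "n - j = Suc i" "i < n" "n - 1 - j = i" using j by (auto simp: i_def)
    have pw: "val (get POW (Minus (Minus nE (Const 1)) (var vT))) (layout inp (g(a := h))) = 2 ^ i"
      if "a \<in> {vP, vQ, vZ}" for a h
      using that I i n pow by (auto simp: I_def)
    have pw0: "val (get POW (Minus (Minus nE (Const 1)) (var vT))) (layout inp g) = 2 ^ i"
      using I i n pow by (auto simp: I_def)
    have bit: "S'' \<inter> {..<Suc i} = (if i \<in> S'' then insert i (S'' \<inter> {..<i}) else S'' \<inter> {..<i})" for S''
      by (auto simp: less_Suc_eq)
    have bit': "S'' \<inter> {i..<n} = (if i \<in> S'' then insert i (S'' \<inter> {Suc i..<n}) else S'' \<inter> {Suc i..<n})" for S''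
      using i by (auto simp: le_less Suc_le_eq)
    have P: "g vP 0 = set_encode (S \<inter> {..<Suc i})" "g vQ 0 = set_encode (S' \<inter> {..<Suc i})"
      "g vZ 0 = set_encode (S \<inter> S' \<inter> {Suc i..<n})" "g vT 0 = j" "inp 0 = n" "g POW i = 2 ^ i"
      and frame: "\<forall>a. a \<notin> {vP, vQ, vZ, vT} \<longrightarrow> g a = f a"
      using I i n pow by (auto simp: I_def)
    have lt: "set_encode (S \<inter> {..<i}) < 2 ^ i" "set_encode (S' \<inter> {..<i}) < 2 ^ i" "f POW i = 2 ^ i"
      using encode_less pow i by auto
    have idx: "n - Suc 0 - j = i" "n - Suc j = i" using i by auto
    have e: "set_encode (S \<inter> {..<Suc i}) = (if i \<in> S then 2 ^ i else 0) + set_encode (S \<inter> {..<i})"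
      "set_encode (S' \<inter> {..<Suc i}) = (if i \<in> S' then 2 ^ i else 0) + set_encode (S' \<inter> {..<i})"
      "set_encode (S \<inter> S' \<inter> {i..<n}) = (if i \<in> S \<and> i \<in> S' then 2 ^ i else 0) + set_encode (S \<inter> S' \<inter> {Suc i..<n})"
      unfolding bit bit' by (auto simp: set_encode_insert)
    show "runs inp and_step g (straight_cost and_step)
        (\<lambda>h. h vT 0 = j \<and> I (Suc j) (h(vT := (h vT)(0 := Suc j))))"
      unfolding and_step_def Let_def
      by (cases "i \<in> S"; cases "i \<in> S'"; intro runs_straight) (simp_all add: P I_def lt e idx frame)
  qed simp
  have "runs inp (and_com e e') f (straight_cost (assign vP e) + (straight_cost (assign vQ e') +
      (straight_cost (assign vZ (Const 0)) + (n + 1) * (straight_cost and_step + for_cost vT nE)))) (I n)"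
    unfolding and_com_def
    by (intro runs_seq runs_assign) (use loop S S' in \<open>simp_all add: f'_def\<close>)
  then show ?thesis
  proof (rule runs_mono)
    show "straight_cost (assign vP e) + (straight_cost (assign vQ e') +
      (straight_cost (assign vZ (Const 0)) + (n + 1) * (straight_cost and_step + for_cost vT nE)))
      \<le> (n + 1) * and_cost e e'"
      by (simp add: and_cost_def algebra_simps)
  next
    fix g assume "I n g"
    moreover have "S \<inter> S' \<inter> {0..<n} = S \<inter> S'" using S by auto
    ultimately show "g vZ 0 = set_encode (S \<inter> S') \<and> (\<forall>a. a \<notin> {vP, vQ, vZ, vT} \<longrightarrow> g a = f a)"
      by (simp add: I_def)
  qed
qed

definition pow_com :: com where
  "pow_com = Seq (put POW (Const 0) (Const 1))
     (for_loop vV nE (put POW (Plus (var vV) (Const 1)) (double (get POW (var vV)))))"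

definition pow_cost :: nat where
  "pow_cost = straight_cost (put POW (Const 0) (Const 1)) +
     straight_cost (put POW (Plus (var vV) (Const 1)) (double (get POW (var vV)))) + for_cost vV nE"

lemma runs_pow:
  assumes n: "inp 0 = n"
  shows "runs inp pow_com f ((n + 1) * pow_cost)
    (\<lambda>g. (\<forall>v\<le>n. g POW v = 2 ^ v) \<and> (\<forall>a. a \<notin> {POW, vV} \<longrightarrow> g a = f a))"
proof -
  define I where "I j g \<longleftrightarrow> g vV 0 = j \<and> (\<forall>v\<le>j. g POW v = 2 ^ v) \<and>
    (\<forall>a. a \<notin> {POW, vV} \<longrightarrow> g a = f a)" for j g
  let ?P = "put POW (Plus (var vV) (Const 1)) (double (get POW (var vV)))"
  define f' where "f' = f(POW := (f POW)(0 := 1))"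
  have "runs inp (for_loop vV nE ?P) f' ((n + 1) * (straight_cost ?P + for_cost vV nE)) (I n)"
  proof (rule runs_for[where I = I])
    fix j g assume "I j g"
    then show "g vV 0 = j \<and> val nE (layout inp g) = n" using n by (simp add: I_def)
  next
    fix j g assume "j < n" and I: "I j g"
    show "runs inp ?P g (straight_cost ?P) (\<lambda>h. h vV 0 = j \<and> I (Suc j) (h(vV := (h vV)(0 := Suc j))))"
      by (rule runs_put) (use I in \<open>simp_all add: I_def le_Suc_eq\<close>)
  qed (simp_all add: I_def f'_def)
  then have "runs inp pow_com f (straight_cost (put POW (Const 0) (Const 1)) +
      (n + 1) * (straight_cost ?P + for_cost vV nE)) (I n)"
    unfolding pow_com_def by (intro runs_seq runs_put) (simp_all add: f'_def)
  then show ?thesis by (rule runs_mono) (auto simp: I_def pow_cost_def algebra_simps)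
qed

section \<open>Closing the out-neighbourhoods under intersection\<close>

definition clique :: "nat \<Rightarrow> (nat \<Rightarrow> nat set) \<Rightarrow> nat set \<Rightarrow> bool" where
  "clique n R X \<longleftrightarrow> X \<subseteq> {..<n} \<and> (\<forall>u\<in>X. X \<subseteq> R u)"

definition max_clique :: "nat \<Rightarrow> (nat \<Rightarrow> nat set) \<Rightarrow> nat set \<Rightarrow> bool" where
  "max_clique n R X \<longleftrightarrow> clique n R X \<and> (\<forall>Y. clique n R Y \<and> X \<subseteq> Y \<longrightarrow> Y = X)"

definition meet :: "nat \<Rightarrow> (nat \<Rightarrow> nat set) \<Rightarrow> nat set \<Rightarrow> nat set" where
  "meet n R U = {v. v < n \<and> (\<forall>u\<in>U. v \<in> R u)}"

definition meets :: "nat \<Rightarrow> (nat \<Rightarrow> nat set) \<Rightarrow> nat set set" where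
  "meets n R = meet n R ` Pow {..<n}"

definition kernel :: "(nat \<Rightarrow> nat set) \<Rightarrow> nat set \<Rightarrow> nat set" where
  "kernel R W = {u \<in> W. W \<subseteq> R u}"

definition extendable :: "nat \<Rightarrow> (nat \<Rightarrow> nat set) \<Rightarrow> nat set \<Rightarrow> bool" where
  "extendable n R X \<longleftrightarrow> (\<exists>w \<in> meet n R X. w \<notin> X \<and> X \<subseteq> R w)"

lemma meet_insert: "meet n R (insert u U) = meet n R U \<inter> R u"
  by (auto simp: meet_def)

lemma meet_subset: "meet n R U \<subseteq> {..<n}"
  by (auto simp: meet_def)

lemma finite_meets: "finite (meets n R)"
  by (simp add: meets_def)

lemma card_meets_le: "card (meets n R) \<le> 2 ^ n"
  unfolding meets_def using card_image_le[of "Pow {..<n}" "meet n R"] by (simp add: card_Pow)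

lemma meets_closed: "W \<in> meets n R \<Longrightarrow> u < n \<Longrightarrow> W \<inter> R u \<in> meets n R"
  unfolding meets_def by (auto simp: meet_insert[symmetric])

text \<open>Intersecting with one out-neighbourhood at a time generates the whole family. This
  justifies a worklist that combines each listed set with single rows only.\<close>

lemma meets_least:
  assumes "{..<n} \<in> F" "\<And>W u. W \<in> F \<Longrightarrow> u < n \<Longrightarrow> W \<inter> R u \<in> F"
  shows "meets n R \<subseteq> F"
proof -
  have "meet n R U \<in> F" if "finite U" "U \<subseteq> {..<n}" for U
    using that
  proof (induction U)
    case empty
    have "meet n R {} = {..<n}" by (auto simp: meet_def)
    then show ?case using assms by simp
  qed (use assms in \<open>auto simp: meet_insert\<close>)
  then show ?thesis by (auto simp: meets_def intro: finite_subset)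
qed

text \<open>If a larger clique exists, any one of its additional vertices already extends
  \<open>X\<close>; by reflexivity, adding a single suitable vertex again gives a clique. Hence
  maximality is tested vertex by vertex.\<close>

lemma max_clique_iff:
  assumes "\<And>u. u < n \<Longrightarrow> u \<in> R u"
  shows "max_clique n R X \<longleftrightarrow> clique n R X \<and> \<not> extendable n R X"
proof
  assume X: "max_clique n R X"
  have "\<not> extendable n R X"
  proof
    assume "extendable n R X"
    then obtain w where w: "w \<in> meet n R X" "w \<notin> X" "X \<subseteq> R w" by (auto simp: extendable_def)
    then have "clique n R (insert w X)"
      using X assms by (auto simp: max_clique_def clique_def meet_def)
    with X w(2) show False unfolding max_clique_def by blast
  qed
  with X show "clique n R X \<and> \<not> extendable n R X" by (simp add: max_clique_def)
next
  assume X: "clique n R X \<and> \<not> extendable n R X"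
  then show "max_clique n R X"
    unfolding max_clique_def extendable_def clique_def meet_def by blast
qed

text \<open>Every kernel is a clique, and a maximal \<open>X\<close> is contained in the kernel of
  its common out-neighbourhood, hence equal to it. Kernels of other intersections may fail to be
  maximal, which is why the extension test appears on the right-hand side.\<close>

lemma ex_max_clique_iff:
  assumes R: "\<And>u. u < n \<Longrightarrow> u \<in> R u"
  shows "(\<exists>X. max_clique n R X \<and> P X) \<longleftrightarrow> (\<exists>W \<in> meets n R. \<not> extendable n R (kernel R W) \<and> P (kernel R W))"
proof
  assume "\<exists>X. max_clique n R X \<and> P X"
  then obtain X where X: "max_clique n R X" "P X" by blast
  let ?W = "meet n R X"
  have "clique n R (kernel R ?W)" by (auto simp: clique_def kernel_def meet_def)
  moreover have "X \<subseteq> kernel R ?W"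
    using X by (auto simp: max_clique_def clique_def kernel_def meet_def)
  ultimately have "kernel R ?W = X" using X by (auto simp: max_clique_def)
  moreover have "?W \<in> meets n R" using X by (auto simp: meets_def max_clique_def clique_def)
  ultimately show "\<exists>W \<in> meets n R. \<not> extendable n R (kernel R W) \<and> P (kernel R W)"
    using X max_clique_iff[OF R, of n X] by (intro bexI[of _ ?W]) auto
next
  assume "\<exists>W \<in> meets n R. \<not> extendable n R (kernel R W) \<and> P (kernel R W)"
  then obtain W where W: "W \<in> meets n R" "\<not> extendable n R (kernel R W)" "P (kernel R W)" by blast
  then have "clique n R (kernel R W)"
    by (auto simp: clique_def kernel_def meets_def meet_def)
  with W show "\<exists>X. max_clique n R X \<and> P X" using max_clique_iff[OF R, of n "kernel R W"] by blast
qed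

text \<open>For the current set \<open>W\<close>, coded in \<open>vC\<close>, the first loop over all vertices inserts the sets
  \<open>W \<inter> R u\<close> into the list and collects the kernel of \<open>W\<close> in \<open>vX\<close>, its size in \<open>vCnt\<close> and its
  common out-neighbourhood in \<open>vY\<close>; the second loop clears \<open>vOk\<close> if the kernel can be extended.\<close>

definition scan_com :: com where
  "scan_com = Seq (and_com (var vC) (get ROW (var vU)))
    (Seq (Cond (Less (Const 0) (get FLG (var vZ))) Skip
            (Seq (put FLG (var vZ) (Const 1))
            (Seq (put LST (var vN) (var vZ)) (assign vN (Plus (var vN) (Const 1))))))
    (Cond (Less (var vZ) (var vC)) Skip
       (Seq (and_com (var vC) (get POW (var vU)))
       (Cond (Less (Const 0) (var vZ))
          (Seq (assign vX (Plus (var vX) (get POW (var vU))))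
          (Seq (assign vCnt (Plus (var vCnt) (Const 1)))
          (Seq (and_com (var vY) (get ROW (var vU))) (assign vY (var vZ))))) Skip))))"

definition test_com :: com where
  "test_com = Seq (and_com (var vY) (get POW (var vU)))
    (Cond (Less (Const 0) (var vZ))
      (Seq (and_com (var vX) (get POW (var vU)))
      (Cond (Less (Const 0) (var vZ)) Skip
        (Seq (and_com (var vX) (get ROW (var vU)))
        (Cond (Less (var vZ) (var vX)) Skip (assign vOk (Const 0)))))) Skip)"

definition process_com :: com where
  "process_com = Seq (assign vC (get LST (var vI)))
    (Seq (assign vX (Const 0))
    (Seq (assign vCnt (Const 0))
    (Seq (assign vY (var vFull))
    (Seq (for_loop vU nE scan_com)
    (Seq (assign vOk (Const 1))
    (Seq (for_loop vU nE test_com)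
    (Seq (Cond (And (Less (Const 0) (var vOk)) (And (Not (Less (var vCnt) sE)) (Not (Less sE (var vCnt)))))
            (assign vAns (Const 1)) Skip)
      (assign vI (Plus (var vI) (Const 1))))))))))"

definition closure_com :: com where
  "closure_com = Seq (assign vFull (Minus (get POW nE) (Const 1)))
    (Seq (put LST (Const 0) (var vFull))
    (Seq (put FLG (var vFull) (Const 1))
    (Seq (assign vN (Const 1))
    (Seq (assign vI (Const 0))
    (Seq (assign vAns (Const 0))
      (While (Less (var vI) (var vN)) process_com))))))"

abbreviation "decide_com \<equiv>
  Cond (And (Less (Const 0) (var vOk)) (And (Not (Less (var vCnt) sE)) (Not (Less sE (var vCnt)))))
    (assign vAns (Const 1)) Skip"

definition scan_cost :: nat where
  "scan_cost = and_cost (var vC) (get ROW (var vU)) +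
     straight_cost (Cond (Less (Const 0) (get FLG (var vZ))) Skip
            (Seq (put FLG (var vZ) (Const 1))
            (Seq (put LST (var vN) (var vZ)) (assign vN (Plus (var vN) (Const 1)))))) +
     (1 + test_cost (Less (var vZ) (var vC)) + straight_cost Skip +
     (and_cost (var vC) (get POW (var vU)) +
     (1 + test_cost (Less (Const 0) (var vZ)) +
       (straight_cost (assign vX (Plus (var vX) (get POW (var vU)))) +
       straight_cost (assign vCnt (Plus (var vCnt) (Const 1))) +
       and_cost (var vY) (get ROW (var vU)) + straight_cost (assign vY (var vZ))) + straight_cost Skip)))"

definition test_com_cost :: nat where
  "test_com_cost = and_cost (var vY) (get POW (var vU)) + (1 + test_cost (Less (Const 0) (var vZ)) +
      (and_cost (var vX) (get POW (var vU)) + (1 + test_cost (Less (Const 0) (var vZ)) + straight_cost Skip +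
       (and_cost (var vX) (get ROW (var vU)) +
        straight_cost (Cond (Less (var vZ) (var vX)) Skip (assign vOk (Const 0)))))) + straight_cost Skip)"

definition process_cost :: nat where
  "process_cost = straight_cost (assign vC (get LST (var vI))) + straight_cost (assign vX (Const 0)) +
     straight_cost (assign vCnt (Const 0)) + straight_cost (assign vY (var vFull)) +
     (scan_cost + for_cost vU nE) + straight_cost (assign vOk (Const 1)) +
     (test_com_cost + for_cost vU nE) + straight_cost decide_com +
     straight_cost (assign vI (Plus (var vI) (Const 1)))"

definition closure_cost :: nat where
  "closure_cost = straight_cost (assign vFull (Minus (get POW nE) (Const 1))) +
     straight_cost (put LST (Const 0) (var vFull)) + straight_cost (put FLG (var vFull) (Const 1)) +
     straight_cost (assign vN (Const 1)) + straight_cost (assign vI (Const 0)) +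
     straight_cost (assign vAns (Const 0)) + process_cost + 1 + test_cost (Less (var vI) (var vN))"

section \<open>Correctness and running time of the closure program\<close>

locale closure =
  fixes inp :: mem and n s :: nat and R :: "nat \<Rightarrow> nat set"
  assumes n: "inp 0 = n" and s: "inp 2 = s"
    and R: "u < n \<Longrightarrow> R u \<subseteq> {..<n}" "u < n \<Longrightarrow> u \<in> R u"
begin

text \<open>The index \<open>n\<close> is included for \<open>POW\<close> because the code of the
  full vertex set is obtained as \<open>2 ^ n - 1\<close>.\<close>

definition tables :: "(nat \<Rightarrow> nat \<Rightarrow> nat) \<Rightarrow> bool" where
  "tables f \<longleftrightarrow> (\<forall>v\<le>n. f POW v = 2 ^ v) \<and> (\<forall>u<n. f ROW u = set_encode (R u))"

text \<open>The list \<open>xs\<close> is a ghost copy of \<open>LST\<close>. Codes are injective on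
  subsets of \<open>{..<n}\<close>, so a single access to \<open>FLG\<close> tells whether a set is
  already listed.\<close>

definition listed :: "nat set list \<Rightarrow> (nat \<Rightarrow> nat \<Rightarrow> nat) \<Rightarrow> bool" where
  "listed xs f \<longleftrightarrow> distinct xs \<and> set xs \<subseteq> meets n R \<and> {..<n} \<in> set xs \<and> f vN 0 = length xs \<and>
     (\<forall>i < length xs. f LST i = set_encode (xs ! i)) \<and>
     (\<forall>S \<subseteq> {..<n}. f FLG (set_encode S) = (if S \<in> set xs then 1 else 0))"

text \<open>The second operand is evaluated after \<open>vP\<close> has been overwritten; its value
  is therefore required in every memory that agrees with \<open>f\<close> outside
  \<open>vP\<close>.\<close>

lemma runs_and':
  assumes f: "tables f" and S: "S \<subseteq> {..<n}" "val e (layout inp f) = set_encode S"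
    and S': "S' \<subseteq> {..<n}" "\<And>f'. (\<And>a. a \<noteq> vP \<Longrightarrow> f' a = f a) \<Longrightarrow> val e' (layout inp f') = set_encode S'"
    and Q: "\<And>g. g vZ 0 = set_encode (S \<inter> S') \<Longrightarrow> (\<And>a. a \<notin> {vP, vQ, vZ, vT} \<Longrightarrow> g a = f a) \<Longrightarrow> Q g"
  shows "runs inp (and_com e e') f ((n + 1) * and_cost e e') Q"
proof (rule runs_mono[OF runs_and[OF n _ S S'(1)] order_refl])
  show "\<forall>v<n. f POW v = 2 ^ v" using f by (simp add: tables_def)
  show "val e' (layout inp (f(vP := (f vP)(0 := set_encode S)))) = set_encode S'"
    by (rule S'(2)) simp
qed (use Q in blast)

lemma encode_neq: "S \<subseteq> {..<n} \<Longrightarrow> S' \<subseteq> {..<n} \<Longrightarrow> set_encode S = set_encode S' \<longleftrightarrow> S = S'"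
  by (meson finite_lessThan finite_subset set_encode_eq)

text \<open>The inclusion test of the program: after an intersection has been computed, one
  comparison of numbers decides it.\<close>

lemma encode_Int_less: "S \<subseteq> {..<n} \<Longrightarrow> set_encode (S \<inter> S') < set_encode S \<longleftrightarrow> \<not> S \<subseteq> S'"
proof -
  assume S: "S \<subseteq> {..<n}"
  have "set_encode (S \<inter> S') \<le> set_encode S" using S by (intro encode_mono) (auto intro: finite_subset)
  moreover have "set_encode (S \<inter> S') = set_encode S \<longleftrightarrow> S \<inter> S' = S" using S by (intro encode_neq) auto
  ultimately show ?thesis by auto
qed

lemma encode_Int_singleton: "S \<subseteq> {..<n} \<Longrightarrow> 0 < set_encode (S \<inter> {j}) \<longleftrightarrow> j \<in> S"
  using encode_eq_0[of "S \<inter> {j}"] by auto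

lemma encode_single [simp]: "set_encode {j} = 2 ^ j"
  by (simp add: set_encode_def)

text \<open>Here \<open>ys\<close> is the list as it was when the scan of entry \<open>i\<close>
  began, \<open>zs\<close> consists of the entries appended since then, and \<open>a\<close> is the
  answer so far, which the scan must preserve. Kernel, size and common out-neighbourhood are
  complete for the vertices below \<open>j\<close>.\<close>

definition scanning :: "nat \<Rightarrow> nat set list \<Rightarrow> nat \<Rightarrow> nat \<Rightarrow> (nat \<Rightarrow> nat \<Rightarrow> nat) \<Rightarrow> bool" where
  "scanning i ys a j g \<longleftrightarrow> tables g \<and> g vU 0 = j \<and> g vI 0 = i \<and> g vAns 0 = a \<and> i < length ys \<and>
     g vFull 0 = set_encode {..<n} \<and>
     g vC 0 = set_encode (ys ! i) \<and> g vX 0 = set_encode (kernel R (ys ! i) \<inter> {..<j}) \<and>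
     g vCnt 0 = card (kernel R (ys ! i) \<inter> {..<j}) \<and>
     g vY 0 = set_encode (meet n R (kernel R (ys ! i) \<inter> {..<j})) \<and>
     (\<exists>zs. listed (ys @ zs) g \<and> (\<forall>u<j. ys ! i \<inter> R u \<in> set (ys @ zs)))"

lemma runs_scan:
  assumes j: "j < n" and g: "scanning i ys a j g"
  shows "runs inp scan_com g ((n + 1) * scan_cost)
    (\<lambda>h. h vU 0 = j \<and> scanning i ys a (Suc j) (h(vU := (h vU)(0 := Suc j))))"
proof -
  define W where "W = ys ! i"
  define K where "K = kernel R W"
  obtain zs where zs: "listed (ys @ zs) g" "\<forall>u<j. W \<inter> R u \<in> set (ys @ zs)" and i: "i < length ys"
    using g by (auto simp: scanning_def W_def)
  have tab: "tables g" using g by (simp add: scanning_def)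
  have Wm: "W \<in> meets n R" using zs(1) i by (auto simp: listed_def W_def)
  then have W: "W \<subseteq> {..<n}" using meet_subset by (auto simp: meets_def)
  have K: "K \<subseteq> {..<n}" using W by (auto simp: K_def kernel_def)
  have Rj: "R j \<subseteq> {..<n}" using R j by blast
  have c: "g vC 0 = set_encode W" "g vU 0 = j" "g ROW j = set_encode (R j)" "g POW j = 2 ^ j"
    using g tab j by (auto simp: scanning_def W_def tables_def)
  let ?W' = "W \<inter> R j"
  have W': "?W' \<subseteq> {..<n}" "?W' \<in> meets n R" using W meets_closed[OF Wm j] by auto
  \<comment> \<open>The memory between the two halves of the body: the new set has been entered, the
    kernel not yet updated.\<close>
  define mid where "mid h \<longleftrightarrow> h vZ 0 = set_encode ?W' \<and>
    (\<forall>a. a \<notin> {vP, vQ, vZ, vT, FLG, LST, vN} \<longrightarrow> h a = g a) \<and>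
    (\<exists>zs. listed (ys @ zs) h \<and> (\<forall>u<Suc j. W \<inter> R u \<in> set (ys @ zs)))" for h
  define fin where "fin h \<longleftrightarrow> h vU 0 = j \<and> scanning i ys a (Suc j) (h(vU := (h vU)(0 := Suc j)))" for h
  have KS: "K \<inter> {..<Suc j} = (if j \<in> W \<and> W \<subseteq> R j then insert j (K \<inter> {..<j}) else K \<inter> {..<j})"
    using W by (auto simp: K_def kernel_def less_Suc_eq)
  have finI: "fin h" if h: "\<forall>a. a \<notin> {vP, vQ, vZ, vT, FLG, LST, vN, vX, vCnt, vY} \<longrightarrow> h a = g a"
      "h vX 0 = set_encode (K \<inter> {..<Suc j})" "h vCnt 0 = card (K \<inter> {..<Suc j})"
      "h vY 0 = set_encode (meet n R (K \<inter> {..<Suc j}))"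
      "\<exists>zs. listed (ys @ zs) h \<and> (\<forall>u<Suc j. W \<inter> R u \<in> set (ys @ zs))" for h
    using h g by (auto simp: fin_def scanning_def tables_def listed_def W_def K_def)
  let ?A = "Cond (Less (Const 0) (get FLG (var vZ))) Skip
            (Seq (put FLG (var vZ) (Const 1))
            (Seq (put LST (var vN) (var vZ)) (assign vN (Plus (var vN) (Const 1)))))"
  have A: "runs inp ?A h (straight_cost ?A) mid"
    if h: "h vZ 0 = set_encode ?W'" "\<And>a. a \<notin> {vP, vQ, vZ, vT} \<Longrightarrow> h a = g a" for h
  proof -
    have l: "listed (ys @ zs) h" using zs(1) h(2) by (auto simp: listed_def)
    have flag: "h FLG (set_encode ?W') = (if ?W' \<in> set (ys @ zs) then 1 else 0)"
      using l W' by (auto simp: listed_def)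
    show ?thesis
    proof (intro runs_straight)
      assume "holds (Less (Const 0) (get FLG (var vZ))) (layout inp h)"
      then have "?W' \<in> set (ys @ zs)" using flag h(1) by (simp split: if_splits)
      then show "mid h" using l h zs(2) unfolding mid_def by (auto simp: less_Suc_eq)
    next
      assume "\<not> holds (Less (Const 0) (get FLG (var vZ))) (layout inp h)"
      then have new: "?W' \<notin> set (ys @ zs)" using flag h(1) by (simp split: if_splits)
      let ?h1 = "h(FLG := (h FLG)(val (var vZ) (layout inp h) := val (Const 1) (layout inp h)))"
      let ?h2 = "?h1(LST := (?h1 LST)(val (var vN) (layout inp ?h1) := val (var vZ) (layout inp ?h1)))"
      let ?h3 = "?h2(vN := (?h2 vN)(0 := val (Plus (var vN) (Const 1)) (layout inp ?h2)))"
      have h3: "?h3 = h(FLG := (h FLG)(set_encode ?W' := 1),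
        LST := (h LST)(length (ys @ zs) := set_encode ?W'), vN := (h vN)(0 := Suc (length (ys @ zs))))"
        using h(1) l by (simp add: listed_def)
      have "listed (ys @ (zs @ [?W'])) ?h3"
        unfolding h3 using l new W' encode_neq[OF _ W'(1)]
        by (auto simp: listed_def nth_append less_Suc_eq)
      moreover have "\<forall>u<Suc j. W \<inter> R u \<in> set (ys @ (zs @ [?W']))" using zs(2) by (auto simp: less_Suc_eq)
      moreover have "?h3 vZ 0 = set_encode ?W'" using h(1) by simp
      moreover have "\<forall>a. a \<notin> {vP, vQ, vZ, vT, FLG, LST, vN} \<longrightarrow> ?h3 a = g a" using h(2) by simp
      ultimately show "mid ?h3" unfolding mid_def by blast
    qed simp_all
  qed
  let ?B = "Seq (and_com (var vC) (get POW (var vU)))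
       (Cond (Less (Const 0) (var vZ))
          (Seq (assign vX (Plus (var vX) (get POW (var vU))))
          (Seq (assign vCnt (Plus (var vCnt) (Const 1)))
          (Seq (and_com (var vY) (get ROW (var vU))) (assign vY (var vZ))))) Skip)"
  let ?TB = "(n + 1) * and_cost (var vC) (get POW (var vU)) +
     (1 + test_cost (Less (Const 0) (var vZ)) +
       (straight_cost (assign vX (Plus (var vX) (get POW (var vU)))) +
       (straight_cost (assign vCnt (Plus (var vCnt) (Const 1))) +
       ((n + 1) * and_cost (var vY) (get ROW (var vU)) + straight_cost (assign vY (var vZ))))) + straight_cost Skip)"
  have start: "g vX 0 = set_encode (K \<inter> {..<j})" "g vCnt 0 = card (K \<inter> {..<j})"
    "g vY 0 = set_encode (meet n R (K \<inter> {..<j}))"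
    using g by (auto simp: scanning_def K_def W_def)
  have B: "runs inp ?B h ?TB fin" if mid: "mid h" and sub: "W \<subseteq> R j" for h
  proof -
    have hg: "\<And>a. a \<notin> {vP, vQ, vZ, vT, FLG, LST, vN} \<Longrightarrow> h a = g a"
      and l: "\<exists>zs. listed (ys @ zs) h \<and> (\<forall>u<Suc j. W \<inter> R u \<in> set (ys @ zs))"
      using mid by (auto simp: mid_def)
    have tabh: "tables h" using tab hg by (simp add: tables_def)
    show ?thesis
    proof (rule runs_seq, rule runs_and'[OF tabh W, of _ "{j}"], goal_cases)
      case 1 show ?case using hg c by simp
    next
      case 2 show ?case using j by simp
    next
      case (3 f') then show ?case using hg c by simp
    next
      case (4 h2)
      have h2: "\<And>a. a \<notin> {vP, vQ, vZ, vT, FLG, LST, vN} \<Longrightarrow> h2 a = g a" using 4(2) hg by simp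
      have l2: "\<exists>zs. listed (ys @ zs) h2 \<and> (\<forall>u<Suc j. W \<inter> R u \<in> set (ys @ zs))"
        using l 4(2) by (simp add: listed_def)
      have z: "0 < h2 vZ 0 \<longleftrightarrow> j \<in> W" using 4(1) encode_Int_singleton[OF W] by simp
      show ?case
      proof (rule runs_cond)
        assume "holds (Less (Const 0) (var vZ)) (layout inp h2)"
        then have jW: "j \<in> W" using z by simp
        then have KS': "K \<inter> {..<Suc j} = insert j (K \<inter> {..<j})" using KS sub by simp
        let ?h3 = "h2(vX := (h2 vX)(0 := set_encode (K \<inter> {..<Suc j})), vCnt := (h2 vCnt)(0 := card (K \<inter> {..<Suc j})))"
        have finK: "finite (K \<inter> {..<j})" "j \<notin> K \<inter> {..<j}" by auto
        have tab3: "tables ?h3" using tab h2 by (simp add: tables_def)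
        have m: "meet n R (K \<inter> {..<j}) \<inter> R j = meet n R (K \<inter> {..<Suc j})"
          by (simp only: KS' meet_insert)
        have fin3: "fin (h4(vY := (h4 vY)(0 := set_encode (meet n R (K \<inter> {..<Suc j})))))"
          if h4: "\<And>a. a \<notin> {vP, vQ, vZ, vT} \<Longrightarrow> h4 a = ?h3 a" for h4
          by (rule finI) (use h4 h2 l2 in \<open>simp_all add: listed_def\<close>)
        show "runs inp (Seq (assign vX (Plus (var vX) (get POW (var vU))))
          (Seq (assign vCnt (Plus (var vCnt) (Const 1)))
          (Seq (and_com (var vY) (get ROW (var vU))) (assign vY (var vZ))))) h2
          (straight_cost (assign vX (Plus (var vX) (get POW (var vU)))) +
       (straight_cost (assign vCnt (Plus (var vCnt) (Const 1))) +
       ((n + 1) * and_cost (var vY) (get ROW (var vU)) + straight_cost (assign vY (var vZ))))) fin"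
        proof (rule runs_seq, rule runs_assign, simp, rule runs_seq, rule runs_assign, simp, goal_cases)
          case 1
          have eq: "h2(vX := (h2 vX)(0 := val (Plus (var vX) (get POW (var vU))) (layout inp h2)),
              vCnt := ((h2(vX := (h2 vX)(0 := val (Plus (var vX) (get POW (var vU))) (layout inp h2)))) vCnt)
                (0 := val (Plus (var vCnt) (Const 1)) (layout inp (h2(vX := (h2 vX)(0 := val (Plus (var vX) (get POW (var vU))) (layout inp h2))))))) = ?h3"
            using h2 start c finK by (simp add: KS' set_encode_insert add.commute)
          show ?case unfolding eq
          proof (rule runs_seq, rule runs_and'[OF tab3 meet_subset[of n R "K \<inter> {..<j}"] _ Rj], goal_cases)
            case 1 show ?case using h2 start by simp
          next
            case (2 f') then show ?case using h2 c by simp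
          next
            case (3 h4)
            then show ?case using fin3[of h4] by (intro runs_assign) (simp_all add: m)
          qed
        qed
      next
        assume "\<not> holds (Less (Const 0) (var vZ)) (layout inp h2)"
        then have "j \<notin> W" using z by simp
        then have "fin h2" by (intro finI) (use h2 l2 start KS in simp_all)
        then show "runs inp Skip h2 (straight_cost Skip) fin" by (intro runs_skip)
      qed
    qed
  qed
  have "runs inp scan_com g ((n + 1) * and_cost (var vC) (get ROW (var vU)) +
     (straight_cost ?A + (1 + test_cost (Less (var vZ) (var vC)) + straight_cost Skip + ?TB))) fin"
    unfolding scan_com_def
  proof (rule runs_seq, rule runs_and'[OF tab W _ Rj], goal_cases)
    case 1 show ?case using c by simp
  next
    case (2 f') then show ?case using c by simp
  next
    case (3 h)
    show ?case
    proof (rule runs_seq, rule runs_mono[OF A[of h, OF 3] order_refl])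
      fix h assume mid: "mid h"
      have z: "h vZ 0 < h vC 0 \<longleftrightarrow> \<not> W \<subseteq> R j"
        using mid c encode_Int_less[OF W] by (simp add: mid_def)
      show "runs inp (Cond (Less (var vZ) (var vC)) Skip ?B) h
          (1 + test_cost (Less (var vZ) (var vC)) + straight_cost Skip + ?TB) fin"
      proof (rule runs_cond)
        assume "holds (Less (var vZ) (var vC)) (layout inp h)"
        then have "\<not> W \<subseteq> R j" using z by simp
        then have "fin h" using mid start KS unfolding mid_def by (intro finI) simp_all
        then show "runs inp Skip h (straight_cost Skip) fin" by (intro runs_skip)
      next
        assume "\<not> holds (Less (var vZ) (var vC)) (layout inp h)"
        then show "runs inp ?B h ?TB fin" using B[OF mid] z by simp
      qed
    qed
  qed
  then show ?thesis
    unfolding fin_def by (rule runs_mono) (simp_all add: scan_cost_def algebra_simps)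
qed

definition testing :: "nat set \<Rightarrow> (nat \<Rightarrow> nat \<Rightarrow> nat) \<Rightarrow> nat \<Rightarrow> (nat \<Rightarrow> nat \<Rightarrow> nat) \<Rightarrow> bool" where
  "testing X f j g \<longleftrightarrow> g vU 0 = j \<and> (\<forall>a. a \<notin> {vU, vOk, vP, vQ, vZ, vT} \<longrightarrow> g a = f a) \<and>
     g vOk 0 = (if \<exists>w<j. w \<in> meet n R X \<and> w \<notin> X \<and> X \<subseteq> R w then 0 else 1)"

text \<open>The three conditions for an extending vertex \<open>j\<close> are checked by one
  intersection of codes each; \<open>vOk\<close> can only change to 0.\<close>

lemma runs_test:
  assumes X: "X \<subseteq> {..<n}" and f: "tables f" "f vX 0 = set_encode X" "f vY 0 = set_encode (meet n R X)"
    and j: "j < n" and g: "testing X f j g"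
  shows "runs inp test_com g ((n + 1) * test_com_cost)
    (\<lambda>h. h vU 0 = j \<and> testing X f (Suc j) (h(vU := (h vU)(0 := Suc j))))"
proof -
  define ok where "ok w \<longleftrightarrow> w \<in> meet n R X \<and> w \<notin> X \<and> X \<subseteq> R w" for w
  define fin where "fin h \<longleftrightarrow> h vU 0 = j \<and> testing X f (Suc j) (h(vU := (h vU)(0 := Suc j)))" for h
  have finI: "fin h" if "\<And>a. a \<notin> {vOk, vP, vQ, vZ, vT} \<Longrightarrow> h a = g a"
    "h vOk 0 = (if ok j then 0 else g vOk 0)" for h
    using that g by (auto simp: fin_def testing_def ok_def less_Suc_eq)
  have same: "fin h" if "\<And>a. a \<notin> {vP, vQ, vZ, vT} \<Longrightarrow> h a = g a" "\<not> ok j" for h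
    by (rule finI) (use that in auto)
  have gf: "\<And>a. a \<notin> {vU, vOk, vP, vQ, vZ, vT} \<Longrightarrow> g a = f a" and gU: "g vU 0 = j"
    using g by (auto simp: testing_def)
  have tab: "tables h" if "\<And>a. a \<notin> {vP, vQ, vZ, vT} \<Longrightarrow> h a = g a" for h
    using f(1) gf that by (simp add: tables_def)
  have c: "g vX 0 = set_encode X" "g vY 0 = set_encode (meet n R X)" "g POW j = 2 ^ j" "g ROW j = set_encode (R j)"
    using gf f j by (auto simp: tables_def)
  have Rj: "R j \<subseteq> {..<n}" using R j by blast
  have sj: "{j} \<subseteq> {..<n}" using j by simp
  let ?C3 = "Cond (Less (var vZ) (var vX)) Skip (assign vOk (Const 0))"
  let ?C2 = "Cond (Less (Const 0) (var vZ)) Skip (Seq (and_com (var vX) (get ROW (var vU))) ?C3)"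
  let ?T2 = "1 + test_cost (Less (Const 0) (var vZ)) + straight_cost Skip +
       ((n + 1) * and_cost (var vX) (get ROW (var vU)) + straight_cost ?C3)"
  have C2: "runs inp ?C2 h ?T2 fin"
    if h: "\<And>a. a \<notin> {vP, vQ, vZ, vT} \<Longrightarrow> h a = g a" "h vZ 0 = set_encode (X \<inter> {j})" "j \<in> meet n R X" for h
  proof (rule runs_cond)
    assume "holds (Less (Const 0) (var vZ)) (layout inp h)"
    then have "j \<in> X" using h encode_Int_singleton[OF X] by simp
    then show "runs inp Skip h (straight_cost Skip) fin"
      by (intro runs_skip same h(1)) (auto simp: ok_def)
  next
    assume "\<not> holds (Less (Const 0) (var vZ)) (layout inp h)"
    then have jX: "j \<notin> X" using h encode_Int_singleton[OF X] by simp
    show "runs inp (Seq (and_com (var vX) (get ROW (var vU))) ?C3) h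
      ((n + 1) * and_cost (var vX) (get ROW (var vU)) + straight_cost ?C3) fin"
    proof (rule runs_seq, rule runs_and'[OF tab X _ Rj], goal_cases)
      case (1 a) then show ?case using h by simp
    next
      case 2 show ?case using h c by simp
    next
      case (3 f') then show ?case using h c gU by simp
    next
      case (4 h2)
      have h2: "\<And>a. a \<notin> {vP, vQ, vZ, vT} \<Longrightarrow> h2 a = g a" using 4 h by simp
      have z: "h2 vZ 0 < h2 vX 0 \<longleftrightarrow> \<not> X \<subseteq> R j" using 4 h2 c encode_Int_less[OF X] by simp
      show ?case
      proof (intro runs_straight)
        assume "holds (Less (var vZ) (var vX)) (layout inp h2)"
        then show "fin h2" using z by (intro same h2) (auto simp: ok_def)
      next
        assume "\<not> holds (Less (var vZ) (var vX)) (layout inp h2)"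
        then have "ok j" using z h(3) jX by (simp add: ok_def)
        then show "fin (h2(vOk := (h2 vOk)(0 := val (Const 0) (layout inp h2))))"
          by (intro finI) (use h2 in simp_all)
      qed simp
    qed
  qed
  have "runs inp test_com g ((n + 1) * and_cost (var vY) (get POW (var vU)) +
     (1 + test_cost (Less (Const 0) (var vZ)) +
      ((n + 1) * and_cost (var vX) (get POW (var vU)) + ?T2) + straight_cost Skip)) fin"
    unfolding test_com_def
  proof (rule runs_seq, rule runs_and'[OF tab meet_subset[of n R X] _ sj], goal_cases)
    case (1 a) then show ?case by simp
  next
    case 2 show ?case using c by simp
  next
    case (3 f') then show ?case using c gU by simp
  next
    case (4 h)
    have z: "0 < h vZ 0 \<longleftrightarrow> j \<in> meet n R X" using 4 encode_Int_singleton[OF meet_subset] by simp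
    show ?case
    proof (rule runs_cond)
      assume "holds (Less (Const 0) (var vZ)) (layout inp h)"
      then have jm: "j \<in> meet n R X" using z by simp
      show "runs inp (Seq (and_com (var vX) (get POW (var vU))) ?C2) h
        ((n + 1) * and_cost (var vX) (get POW (var vU)) + ?T2) fin"
      proof (rule runs_seq, rule runs_and'[OF tab X _ sj], goal_cases)
        case (1 a) then show ?case using 4 by simp
      next
        case 2 show ?case using 4 c by simp
      next
        case (3 f') then show ?case using 4 c gU by simp
      next
        case (4 h2)
        then show ?case using \<open>\<And>a. a \<notin> {vP, vQ, vZ, vT} \<Longrightarrow> h a = g a\<close> by (intro C2 jm) simp_all
      qed
    next
      assume "\<not> holds (Less (Const 0) (var vZ)) (layout inp h)"
      then show "runs inp Skip h (straight_cost Skip) fin"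
        using z 4 by (intro runs_skip same) (auto simp: ok_def)
    qed
  qed
  then show ?thesis
    unfolding fin_def by (rule runs_mono) (simp_all add: test_com_cost_def algebra_simps)
qed

definition accepts :: "nat set \<Rightarrow> bool" where
  "accepts W \<longleftrightarrow> \<not> extendable n R (kernel R W) \<and> card (kernel R W) = s"

text \<open>Worklist invariant: entries before position \<open>j\<close> are processed, that is,
  their intersections with all rows are listed, and the answer records whether one of them was
  accepted.\<close>

definition closing :: "nat \<Rightarrow> (nat \<Rightarrow> nat \<Rightarrow> nat) \<Rightarrow> bool" where
  "closing j g \<longleftrightarrow> tables g \<and> g vI 0 = j \<and> g vFull 0 = set_encode {..<n} \<and>
     (\<exists>xs. listed xs g \<and> j \<le> length xs \<and> (\<forall>i<j. \<forall>u<n. xs ! i \<inter> R u \<in> set xs) \<and>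
        g vAns 0 = (if \<exists>i<j. accepts (xs ! i) then 1 else 0))"

text \<open>The listed sets are distinct members of \<open>meets n R\<close>. The number of
  iterations is therefore bounded by the size of this family, the quantity that the path
  decomposition controls.\<close>

lemma runs_process:
  assumes g: "closing j g" and less: "g vI 0 < g vN 0"
  shows "j < card (meets n R) \<and> runs inp process_com g ((n + 1) ^ 2 * process_cost) (closing (Suc j))"
proof
  obtain xs where xs: "listed xs g" "\<forall>i<j. \<forall>u<n. xs ! i \<inter> R u \<in> set xs"
      "g vAns 0 = (if \<exists>i<j. accepts (xs ! i) then 1 else 0)"
    and c: "g vI 0 = j" "g vFull 0 = set_encode {..<n}" "tables g"
    using g unfolding closing_def by blast
  have j: "j < length xs" using less c xs(1) by (simp add: listed_def)
  have "length xs = card (set xs)" using xs(1) by (simp add: listed_def distinct_card)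
  also have "\<dots> \<le> card (meets n R)"
    using xs(1) by (intro card_mono finite_meets) (simp add: listed_def)
  finally show "j < card (meets n R)" using j by simp
  define W where "W = xs ! j"
  define K where "K = kernel R W"
  have "W \<in> meets n R" using xs(1) j by (auto simp: listed_def W_def)
  then have W: "W \<subseteq> {..<n}" using meet_subset by (auto simp: meets_def)
  then have K: "K \<subseteq> {..<n}" by (auto simp: K_def kernel_def)
  have KI: "K \<inter> {..<n} = K" using K by auto
  have m0: "meet n R {} = {..<n}" by (auto simp: meet_def)
  let ?scan = "for_loop vU nE scan_com" and ?Tscan = "(n + 1) * ((n + 1) * scan_cost + for_cost vU nE)"
  let ?test = "for_loop vU nE test_com" and ?Ttest = "(n + 1) * ((n + 1) * test_com_cost + for_cost vU nE)"
  define g1 where "g1 = g(vC := (g vC)(0 := set_encode W), vX := (g vX)(0 := 0),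
    vCnt := (g vCnt)(0 := 0), vY := (g vY)(0 := set_encode {..<n}))"
  have scan: "runs inp ?scan g1 ?Tscan (scanning j xs (g vAns 0) n)"
  proof (rule runs_for[where I = "scanning j xs (g vAns 0)"])
    have "listed (xs @ []) (g1(vU := (g1 vU)(0 := 0)))"
      using xs(1) by (simp add: listed_def g1_def)
    then have "\<exists>zs. listed (xs @ zs) (g1(vU := (g1 vU)(0 := 0))) \<and> (\<forall>u<0. xs ! j \<inter> R u \<in> set (xs @ zs))"
      by blast
    then show "scanning j xs (g vAns 0) 0 (g1(vU := (g1 vU)(0 := 0)))"
      unfolding scanning_def using c j by (simp add: g1_def tables_def W_def m0)
  next
    fix i h assume "scanning j xs (g vAns 0) i h"
    then show "h vU 0 = i \<and> val nE (layout inp h) = n" using n by (simp add: scanning_def)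
  next
    fix i h assume "i < n" "scanning j xs (g vAns 0) i h"
    then show "runs inp scan_com h ((n + 1) * scan_cost)
        (\<lambda>h'. h' vU 0 = i \<and> scanning j xs (g vAns 0) (Suc i) (h'(vU := (h' vU)(0 := Suc i))))"
      by (rule runs_scan)
  qed simp
  have test: "runs inp ?test f ?Ttest (testing K f n)"
    if f: "tables f" "f vX 0 = set_encode K" "f vY 0 = set_encode (meet n R K)" "f vOk 0 = 1" for f
  proof (rule runs_for[where I = "testing K f"])
    show "testing K f 0 (f(vU := (f vU)(0 := 0)))" using f by (simp add: testing_def)
  next
    fix i h assume "testing K f i h"
    then show "h vU 0 = i \<and> val nE (layout inp h) = n" using n by (simp add: testing_def)
  next
    fix i h assume "i < n" "testing K f i h"
    then show "runs inp test_com h ((n + 1) * test_com_cost)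
        (\<lambda>h'. h' vU 0 = i \<and> testing K f (Suc i) (h'(vU := (h' vU)(0 := Suc i))))"
      using runs_test[OF K f(1-3)] by simp
  qed simp
  have rest: "runs inp (Seq (assign vOk (Const 1)) (Seq ?test (Seq decide_com (assign vI (Plus (var vI) (Const 1))))))
      g2 (straight_cost (assign vOk (Const 1)) + (?Ttest + (straight_cost decide_com +
        straight_cost (assign vI (Plus (var vI) (Const 1)))))) (closing (Suc j))"
    if g2: "scanning j xs (g vAns 0) n g2" for g2
  proof -
    obtain zs where zs: "listed (xs @ zs) g2" "\<forall>u<n. W \<inter> R u \<in> set (xs @ zs)"
      using g2 by (auto simp: scanning_def W_def)
    have c2: "tables g2" "g2 vI 0 = j" "g2 vAns 0 = g vAns 0" "g2 vFull 0 = set_encode {..<n}"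
      "g2 vX 0 = set_encode K" "g2 vCnt 0 = card K" "g2 vY 0 = set_encode (meet n R K)"
      using g2 KI by (simp_all add: scanning_def W_def[symmetric] K_def[symmetric])
    let ?f = "g2(vOk := (g2 vOk)(0 := 1))"
    have closed: "\<forall>i<Suc j. \<forall>u<n. (xs @ zs) ! i \<inter> R u \<in> set (xs @ zs)"
      using xs(2) zs(2) j by (auto simp: less_Suc_eq nth_append W_def)
    have "(xs @ zs) ! j = W" "\<And>i. i < j \<Longrightarrow> (xs @ zs) ! i = xs ! i"
      using j by (simp_all add: nth_append W_def)
    then have acc: "(\<exists>i<Suc j. accepts ((xs @ zs) ! i)) \<longleftrightarrow> (\<exists>i<j. accepts (xs ! i)) \<or> accepts W"
      by (metis less_Suc_eq)
    have test': "runs inp ?test ?f ?Ttest (testing K ?f n)"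
      using c2 by (intro test) (simp_all add: tables_def)
    show ?thesis
    proof (rule runs_seq, rule runs_assign, simp, simp only: val.simps,
        rule runs_seq, rule runs_mono[OF test' order_refl], goal_cases)
      case (1 h)
      then have h: "\<And>a. a \<notin> {vU, vOk, vP, vQ, vZ, vT} \<Longrightarrow> h a = g2 a"
        and ok: "h vOk 0 = (if extendable n R K then 0 else 1)"
        by (auto simp: testing_def extendable_def meet_def)
      have l: "listed (xs @ zs) h'" if "\<And>a. a \<in> {vN, LST, FLG} \<Longrightarrow> h' a = h a" for h'
        using zs(1) h that by (simp add: listed_def)
      have hc: "h vCnt 0 = card K" "h vI 0 = j" "h vAns 0 = g vAns 0" "h vFull 0 = set_encode {..<n}"
        using h c2 by simp_all
      have tabh: "tables h'" if "\<And>a. a \<in> {POW, ROW} \<Longrightarrow> h' a = h a" for h'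
        using c2(1) h that by (simp add: tables_def)
      have fin: "closing (Suc j) (h'(vI := (h' vI)(0 := Suc j)))"
        if h': "\<And>a. a \<noteq> vAns \<Longrightarrow> h' a = h a"
          "h' vAns 0 = (if (\<exists>i<j. accepts (xs ! i)) \<or> accepts W then 1 else 0)" for h'
      proof -
        let ?h = "h'(vI := (h' vI)(0 := Suc j))"
        have "listed (xs @ zs) ?h" "tables ?h" by (rule l tabh, use h'(1) in auto)+
        then show ?thesis unfolding closing_def
          using h' hc j closed acc by (intro conjI exI[of _ "xs @ zs"]) simp_all
      qed
      have iff: "holds (And (Less (Const 0) (var vOk)) (And (Not (Less (var vCnt) sE)) (Not (Less sE (var vCnt))))) (layout inp h)
          \<longleftrightarrow> accepts W"
        using ok hc s by (auto simp: accepts_def K_def)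
      show ?case
      proof (rule runs_seq, rule runs_straight_cond, goal_cases)
        case 1
        then have "accepts W" using iff by blast
        then show ?case
          using fin[of "h(vAns := (h vAns)(0 := 1))"] hc by (intro runs_assign) simp_all
      next
        case 2
        then have "\<not> accepts W" using iff by blast
        then show ?case
          using fin[of h] hc xs(3) by (intro runs_assign runs_skip) simp_all
      qed
    qed
  qed
  have "runs inp (Seq ?scan (Seq (assign vOk (Const 1)) (Seq ?test (Seq decide_com
      (assign vI (Plus (var vI) (Const 1))))))) g1 (?Tscan + (straight_cost (assign vOk (Const 1)) +
     (?Ttest + (straight_cost decide_com + straight_cost (assign vI (Plus (var vI) (Const 1))))))) (closing (Suc j))"
    by (rule runs_seq, rule runs_mono[OF scan order_refl], rule rest)
  moreover have "g LST j = set_encode W" using xs(1) j by (simp add: listed_def W_def)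
  ultimately have "runs inp process_com g (straight_cost (assign vC (get LST (var vI))) +
     (straight_cost (assign vX (Const 0)) + (straight_cost (assign vCnt (Const 0)) +
     (straight_cost (assign vY (var vFull)) + (?Tscan + (straight_cost (assign vOk (Const 1)) +
     (?Ttest + (straight_cost decide_com + straight_cost (assign vI (Plus (var vI) (Const 1)))))))))))
     (closing (Suc j))"
    unfolding process_com_def
    by (intro runs_seq[where P = "assign _ _"] runs_assign) (use c in \<open>simp_all add: g1_def\<close>)
  then show "runs inp process_com g ((n + 1) ^ 2 * process_cost) (closing (Suc j))"
    by (rule runs_mono) (simp_all add: process_cost_def algebra_simps power2_eq_square)
qed

text \<open>Once the worklist is exhausted, the list contains the full set and is closed under
  intersection with every row, so by \<open>meets_least\<close> it is the whole family. The flags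
  are zero from the outset; clearing one for each of the \<open>2 ^ n\<close> codes could exceed the
  time bound.\<close>

lemma runs_closure:
  assumes f: "tables f" "\<And>x. f FLG x = 0"
  shows "runs inp closure_com f ((card (meets n R) + 1) * ((n + 1) ^ 2 * closure_cost))
    (\<lambda>g. g vAns 0 = (if \<exists>W \<in> meets n R. accepts W then 1 else 0))"
proof -
  let ?M = "card (meets n R)"
  let ?loop = "While (Less (var vI) (var vN)) process_com"
  let ?T = "(?M + 1) * ((n + 1) ^ 2 * process_cost + 1 + test_cost (Less (var vI) (var vN)))"
  define f' where "f' = f(vFull := (f vFull)(0 := set_encode {..<n}), LST := (f LST)(0 := set_encode {..<n}),
    FLG := (f FLG)(set_encode {..<n} := 1), vN := (f vN)(0 := 1), vI := (f vI)(0 := 0), vAns := (f vAns)(0 := 0))"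
  have full: "{..<n} \<in> meets n R"
    unfolding meets_def by (intro image_eqI[of _ _ "{}"]) (auto simp: meet_def)
  have "listed [{..<n}] f'"
    using f(2) full encode_neq[of _ "{..<n}"] by (auto simp: listed_def f'_def)
  then have "\<exists>xs. listed xs f' \<and> 0 \<le> length xs \<and> (\<forall>i<0. \<forall>u<n. xs ! i \<inter> R u \<in> set xs) \<and>
      f' vAns 0 = (if \<exists>i<0. accepts (xs ! i) then 1 else 0)"
    by (intro exI[of _ "[{..<n}]"]) (simp add: f'_def)
  then have init: "closing 0 f'" unfolding closing_def using f(1) by (simp add: f'_def tables_def)
  have "runs inp ?loop f' ?T (\<lambda>g. \<exists>j. closing j g \<and> \<not> holds (Less (var vI) (var vN)) (layout inp g))"
    by (rule runs_while[where I = closing]) (use init runs_process in simp_all)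
  then have loop: "runs inp ?loop f' ?T (\<lambda>g. g vAns 0 = (if \<exists>W \<in> meets n R. accepts W then 1 else 0))"
  proof (rule runs_mono[OF _ order_refl])
    fix g assume "\<exists>j. closing j g \<and> \<not> holds (Less (var vI) (var vN)) (layout inp g)"
    then obtain j xs where xs: "listed xs g" "\<forall>i<j. \<forall>u<n. xs ! i \<inter> R u \<in> set xs"
      "g vAns 0 = (if \<exists>i<j. accepts (xs ! i) then 1 else 0)" "j \<le> length xs" "g vI 0 = j" "\<not> g vI 0 < g vN 0"
      unfolding closing_def by auto
    then have j: "j = length xs" by (simp add: listed_def)
    have "meets n R \<subseteq> set xs"
      using xs(1,2) j by (intro meets_least) (auto simp: listed_def in_set_conv_nth)
    then have "set xs = meets n R" using xs(1) by (auto simp: listed_def)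
    then have "(\<exists>i<j. accepts (xs ! i)) \<longleftrightarrow> (\<exists>W \<in> meets n R. accepts W)"
      using j by (metis in_set_conv_nth)
    with xs(3) show "g vAns 0 = (if \<exists>W \<in> meets n R. accepts W then 1 else 0)" by simp
  qed
  have p: "f POW n - Suc 0 = set_encode {..<n}" using f(1) encode_lessThan[of n] by (simp add: tables_def)
  have "runs inp closure_com f (straight_cost (assign vFull (Minus (get POW nE) (Const 1))) +
     (straight_cost (put LST (Const 0) (var vFull)) + (straight_cost (put FLG (var vFull) (Const 1)) +
     (straight_cost (assign vN (Const 1)) + (straight_cost (assign vI (Const 0)) +
     (straight_cost (assign vAns (Const 0)) + ?T))))))
    (\<lambda>g. g vAns 0 = (if \<exists>W \<in> meets n R. accepts W then 1 else 0))"
    unfolding closure_com_def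
    by (intro runs_seq runs_assign runs_put) (use loop n p in \<open>simp_all add: f'_def\<close>)
  moreover have "straight_cost (assign vFull (Minus (get POW nE) (Const 1))) +
     (straight_cost (put LST (Const 0) (var vFull)) + (straight_cost (put FLG (var vFull) (Const 1)) +
     (straight_cost (assign vN (Const 1)) + (straight_cost (assign vI (Const 0)) +
     (straight_cost (assign vAns (Const 0)) + ?T))))) \<le> (?M + 1) * ((n + 1) ^ 2 * closure_cost)"
  proof -
    have "x + (?M + 1) * ((n + 1) ^ 2 * p + q) \<le> (?M + 1) * ((n + 1) ^ 2 * (x + p + q))" for x p q
      by (simp add: algebra_simps power2_eq_square)
    from this[of "closure_cost - process_cost - 1 - test_cost (Less (var vI) (var vN))" process_cost
        "1 + test_cost (Less (var vI) (var vN))"]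
    show ?thesis by (simp add: closure_cost_def ac_simps)
  qed
  ultimately show ?thesis by (rule runs_mono)
qed

end

section \<open>Computing the out-neighbourhoods\<close>

text \<open>The array \<open>ARR\<close> holds \<open>0\<close> for a vertex not reached so far and otherwise the earliest known
  arrival time plus one.\<close>

definition relax :: "bool \<Rightarrow> nat \<Rightarrow> nat \<Rightarrow> nat \<Rightarrow> (nat \<Rightarrow> nat) \<Rightarrow> nat \<Rightarrow> nat" where
  "relax strict l i j A = (if 0 < A i \<and> A i < l + (if strict then 1 else 2) \<and> \<not> (0 < A j \<and> A j < l + 2)
     then A(j := l + 1) else A)"

abbreviation (input) "tailE \<equiv> Reg (Plus (Const 3) (Plus (var vE) (Plus (var vE) (var vE))))"
abbreviation (input) "headE \<equiv> Reg (Plus (Const 4) (Plus (var vE) (Plus (var vE) (var vE))))"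
abbreviation (input) "labE \<equiv> Reg (Plus (Const 5) (Plus (var vE) (Plus (var vE) (var vE))))"

definition relax_com :: "bool \<Rightarrow> exp \<Rightarrow> exp \<Rightarrow> com" where
  "relax_com strict x y = Cond (And (Less (Const 0) (get ARR x))
     (And (Less (get ARR x) (Plus labE (Const (if strict then 1 else 2))))
       (Not (And (Less (Const 0) (get ARR y)) (Less (get ARR y) (Plus labE (Const 2)))))))
     (put ARR y (Plus labE (Const 1))) Skip"

definition edge_com :: "bool \<Rightarrow> bool \<Rightarrow> com" where
  "edge_com directed strict = Seq (relax_com strict tailE headE)
     (if directed then Skip else relax_com strict headE tailE)"

definition rounds_com :: "bool \<Rightarrow> bool \<Rightarrow> com" where
  "rounds_com directed strict = for_loop vR nE (for_loop vE mE (edge_com directed strict))"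

definition row_com :: "bool \<Rightarrow> bool \<Rightarrow> com" where
  "row_com directed strict =
     Seq (for_loop vV nE (put ARR (var vV) (Const 0)))
    (Seq (put ARR (var vU) (Const 1))
    (Seq (rounds_com directed strict)
    (Seq (assign vZ (Const 0))
    (Seq (for_loop vV nE (Cond (Less (Const 0) (get ARR (var vV)))
            (assign vZ (Plus (var vZ) (get POW (var vV)))) Skip))
      (put ROW (var vU) (var vZ))))))"

definition table_com :: "bool \<Rightarrow> bool \<Rightarrow> com" where
  "table_com directed strict = for_loop vU nE (row_com directed strict)"

definition row_cost :: "bool \<Rightarrow> bool \<Rightarrow> nat" where
  "row_cost directed strict = straight_cost (put ARR (var vV) (Const 0)) + for_cost vV nE +
     straight_cost (put ARR (var vU) (Const 1)) +
     straight_cost (edge_com directed strict) + for_cost vE mE + for_cost vR nE +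
     straight_cost (assign vZ (Const 0)) + straight_cost (Cond (Less (Const 0) (get ARR (var vV)))
            (assign vZ (Plus (var vZ) (get POW (var vV)))) Skip) + for_cost vV nE +
     straight_cost (put ROW (var vU) (var vZ))"

definition table_cost :: "bool \<Rightarrow> bool \<Rightarrow> nat" where
  "table_cost directed strict = row_cost directed strict + for_cost vU nE"

text \<open>Without temporal edges the path number is 0 and the time allowed is only linear in
  \<open>n\<close>, too little for filling the table. The answer then depends on \<open>n\<close>
  and \<open>s\<close> alone.\<close>

definition trivial_com :: com where
  "trivial_com = Cond (Less nE (Const 1))
     (Cond (Less sE (Const 1)) (Store (Const 0) (Const 1)) (Store (Const 0) (Const 0)))
     (Cond (And (Less sE (Const 2)) (Less (Const 0) sE)) (Store (Const 0) (Const 1)) (Store (Const 0) (Const 0)))"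

definition main_com :: "bool \<Rightarrow> bool \<Rightarrow> com" where
  "main_com directed strict = Cond (Less (Const 0) mE)
     (Seq pow_com (Seq (table_com directed strict) (Seq closure_com (Store (Const 0) (var vAns)))))
     trivial_com"

definition main_cost :: "bool \<Rightarrow> bool \<Rightarrow> nat" where
  "main_cost directed strict = 1 + test_cost (Less (Const 0) mE) + pow_cost + table_cost directed strict +
     closure_cost + straight_cost (Store (Const 0) (var vAns)) + straight_cost trivial_com"

section \<open>Correctness of the relaxation rounds\<close>

locale encoded =
  fixes directed strict :: bool and G :: "'v tgraph" and s :: nat and inp :: mem
    and vs :: "'v list" and tes :: "('v edge \<times> nat) list"
  assumes G: "temporal_graph directed G"
    and vs: "distinct vs" "set vs = verts G"
    and tes: "distinct tes" "set tes = temporal_edges G"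
    and size: "inp 0 = length vs" "inp 1 = length tes" "inp 2 = s"
    and entry: "x < length tes \<Longrightarrow> tes ! x = (e, l) \<Longrightarrow>
      inp (3 + 3 * x) < length vs \<and> inp (4 + 3 * x) < length vs \<and> inp (5 + 3 * x) = l \<and>
      joins e (vs ! inp (3 + 3 * x)) (vs ! inp (4 + 3 * x))"
begin

abbreviation "n \<equiv> length vs"
abbreviation "m \<equiv> length tes"

definition R :: "nat \<Rightarrow> nat set" where
  "R u = {v. v < n \<and> reaches strict G (vs ! u) (vs ! v)}"

text \<open>The number of edges is left open: within one round an entry may build on another one
  that was updated in the same round.\<close>

definition sound :: "nat \<Rightarrow> (nat \<Rightarrow> nat) \<Rightarrow> bool" where
  "sound u A \<longleftrightarrow> (\<forall>v<n. 0 < A v \<longrightarrow> (\<exists>h. arrives strict G (vs ! u) h (vs ! v) (A v - 1)))"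

text \<open>Entries are arrival times plus one, so this asks for an arrival no later than
  \<open>t\<close>. An earlier arrival is at least as good for every continuation.\<close>

definition found :: "(nat \<Rightarrow> nat) \<Rightarrow> nat \<Rightarrow> nat \<Rightarrow> bool" where
  "found A v t \<longleftrightarrow> 0 < A v \<and> A v \<le> t + 1"

definition complete :: "nat \<Rightarrow> nat \<Rightarrow> (nat \<Rightarrow> nat) \<Rightarrow> bool" where
  "complete u h A \<longleftrightarrow> (\<forall>v<n. \<forall>t. arrives strict G (vs ! u) h (vs ! v) t \<longrightarrow> found A v t)"

text \<open>The effect of having handled the temporal edge number \<open>x\<close> in the current
  round, in every direction in which it can be traversed. It survives the remaining relaxations,
  since entries only improve.\<close>

definition relaxed :: "nat \<Rightarrow> nat \<Rightarrow> nat \<Rightarrow> (nat \<Rightarrow> nat) \<Rightarrow> bool" where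
  "relaxed u h x A \<longleftrightarrow> (\<forall>v<n. \<forall>w<n. \<forall>t e l. tes ! x = (e, l) \<longrightarrow> joins e (vs ! v) (vs ! w) \<longrightarrow>
     arrives strict G (vs ! u) h (vs ! v) t \<longrightarrow> before strict t l \<longrightarrow> found A w l)"

lemma vs_verts: "v < n \<Longrightarrow> vs ! v \<in> verts G"
  using vs(2) nth_mem by metis

lemma R_refl: "u < n \<Longrightarrow> u \<in> R u"
  using reaches_refl[OF G] vs_verts by (simp add: R_def)

lemma R_subset: "R u \<subseteq> {..<n}"
  by (auto simp: R_def)

lemma found_relax: "found A v t \<Longrightarrow> found (relax strict l i j A) v t"
  unfolding found_def relax_def by (cases "v = j") (simp_all del: One_nat_def)

lemma relax_found: "found A i t \<Longrightarrow> before strict t l \<Longrightarrow> found (relax strict l i j A) j l"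
  unfolding found_def relax_def before_def by (cases strict) (simp_all del: One_nat_def)

lemma sound_relax:
  assumes "sound u A" "x < m" "tes ! x = (e, l)" "joins e (vs ! i) (vs ! j)" "i < n"
  shows "sound u (relax strict l i j A)"
proof (cases "0 < A i \<and> A i < l + (if strict then 1 else 2)")
  case True
  with assms obtain h where h: "arrives strict G (vs ! u) h (vs ! i) (A i - 1)"
    unfolding sound_def by blast
  have "(e, l) \<in> temporal_edges G" using assms(2,3) tes nth_mem by metis
  \<comment> \<open>With the stored value being the arrival time plus one, the thresholds
    \<open>l + 1\<close> and \<open>l + 2\<close> express arrival before \<open>l\<close> and no
    later than \<open>l\<close>.\<close>
  moreover have "before strict (A i - 1) l" using True by (auto simp: before_def split: if_splits)
  ultimately have j: "arrives strict G (vs ! u) (Suc h) (vs ! j) l"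
    using arrives.step[OF h] assms(4) by blast
  show ?thesis unfolding sound_def
  proof (intro allI impI)
    fix v assume v: "v < n" "0 < relax strict l i j A v"
    have "relax strict l i j A v = A v \<or> v = j \<and> relax strict l i j A v = l + 1"
      by (simp add: relax_def)
    then show "\<exists>h. arrives strict G (vs ! u) h (vs ! v) (relax strict l i j A v - 1)"
    proof
      assume "relax strict l i j A v = A v"
      then show ?thesis using assms(1) v by (simp add: sound_def)
    next
      assume "v = j \<and> relax strict l i j A v = l + 1"
      then show ?thesis using j by (metis add_diff_cancel_right')
    qed
  qed
next
  case False
  then have "relax strict l i j A = A" unfolding relax_def by meson
  then show ?thesis using assms by simp
qed

lemma complete_Suc:
  assumes c: "complete u h A" and r: "\<And>x. x < m \<Longrightarrow> relaxed u h x A"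
  shows "complete u (Suc h) A"
  unfolding complete_def
proof (intro allI impI)
  fix w t assume w: "w < n" and "arrives strict G (vs ! u) (Suc h) (vs ! w) t"
  from this(2) show "found A w t"
  proof cases
    case start
    then have "arrives strict G (vs ! u) h (vs ! w) t" by (simp add: arrives.start)
    then show ?thesis using c w by (simp add: complete_def)
  next
    case (step v t0 e)
    obtain v' where v': "v' < n" "v = vs ! v'"
      using arrives_target[OF G step(1)] vs by (metis in_set_conv_nth)
    obtain x where x: "x < m" "tes ! x = (e, t)" using step(2) tes by (metis in_set_conv_nth)
    show ?thesis
      using r[OF x(1), unfolded relaxed_def, rule_format, OF v'(1) w x(2) _ _ step(4)] v'(2) step(1,3) by simp
  qed
qed

lemma runs_relax:
  assumes x: "x < m" "g vE 0 = x"
    and e: "e = headE \<and> i = inp (4 + 3 * x) \<or> e = tailE \<and> i = inp (3 + 3 * x)"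
      "e' = headE \<and> j = inp (4 + 3 * x) \<or> e' = tailE \<and> j = inp (3 + 3 * x)"
    and Q: "\<And>h. (\<And>a. a \<noteq> ARR \<Longrightarrow> h a = g a) \<Longrightarrow> h ARR = relax strict (inp (5 + 3 * x)) i j (g ARR) \<Longrightarrow> Q h"
  shows "runs inp (relax_com strict e e') g (straight_cost (relax_com strict e e')) Q"
proof -
  have l: "val labE (layout inp g) = inp (5 + 3 * x)"
    using x size layout_input[of "5 + 3 * x" inp g] by (simp add: add.commute)
  have "val tailE (layout inp g) = inp (3 + 3 * x)" "val headE (layout inp g) = inp (4 + 3 * x)"
    using x size layout_input[of "3 + 3 * x" inp g] layout_input[of "4 + 3 * x" inp g] by (simp_all add: add.commute)
  with e have v: "val e (layout inp g) = i" "val e' (layout inp g) = j" by auto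
  show ?thesis unfolding relax_com_def
  proof (rule runs_straight_cond, goal_cases)
    case 1
    then have "g(ARR := (g ARR)(j := inp (5 + 3 * x) + 1)) = g(ARR := relax strict (inp (5 + 3 * x)) i j (g ARR))"
      unfolding holds.simps using v l by (auto simp: relax_def simp del: val.simps(2) split: if_splits)
    then show ?case
      using Q[of "g(ARR := relax strict (inp (5 + 3 * x)) i j (g ARR))"] v l
      by (intro runs_put) (simp_all del: val.simps(2))
  next
    case 2
    then have "relax strict (inp (5 + 3 * x)) i j (g ARR) = g ARR"
      unfolding holds.simps using v l by (auto simp: relax_def simp del: val.simps(2) split: if_splits)
    then show ?case using Q[of g] by (intro runs_skip) simp
  qed
qed

lemma runs_edge:
  assumes x: "x < m" and g: "g vE 0 = x" "sound u (g ARR)" "complete u h (g ARR)" "\<forall>y<x. relaxed u h y (g ARR)"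
    and Q: "\<And>g'. (\<And>a. a \<noteq> ARR \<Longrightarrow> g' a = g a) \<Longrightarrow> sound u (g' ARR) \<Longrightarrow> complete u h (g' ARR) \<Longrightarrow>
      \<forall>y<Suc x. relaxed u h y (g' ARR) \<Longrightarrow> Q g'"
  shows "runs inp (edge_com directed strict) g (straight_cost (edge_com directed strict)) Q"
proof -
  obtain e l where te: "tes ! x = (e, l)" by force
  define i where "i = inp (3 + 3 * x)"
  define j where "j = inp (4 + 3 * x)"
  have en: "i < n" "j < n" "inp (5 + 3 * x) = l" "joins e (vs ! i) (vs ! j)"
    using entry[OF x te] by (auto simp: i_def j_def)
  have el: "(e, l) \<in> temporal_edges G" using x te tes nth_mem by metis
  define P where "P A \<longleftrightarrow> sound u A \<and> complete u h A \<and> (\<forall>y<x. relaxed u h y A)" for A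
  have PI: "P (relax strict l a b A)" if "P A" "a < n" "joins e (vs ! a) (vs ! b)" for A a b
    using that sound_relax[OF _ x te] found_relax by (auto simp: P_def complete_def relaxed_def)
  have fin: "Q g'" if "\<And>a. a \<noteq> ARR \<Longrightarrow> g' a = g a" "P (g' ARR)" "relaxed u h x (g' ARR)" for g'
    using that Q by (auto simp: P_def less_Suc_eq)
  have P0: "P (g ARR)" using g by (simp add: P_def)
  let ?A = "relax strict l i j (g ARR)"
  have P1: "P ?A" using PI[OF P0 en(1,4)] .
  have rel1: "found ?A j l" if "arrives strict G (vs ! u) h (vs ! i) t" "before strict t l" for t
    using relax_found[OF _ that(2)] P0 en that(1) by (simp add: P_def complete_def)
  have idx: "v = i \<and> w = j \<or> \<not> directed \<and> v = j \<and> w = i"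
    if "v < n" "w < n" "joins e (vs ! v) (vs ! w)" for v w
    using joins_unique[OF G el that(3) en(4)] that en vs(1) by (auto simp: nth_eq_iff_index_eq)
  show ?thesis unfolding edge_com_def
  proof (rule runs_straight_seq, rule runs_relax[where i = i and j = j and g = g, OF x g(1)], goal_cases)
    case 1 show ?case by (simp add: i_def)
  next
    case 2 show ?case by (simp add: j_def)
  next
    case (3 g1)
    have g1: "g1 ARR = ?A" using 3 en by simp
    show ?case
    proof (cases directed)
      case True
      have "relaxed u h x (g1 ARR)"
        unfolding relaxed_def using idx rel1 te True g1 by fastforce
      then have "Q g1" using 3 P1 g1 by (intro fin) simp_all
      then show ?thesis using True by (simp add: runs_skip del: straight_cost.simps)
    next
      case False
      have rev_joins: "joins e (vs ! j) (vs ! i)"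
        using en(4) el G False by (auto simp: joins_def temporal_graph_def temporal_edges_def insert_commute)
      have "runs inp (relax_com strict headE tailE) g1 (straight_cost (relax_com strict headE tailE)) Q"
      proof (rule runs_relax[where i = j and j = i, OF x], goal_cases)
        case 1 show ?case using 3 g by simp
      next
        case 2 show ?case by (simp add: j_def)
      next
        case 3 show ?case by (simp add: i_def)
      next
        case (4 g2)
        have g2: "g2 ARR = relax strict l j i ?A" using 4 g1 en by simp
        have "relaxed u h x (g2 ARR)"
          unfolding relaxed_def
        proof (intro allI impI)
          fix v w t e' l' assume *: "v < n" "w < n" "tes ! x = (e', l')" "joins e' (vs ! v) (vs ! w)"
            "arrives strict G (vs ! u) h (vs ! v) t" "before strict t l'"
          then have e': "e' = e" "l' = l" using te by auto
          from idx[of v w] * e' consider "v = i" "w = j" | "v = j" "w = i" by auto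
          then show "found (g2 ARR) w l'"
          proof cases
            case 1
            then show ?thesis using rel1 * e' found_relax g2 by simp
          next
            case 2
            have "found ?A j t" using P1 * 2 by (simp add: P_def complete_def)
            then show ?thesis using relax_found * 2 e' g2 by simp
          qed
        qed
        moreover have "P (g2 ARR)" using PI[OF P1 en(2) rev_joins] g2 by simp
        moreover have "\<And>a. a \<noteq> ARR \<Longrightarrow> g2 a = g a" using 4 3 by simp
        ultimately show ?case using fin[of g2] by blast
      qed
      then show ?thesis using False by simp
    qed
  qed
qed

lemma runs_rounds:
  assumes f: "sound u (f ARR)" "complete u 0 (f ARR)"
  shows "runs inp (rounds_com directed strict) f
    ((n + 1) * ((m + 1) * (straight_cost (edge_com directed strict) + for_cost vE mE) + for_cost vR nE))
    (\<lambda>g. sound u (g ARR) \<and> complete u n (g ARR) \<and> (\<forall>a. a \<notin> {ARR, vR, vE} \<longrightarrow> g a = f a))"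
proof -
  define I where "I h g \<longleftrightarrow> g vR 0 = h \<and> sound u (g ARR) \<and> complete u h (g ARR) \<and>
    (\<forall>a. a \<notin> {ARR, vR, vE} \<longrightarrow> g a = f a)" for h g
  define J where "J h x g \<longleftrightarrow> g vE 0 = x \<and> (\<forall>y<x. relaxed u h y (g ARR)) \<and> I h g" for h x g
  have round: "runs inp (for_loop vE mE (edge_com directed strict)) g
      ((m + 1) * (straight_cost (edge_com directed strict) + for_cost vE mE)) (J h m)"
    if g: "I h g" for h g
  proof (rule runs_for[where I = "J h"])
    show "J h 0 (g(vE := (g vE)(0 := 0)))" using g by (simp add: J_def I_def)
  next
    fix x g assume "J h x g"
    then show "g vE 0 = x \<and> val mE (layout inp g) = m" using size by (simp add: J_def)
  next
    fix x g assume x: "x < m" and J: "J h x g"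
    show "runs inp (edge_com directed strict) g (straight_cost (edge_com directed strict))
        (\<lambda>g'. g' vE 0 = x \<and> J h (Suc x) (g'(vE := (g' vE)(0 := Suc x))))"
    proof (rule runs_edge[OF x, of _ u h], goal_cases)
      case (5 g')
      then show ?case using J unfolding J_def I_def by simp
    qed (use J in \<open>auto simp: J_def I_def\<close>)
  qed simp
  have "runs inp (rounds_com directed strict) f
    ((n + 1) * ((m + 1) * (straight_cost (edge_com directed strict) + for_cost vE mE) + for_cost vR nE)) (I n)"
    unfolding rounds_com_def
  proof (rule runs_for[where I = I])
    show "I 0 (f(vR := (f vR)(0 := 0)))" using f by (simp add: I_def)
  next
    fix h g assume "I h g"
    then show "g vR 0 = h \<and> val nE (layout inp g) = n" using size by (simp add: I_def)
  next
    fix h g assume "h < n" and I: "I h g"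
    show "runs inp (for_loop vE mE (edge_com directed strict)) g
      ((m + 1) * (straight_cost (edge_com directed strict) + for_cost vE mE))
      (\<lambda>g'. g' vR 0 = h \<and> I (Suc h) (g'(vR := (g' vR)(0 := Suc h))))"
    proof (rule runs_mono[OF round[OF I] order_refl])
      fix g' assume J: "J h m g'"
      then have "complete u (Suc h) (g' ARR)" by (intro complete_Suc) (auto simp: J_def I_def)
      then show "g' vR 0 = h \<and> I (Suc h) (g'(vR := (g' vR)(0 := Suc h)))"
        using J by (simp add: J_def I_def)
    qed
  qed simp
  then show ?thesis by (rule runs_mono) (auto simp: I_def)
qed

lemma R_iff:
  assumes "sound u A" "complete u n A" "v < n"
  shows "0 < A v \<longleftrightarrow> v \<in> R u"
proof
  assume "0 < A v"
  with assms obtain h where "arrives strict G (vs ! u) h (vs ! v) (A v - 1)" unfolding sound_def by blast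
  then show "v \<in> R u" using assms(3) by (auto simp: R_def reaches_iff_arrives[OF G])
next
  assume "v \<in> R u"
  then obtain t where "arrives strict G (vs ! u) (card (verts G)) (vs ! v) t"
    unfolding R_def using reaches_arrives_card[OF G] by blast
  moreover have "card (verts G) = n" using vs distinct_card by metis
  ultimately show "0 < A v" using assms by (auto simp: complete_def found_def)
qed

lemma runs_row:
  assumes u: "u < n" "f vU 0 = u" and pow: "\<forall>v<n. f POW v = 2 ^ v"
  shows "runs inp (row_com directed strict) f ((n + 1) * ((m + 1) * row_cost directed strict))
    (\<lambda>g. (\<forall>a. a \<notin> {ARR, ROW, vR, vE, vV, vZ} \<longrightarrow> g a = f a) \<and>
      g ROW = (f ROW)(u := set_encode (R u)))"
proof -
  let ?clear = "put ARR (var vV) (Const 0)"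
  let ?collect = "Cond (Less (Const 0) (get ARR (var vV))) (assign vZ (Plus (var vZ) (get POW (var vV)))) Skip"
  let ?Tr = "(n + 1) * ((m + 1) * (straight_cost (edge_com directed strict) + for_cost vE mE) + for_cost vR nE)"
  define I where "I j g \<longleftrightarrow> g vV 0 = j \<and> (\<forall>v<j. g ARR v = 0) \<and> (\<forall>a. a \<notin> {ARR, vV} \<longrightarrow> g a = f a)" for j g
  have clear: "runs inp (for_loop vV nE ?clear) f ((n + 1) * (straight_cost ?clear + for_cost vV nE)) (I n)"
  proof (rule runs_for[where I = I])
    fix j g assume "I j g"
    then show "g vV 0 = j \<and> val nE (layout inp g) = n" using size by (simp add: I_def)
  next
    fix j g assume "j < n" "I j g"
    then show "runs inp ?clear g (straight_cost ?clear) (\<lambda>h. h vV 0 = j \<and> I (Suc j) (h(vV := (h vV)(0 := Suc j))))"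
      by (intro runs_put) (simp_all add: I_def less_Suc_eq)
  qed (simp_all add: I_def)
  define K where "K f' j g \<longleftrightarrow> g vV 0 = j \<and> g vZ 0 = set_encode (R u \<inter> {..<j}) \<and>
    (\<forall>a. a \<notin> {vV, vZ} \<longrightarrow> g a = f' a)" for f' :: "nat \<Rightarrow> nat \<Rightarrow> nat" and j g
  have collect: "runs inp (for_loop vV nE ?collect) f' ((n + 1) * (straight_cost ?collect + for_cost vV nE)) (K f' n)"
    if f': "sound u (f' ARR)" "complete u n (f' ARR)" "f' vZ 0 = 0" "\<forall>v<n. f' POW v = 2 ^ v" for f'
  proof (rule runs_for[where I = "K f'"])
    show "K f' 0 (f'(vV := (f' vV)(0 := 0)))" using f' by (simp add: K_def)
  next
    fix j g assume "K f' j g"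
    then show "g vV 0 = j \<and> val nE (layout inp g) = n" using size by (simp add: K_def)
  next
    fix j g assume j: "j < n" and K: "K f' j g"
    have c: "g ARR = f' ARR" "g POW j = 2 ^ j" "g vV 0 = j" "g vZ 0 = set_encode (R u \<inter> {..<j})"
      using K f' j by (auto simp: K_def)
    have iff: "0 < f' ARR j \<longleftrightarrow> j \<in> R u" using R_iff f' j by blast
    have e: "R u \<inter> {..<Suc j} = (if j \<in> R u then insert j (R u \<inter> {..<j}) else R u \<inter> {..<j})"
      by (auto simp: less_Suc_eq)
    show "runs inp ?collect g (straight_cost ?collect) (\<lambda>h. h vV 0 = j \<and> K f' (Suc j) (h(vV := (h vV)(0 := Suc j))))"
    proof (intro runs_straight)
      assume "holds (Less (Const 0) (get ARR (var vV))) (layout inp g)"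
      then have "j \<in> R u" using c iff by simp
      then show "(g(vZ := (g vZ)(0 := val (Plus (var vZ) (get POW (var vV))) (layout inp g)))) vV 0 = j \<and>
        K f' (Suc j) ((g(vZ := (g vZ)(0 := val (Plus (var vZ) (get POW (var vV))) (layout inp g))))
          (vV := ((g(vZ := (g vZ)(0 := val (Plus (var vZ) (get POW (var vV))) (layout inp g)))) vV)(0 := Suc j)))"
        using c K unfolding K_def e by (simp add: set_encode_insert)
    next
      assume "\<not> holds (Less (Const 0) (get ARR (var vV))) (layout inp g)"
      then have "j \<notin> R u" using c iff by simp
      then show "g vV 0 = j \<and> K f' (Suc j) (g(vV := (g vV)(0 := Suc j)))"
        using c K unfolding K_def e by simp
    qed simp
  qed simp
  have RI: "R u \<inter> {..<n} = R u" using R_subset by auto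
  have "runs inp (row_com directed strict) f ((n + 1) * (straight_cost ?clear + for_cost vV nE) +
    (straight_cost (put ARR (var vU) (Const 1)) + (?Tr + (straight_cost (assign vZ (Const 0)) +
    ((n + 1) * (straight_cost ?collect + for_cost vV nE) + straight_cost (put ROW (var vU) (var vZ)))))))
    (\<lambda>g. (\<forall>a. a \<notin> {ARR, ROW, vR, vE, vV, vZ} \<longrightarrow> g a = f a) \<and> g ROW = (f ROW)(u := set_encode (R u)))"
    unfolding row_com_def
  proof (rule runs_seq, rule runs_mono[OF clear order_refl])
    fix g assume g: "I n g"
    \<comment> \<open>The entry 1 encodes arrival at the source at time 0.\<close>
    let ?g1 = "g(ARR := (g ARR)(u := 1))"
    have "0 < ?g1 ARR v \<longleftrightarrow> v = u" if "v < n" for v using g that by (simp add: I_def)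
    moreover have "v = u \<and> t = 0" if "arrives strict G (vs ! u) 0 (vs ! v) t" "v < n" for v t
      using that(1) by cases (use that(2) u(1) vs(1) in \<open>simp_all add: nth_eq_iff_index_eq\<close>)
    ultimately have "sound u (?g1 ARR)" "complete u 0 (?g1 ARR)"
      using arrives.start[OF vs_verts[OF u(1)], of strict 0] unfolding sound_def complete_def found_def
      by fastforce+
    note rounds = runs_rounds[of u ?g1, OF this]
    show "runs inp (Seq (put ARR (var vU) (Const 1)) (Seq (rounds_com directed strict)
      (Seq (assign vZ (Const 0)) (Seq (for_loop vV nE ?collect) (put ROW (var vU) (var vZ)))))) g
      (straight_cost (put ARR (var vU) (Const 1)) + (?Tr + (straight_cost (assign vZ (Const 0)) +
      ((n + 1) * (straight_cost ?collect + for_cost vV nE) + straight_cost (put ROW (var vU) (var vZ))))))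
      (\<lambda>g. (\<forall>a. a \<notin> {ARR, ROW, vR, vE, vV, vZ} \<longrightarrow> g a = f a) \<and> g ROW = (f ROW)(u := set_encode (R u)))"
    proof (rule runs_seq, rule runs_put, simp)
      have gU: "val (var vU) (layout inp g) = u" using g u by (simp add: I_def)
      show "runs inp (Seq (rounds_com directed strict)
        (Seq (assign vZ (Const 0)) (Seq (for_loop vV nE ?collect) (put ROW (var vU) (var vZ)))))
        (g(ARR := (g ARR)(val (var vU) (layout inp g) := val (Const 1) (layout inp g))))
        (?Tr + (straight_cost (assign vZ (Const 0)) +
        ((n + 1) * (straight_cost ?collect + for_cost vV nE) + straight_cost (put ROW (var vU) (var vZ)))))
        (\<lambda>g. (\<forall>a. a \<notin> {ARR, ROW, vR, vE, vV, vZ} \<longrightarrow> g a = f a) \<and> g ROW = (f ROW)(u := set_encode (R u)))"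
        unfolding gU val.simps(1)
      proof (rule runs_seq, rule runs_mono[OF rounds order_refl], rule runs_seq, rule runs_assign, simp, rule runs_seq)
        fix h assume h: "sound u (h ARR) \<and> complete u n (h ARR) \<and> (\<forall>a. a \<notin> {ARR, vR, vE} \<longrightarrow> h a = ?g1 a)"
        let ?h1 = "h(vZ := (h vZ)(0 := val (Const 0) (layout inp h)))"
        have h1: "sound u (?h1 ARR)" "complete u n (?h1 ARR)" "?h1 vZ 0 = 0" "\<forall>v<n. ?h1 POW v = 2 ^ v"
          using h g pow by (simp_all add: I_def)
        show "runs inp (for_loop vV nE ?collect) ?h1 ((n + 1) * (straight_cost ?collect + for_cost vV nE))
          (\<lambda>h. runs inp (put ROW (var vU) (var vZ)) h (straight_cost (put ROW (var vU) (var vZ)))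
            (\<lambda>g. (\<forall>a. a \<notin> {ARR, ROW, vR, vE, vV, vZ} \<longrightarrow> g a = f a) \<and> g ROW = (f ROW)(u := set_encode (R u))))"
        proof (rule runs_mono[OF collect[OF h1] order_refl])
          fix h2 assume h2: "K ?h1 n h2"
          have "h2 vZ 0 = set_encode (R u)" using h2 RI by (simp add: K_def)
          moreover have "h2 a = f a" if "a \<notin> {ARR, vR, vE, vV, vZ}" for a
            using h2 h g that by (simp add: K_def I_def)
          ultimately show "runs inp (put ROW (var vU) (var vZ)) h2 (straight_cost (put ROW (var vU) (var vZ)))
            (\<lambda>g. (\<forall>a. a \<notin> {ARR, ROW, vR, vE, vV, vZ} \<longrightarrow> g a = f a) \<and> g ROW = (f ROW)(u := set_encode (R u)))"
            using u by (intro runs_put) simp_all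
        qed
      qed
    qed
  qed
  then show ?thesis
  proof (rule runs_mono)
    have "(n + 1) * (a + b) + (c + ((n + 1) * ((m + 1) * (d + e) + h) + (i + ((n + 1) * (j + b) + k))))
      \<le> (n + 1) * ((m + 1) * (a + b + c + d + e + h + i + j + b + k))" for a b c d e h i j k
      by (simp add: algebra_simps)
    then show "(n + 1) * (straight_cost ?clear + for_cost vV nE) +
      (straight_cost (put ARR (var vU) (Const 1)) + (?Tr + (straight_cost (assign vZ (Const 0)) +
      ((n + 1) * (straight_cost ?collect + for_cost vV nE) + straight_cost (put ROW (var vU) (var vZ))))))
      \<le> (n + 1) * ((m + 1) * row_cost directed strict)"
      unfolding row_cost_def .
  qed
qed

lemma runs_table:
  assumes pow: "\<forall>v\<le>n. f POW v = 2 ^ v"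
  shows "runs inp (table_com directed strict) f ((n + 1) ^ 2 * ((m + 1) * table_cost directed strict))
    (\<lambda>g. (\<forall>a. a \<notin> {ARR, ROW, vR, vE, vV, vZ, vU} \<longrightarrow> g a = f a) \<and> (\<forall>u<n. g ROW u = set_encode (R u)))"
proof -
  define I where "I u g \<longleftrightarrow> g vU 0 = u \<and> (\<forall>a. a \<notin> {ARR, ROW, vR, vE, vV, vZ, vU} \<longrightarrow> g a = f a) \<and>
    (\<forall>u'<u. g ROW u' = set_encode (R u'))" for u g
  have "runs inp (table_com directed strict) f
      ((n + 1) * ((n + 1) * ((m + 1) * row_cost directed strict) + for_cost vU nE)) (I n)"
    unfolding table_com_def
  proof (rule runs_for[where I = I])
    fix u g assume "I u g"
    then show "g vU 0 = u \<and> val nE (layout inp g) = n" using size by (simp add: I_def)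
  next
    fix u g assume u: "u < n" and I: "I u g"
    have "runs inp (row_com directed strict) g ((n + 1) * ((m + 1) * row_cost directed strict))
      (\<lambda>h. (\<forall>a. a \<notin> {ARR, ROW, vR, vE, vV, vZ} \<longrightarrow> h a = g a) \<and> h ROW = (g ROW)(u := set_encode (R u)))"
      by (rule runs_row[OF u]) (use I pow in \<open>simp_all add: I_def\<close>)
    then show "runs inp (row_com directed strict) g ((n + 1) * ((m + 1) * row_cost directed strict))
      (\<lambda>h. h vU 0 = u \<and> I (Suc u) (h(vU := (h vU)(0 := Suc u))))"
      by (rule runs_mono[OF _ order_refl]) (use I in \<open>simp add: I_def less_Suc_eq\<close>)
  qed (simp_all add: I_def)
  then show ?thesis
    by (rule runs_mono) (auto simp: I_def table_cost_def algebra_simps power2_eq_square)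
qed

end

section \<open>Deciding oTCC\<close>

text \<open>Register 0 belongs to the input, so writing the answer there leaves the memories of the
  form \<open>layout inp f\<close>. Such commands are treated with \<open>exec\<close>
  directly.\<close>

lemma exec_choose:
  "\<exists>t. exec (Cond p (Store (Const 0) (Const 1)) (Store (Const 0) (Const 0))) \<sigma> t
      (\<sigma>(0 := if holds p \<sigma> then 1 else 0)) \<and>
    t \<le> straight_cost (Cond p (Store (Const 0) (Const 1)) (Store (Const 0) (Const 0)))"
proof (cases "holds p \<sigma>")
  case True
  have "exec (Store (Const 0) (Const 1)) \<sigma> 3 (\<sigma>(0 := 1))"
    using exec.store[of "Const 0" "Const 1" \<sigma>] by (simp add: numeral_3_eq_3)
  from exec.cond_true[OF True this] show ?thesis
    using True by (intro exI[of _ "1 + test_cost p + 3"]) simp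
next
  case False
  have "exec (Store (Const 0) (Const 0)) \<sigma> 3 (\<sigma>(0 := 0))"
    using exec.store[of "Const 0" "Const 0" \<sigma>] by (simp add: numeral_3_eq_3)
  from exec.cond_false[OF False this] show ?thesis
    using False by (intro exI[of _ "1 + test_cost p + 3"]) simp
qed

lemma exec_trivial:
  "\<exists>t \<tau>. exec trivial_com \<sigma> t \<tau> \<and> t \<le> straight_cost trivial_com \<and>
    \<tau> 0 = (if \<sigma> 0 = 0 \<and> \<sigma> 2 = 0 \<or> \<sigma> 0 \<noteq> 0 \<and> \<sigma> 2 = 1 then 1 else 0)"
proof (cases "holds (Less nE (Const 1)) \<sigma>")
  case True
  obtain t where t: "exec (Cond (Less sE (Const 1)) (Store (Const 0) (Const 1)) (Store (Const 0) (Const 0))) \<sigma> t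
      (\<sigma>(0 := if holds (Less sE (Const 1)) \<sigma> then 1 else 0))"
    "t \<le> straight_cost (Cond (Less sE (Const 1)) (Store (Const 0) (Const 1)) (Store (Const 0) (Const 0)))"
    using exec_choose by blast
  from exec.cond_true[OF True t(1)] t(2) True show ?thesis
    unfolding trivial_com_def by (intro exI conjI) (assumption, auto)
next
  case False
  let ?p = "And (Less sE (Const 2)) (Less (Const 0) sE)"
  obtain t where t: "exec (Cond ?p (Store (Const 0) (Const 1)) (Store (Const 0) (Const 0))) \<sigma> t
      (\<sigma>(0 := if holds ?p \<sigma> then 1 else 0))"
    "t \<le> straight_cost (Cond ?p (Store (Const 0) (Const 1)) (Store (Const 0) (Const 0)))"
    using exec_choose by blast
  from exec.cond_false[OF False t(1)] t(2) False show ?thesis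
    unfolding trivial_com_def by (intro exI conjI) (assumption, auto)
qed

section \<open>From index sets back to vertex sets\<close>

context encoded
begin

abbreviation "img X \<equiv> (!) vs ` X"

lemma inj_vs: "inj_on ((!) vs) {..<n}"
  using vs(1) by (auto simp: inj_on_def nth_eq_iff_index_eq)

lemma img_all: "img {..<n} = verts G"
  using vs(2) by (auto simp: set_conv_nth)

lemma img_cases:
  assumes "Y \<subseteq> verts G"
  obtains X where "X \<subseteq> {..<n}" "Y = img X"
  using assms that by (metis img_all subset_image_iff)

lemma img_subset: "X \<subseteq> {..<n} \<Longrightarrow> Y \<subseteq> {..<n} \<Longrightarrow> img X \<subseteq> img Y \<longleftrightarrow> X \<subseteq> Y"
  using inj_on_image_mem_iff[OF inj_vs] by blast

lemma clique_iff:
  assumes "X \<subseteq> {..<n}"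
  shows "clique n R X \<longleftrightarrow> temporally_connected strict G (img X)"
proof -
  have "img X \<subseteq> verts G" using assms img_all by blast
  then show ?thesis using assms unfolding clique_def temporally_connected_def R_def by auto
qed

lemma open_tcc_iff:
  assumes X: "X \<subseteq> {..<n}"
  shows "max_clique n R X \<longleftrightarrow> open_tcc strict G (img X)"
proof
  assume M: "max_clique n R X"
  show "open_tcc strict G (img X)" unfolding open_tcc_def
  proof (intro conjI allI impI)
    show "temporally_connected strict G (img X)" using M clique_iff[OF X] by (simp add: max_clique_def)
    fix Z assume Z: "temporally_connected strict G Z \<and> img X \<subseteq> Z"
    then have "Z \<subseteq> verts G" by (simp add: temporally_connected_def)
    then obtain Y where Y: "Y \<subseteq> {..<n}" "Z = img Y" by (rule img_cases)
    then have "clique n R Y" "X \<subseteq> Y" using Z clique_iff img_subset[OF X Y(1)] by auto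
    with M have "Y = X" by (simp add: max_clique_def)
    with Y show "Z = img X" by simp
  qed
next
  assume M: "open_tcc strict G (img X)"
  show "max_clique n R X" unfolding max_clique_def
  proof (intro conjI allI impI)
    show "clique n R X" using M clique_iff[OF X] by (simp add: open_tcc_def)
    fix Y assume Y: "clique n R Y \<and> X \<subseteq> Y"
    then have Yn: "Y \<subseteq> {..<n}" by (simp add: clique_def)
    then have "img Y = img X" using M Y clique_iff[OF Yn] unfolding open_tcc_def by blast
    then show "Y = X" using img_subset[OF X Yn] img_subset[OF Yn X] by auto
  qed
qed

lemma oTCC_iff: "oTCC strict G s \<longleftrightarrow> (\<exists>X. max_clique n R X \<and> card X = s)"
proof
  assume "oTCC strict G s"
  then obtain Y where Y: "open_tcc strict G Y" "card Y = s" by (auto simp: oTCC_def)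
  then have "Y \<subseteq> verts G" by (simp add: open_tcc_def temporally_connected_def)
  then obtain X where X: "X \<subseteq> {..<n}" "Y = img X" by (rule img_cases)
  then have "card Y = card X" using inj_vs by (metis card_image inj_on_subset)
  then show "\<exists>X. max_clique n R X \<and> card X = s" using Y X open_tcc_iff by metis
next
  assume "\<exists>X. max_clique n R X \<and> card X = s"
  then obtain X where X: "max_clique n R X" "card X = s" by blast
  then have "X \<subseteq> {..<n}" by (simp add: max_clique_def clique_def)
  then have "open_tcc strict G (img X)" "card (img X) = s"
    using X open_tcc_iff inj_vs by (metis, metis card_image inj_on_subset)
  then show "oTCC strict G s" by (auto simp: oTCC_def)
qed

text \<open>Carries the count of common out-neighbourhoods of vertices over to the family of index
  sets that the program enumerates.\<close>

lemma card_meets: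
  "card (meets n R) \<le> card (common strict G ` Pow (verts G))"
proof (rule card_inj_on_le)
  show "inj_on (image ((!) vs)) (meets n R)"
    by (rule inj_on_subset[OF inj_on_image_Pow[OF inj_vs]]) (auto simp: meets_def meet_def)
  have "img (meet n R U) = common strict G (img U)" if U: "U \<subseteq> {..<n}" for U
  proof
    show "img (meet n R U) \<subseteq> common strict G (img U)"
      using vs_verts by (auto simp: meet_def common_def R_def)
    show "common strict G (img U) \<subseteq> img (meet n R U)"
    proof
      fix w assume w: "w \<in> common strict G (img U)"
      then obtain v where "v < n" "w = vs ! v" using img_all by (auto simp: common_def)
      with w show "w \<in> img (meet n R U)" by (auto simp: common_def meet_def R_def)
    qed
  qed
  moreover have "img U \<in> Pow (verts G)" if "U \<subseteq> {..<n}" for U using that img_all by blast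
  ultimately show "image ((!) vs) ` meets n R \<subseteq> common strict G ` Pow (verts G)"
    by (auto simp: meets_def)
  show "finite (common strict G ` Pow (verts G))"
    using G by (simp add: temporal_graph_def)
qed

lemma card_verts: "card (verts G) = n"
  using vs distinct_card by metis

text \<open>A temporal edge forces \<open>1 \<le> k\<close> and \<open>2 \<le> n\<close>. The
  constants come from \<open>(n + 1) ^ 2 \<le> 4 * n ^ 2\<close>, from
  \<open>m + 1 \<le> 2 * (k * n)\<close>, and from doubling the size of the nonempty family: 8 is 4
  times 2, and 64 is 2 times 4 times the 8 of \<open>family_bound\<close>.\<close>

lemma size_bounds:
  assumes m: "0 < m"
  defines "k \<equiv> tpn strict G"
  shows "(n + 1) \<le> 2 * n ^ (2 * k + 1)" "(n + 1) ^ 2 * (m + 1) \<le> 8 * n ^ (2 * k + 1)"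
    "(card (meets n R) + 1) * (n + 1) ^ 2 \<le> 64 * n ^ (2 * k + 1)" "1 \<le> n ^ (2 * k + 1)"
proof -
  obtain Ps where Ps: "length Ps = k" "\<forall>ps \<in> set Ps. \<exists>ws. temporal_path strict G ws ps"
    "\<forall>te \<in> temporal_edges G. \<exists>!i. i < k \<and> te \<in> set (Ps ! i)"
    using k_path_graph_tpn[OF G, of strict] unfolding k_path_graph_def k_def by blast
  then have "\<forall>A \<in> {..<k}. \<exists>ws. temporal_path strict G ws (Ps ! A)" by simp
  then obtain ws where ws: "\<And>A. A < k \<Longrightarrow> temporal_path strict G (ws A) (Ps ! A)"
    using bchoice[of "{..<k}" "\<lambda>A ws. temporal_path strict G ws (Ps ! A)"] by auto
  interpret path_cover directed strict G ws "\<lambda>A. Ps ! A" k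
    by unfold_locales (use G ws Ps(3) in auto)
  obtain e l where el: "(e, l) \<in> temporal_edges G"
    using m tes(2) by (metis length_greater_0_conv list.set_intros(1) neq_Nil_conv surj_pair)
  then have k: "1 \<le> k" using Ps(3) by (metis less_one linorder_not_less not_less_zero)
  obtain a b where ab: "a \<in> verts G" "b \<in> verts G" "a \<noteq> b"
    using el G by (auto simp: temporal_edges_def temporal_graph_def)
  then have n: "2 \<le> n"
    using card_mono[of "verts G" "{a, b}"] G card_verts by (simp add: temporal_graph_def)
  define N where "N = n ^ (2 * k + 1)"
  have "n \<le> N" unfolding N_def using n by (intro self_le_power) auto
  then show "(n + 1) \<le> 2 * n ^ (2 * k + 1)" "1 \<le> n ^ (2 * k + 1)"
    unfolding N_def[symmetric] using n by linarith+
  have "(n + 1) ^ 2 \<le> (2 * n) ^ 2" using n by (intro power_mono) auto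
  then have sq: "(n + 1) ^ 2 \<le> 4 * n ^ 2" by (simp add: power_mult_distrib)
  have "m = card (temporal_edges G)" using tes distinct_card by metis
  then have "m \<le> k * n" using card_temporal_edges card_verts by simp
  then have "m + 1 \<le> 2 * (k * n)" using m by linarith
  then have "(n + 1) ^ 2 * (m + 1) \<le> 4 * n ^ 2 * (2 * (k * n))" using sq by (rule mult_le_mono[rotated])
  also have "\<dots> = 8 * (k * n ^ 3)" by (simp add: power2_eq_square power3_eq_cube)
  finally show "(n + 1) ^ 2 * (m + 1) \<le> 8 * n ^ (2 * k + 1)" using table_bound[OF k n] by linarith
  let ?M = "card (meets n R)"
  have "?M \<le> (n + 1) ^ k * k ^ k + n + 1"
    by (rule order_trans[OF card_meets]) (use card_commons card_verts in simp)
  then have M: "?M * n ^ 2 \<le> 8 * N" unfolding N_def using card_meets_le by (rule family_bound[OF k n])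
  have "meets n R \<noteq> {}" by (auto simp: meets_def)
  then have "?M + 1 \<le> 2 * ?M" using finite_meets by (simp add: Suc_le_eq card_gt_0_iff)
  then have "(?M + 1) * (n + 1) ^ 2 \<le> 2 * ?M * (4 * n ^ 2)" using sq by (rule mult_le_mono)
  also have "\<dots> = 8 * (?M * n ^ 2)" by simp
  finally show "(?M + 1) * (n + 1) ^ 2 \<le> 64 * n ^ (2 * k + 1)" using M unfolding N_def by linarith
qed

lemma exec_main_nontrivial:
  assumes m: "0 < m" and zero: "\<And>x. 3 + 3 * m \<le> x \<Longrightarrow> inp x = 0"
  shows "\<exists>t \<tau>. exec (main_com directed strict) inp t \<tau> \<and> \<tau> 0 = (if oTCC strict G s then 1 else 0) \<and>
    t \<le> 64 * main_cost directed strict * n ^ (2 * tpn strict G + 1)"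
proof -
  interpret closure inp n s R
    using size R_subset R_refl by unfold_locales auto
  \<comment> \<open>All registers beyond the input are zero, so the initial memory is the layout
    with empty arrays; in particular all flags are cleared.\<close>
  have init: "layout inp (\<lambda>_ _. 0) = inp" using zero size by (auto simp: layout_def)
  let ?T1 = "(n + 1) * pow_cost" and ?T2 = "(n + 1) ^ 2 * ((m + 1) * table_cost directed strict)"
    and ?T3 = "(card (meets n R) + 1) * ((n + 1) ^ 2 * closure_cost)"
  have "runs inp (Seq pow_com (Seq (table_com directed strict) closure_com)) (\<lambda>_ _. 0) (?T1 + (?T2 + ?T3))
      (\<lambda>g. g vAns 0 = (if \<exists>W \<in> meets n R. accepts W then 1 else 0))"
  proof (rule runs_seq, rule runs_mono[OF runs_pow[of inp n] order_refl])
    fix g :: "nat \<Rightarrow> nat \<Rightarrow> nat"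
    assume g: "(\<forall>v\<le>n. g POW v = 2 ^ v) \<and> (\<forall>a. a \<notin> {POW, vV} \<longrightarrow> g a = (\<lambda>_. 0))"
    show "runs inp (Seq (table_com directed strict) closure_com) g (?T2 + ?T3)
      (\<lambda>g. g vAns 0 = (if \<exists>W \<in> meets n R. accepts W then 1 else 0))"
    proof (rule runs_seq, rule runs_mono[OF runs_table order_refl])
      show "\<forall>v\<le>n. g POW v = 2 ^ v" using g by simp
    next
      fix h assume h: "(\<forall>a. a \<notin> {ARR, ROW, vR, vE, vV, vZ, vU} \<longrightarrow> h a = g a) \<and> (\<forall>u<n. h ROW u = set_encode (R u))"
      show "runs inp closure_com h ?T3 (\<lambda>g. g vAns 0 = (if \<exists>W \<in> meets n R. accepts W then 1 else 0))"
        by (rule runs_closure) (use g h in \<open>simp_all add: tables_def\<close>)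
    qed
  qed (use size in simp)
  then obtain t f where f: "exec (Seq pow_com (Seq (table_com directed strict) closure_com)) inp t (layout inp f)"
    "t \<le> ?T1 + (?T2 + ?T3)" "f vAns 0 = (if \<exists>W \<in> meets n R. accepts W then 1 else 0)"
    unfolding runs_def init by blast
  \<comment> \<open>The run is taken apart so that the final store, which overwrites an input
    register, can be put behind it in the nesting of \<open>main_com\<close>.\<close>
  from f(1) obtain t1 t2 t3 \<sigma>1 \<sigma>2 where parts: "exec pow_com inp t1 \<sigma>1"
    "exec (table_com directed strict) \<sigma>1 t2 \<sigma>2" "exec closure_com \<sigma>2 t3 (layout inp f)" "t = t1 + (t2 + t3)"
    by (elim exec_elims(3)) blast
  let ?out = "Store (Const 0) (var vAns)"
  have out: "exec ?out (layout inp f) (straight_cost ?out) ((layout inp f)(0 := f vAns 0))"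
    using exec.store[of "Const 0" "var vAns" "layout inp f"] by simp
  have "holds (Less (Const 0) mE) inp" using m size by simp
  from exec.cond_true[OF this exec.seq[OF parts(1) exec.seq[OF parts(2) exec.seq[OF parts(3) out]]]]
  have run: "exec (main_com directed strict) inp (1 + test_cost (Less (Const 0) mE) + (t + straight_cost ?out))
      ((layout inp f)(0 := f vAns 0))"
    unfolding main_com_def parts(4) by (simp only: add.assoc)
  have "(\<exists>W \<in> meets n R. accepts W) \<longleftrightarrow> oTCC strict G s"
    unfolding oTCC_iff accepts_def using ex_max_clique_iff[of n R "\<lambda>X. card X = s"] R_refl by simp
  then have ans: "((layout inp f)(0 := f vAns 0)) 0 = (if oTCC strict G s then 1 else 0)" using f(3) by simp
  define N where "N = n ^ (2 * tpn strict G + 1)"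
  note b = size_bounds[OF m, folded N_def]
  define K where "K = 64 * N"
  have K: "x \<le> K * x" for x using b(4) by (simp add: K_def)
  have "?T1 \<le> K * pow_cost" using b(1) by (intro mult_le_mono1) (simp add: K_def)
  moreover have "?T2 \<le> K * table_cost directed strict"
    unfolding mult.assoc[symmetric] using b(2) by (intro mult_le_mono1) (simp add: K_def)
  moreover have "?T3 \<le> K * closure_cost"
    unfolding mult.assoc[symmetric] using b(3) by (intro mult_le_mono1) (simp add: K_def)
  ultimately have "1 + test_cost (Less (Const 0) mE) + (t + straight_cost ?out) \<le> K * main_cost directed strict"
    using f(2) K[of 1] K[of "test_cost (Less (Const 0) mE)"] K[of "straight_cost ?out"]
    unfolding main_cost_def distrib_left by linarith
  also have "K * main_cost directed strict = 64 * main_cost directed strict * N" by (simp add: K_def)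
  finally show ?thesis using run ans unfolding N_def by blast
qed

text \<open>Every vertex reaches only itself, so the cliques are the empty set and the singletons;
  the empty one is maximal only if there are no vertices.\<close>

lemma oTCC_trivial:
  assumes "m = 0"
  shows "oTCC strict G s \<longleftrightarrow> n = 0 \<and> s = 0 \<or> n \<noteq> 0 \<and> s = 1"
proof -
  have empty: "temporal_edges G = {}" using assms tes by auto
  have "v = u" if "arrives strict G u h v t" for u h v t
    using that by cases (use empty in auto)
  then have "vs ! v = vs ! u" if "v \<in> R u" for u v
    using that unfolding R_def reaches_iff_arrives[OF G] by blast
  then have "v = u" if "v \<in> R u" "u < n" for u v
    using that R_subset nth_eq_iff_index_eq[OF vs(1), of v u] by blast
  then have R: "R u = {u}" if "u < n" for u using that R_refl[OF that] by blast
  have clique: "clique n R X \<longleftrightarrow> X = {} \<or> (\<exists>u<n. X = {u})" for X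
  proof
    assume X: "clique n R X"
    show "X = {} \<or> (\<exists>u<n. X = {u})"
    proof (cases "X = {}")
      case False
      then obtain u where u: "u \<in> X" by blast
      with X have "u < n" "X \<subseteq> R u" by (auto simp: clique_def)
      then show ?thesis using R u by blast
    qed simp
  qed (auto simp: clique_def R)
  have "max_clique n R X \<longleftrightarrow> (if n = 0 then X = {} else \<exists>u<n. X = {u})" for X
    unfolding max_clique_def clique by (auto split: if_splits)
  then show ?thesis unfolding oTCC_iff
    by (cases "n = 0") (auto intro!: exI[of _ "{0 :: nat}"])
qed

end

lemma encodes_encoded:
  assumes G: "temporal_graph directed G" and "encodes G s \<sigma>"
  obtains vs tes where "encoded directed G s \<sigma> vs tes" "\<And>x. 3 + 3 * length tes \<le> x \<Longrightarrow> \<sigma> x = 0"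
proof -
  obtain vs tes rs where e: "distinct vs" "set vs = verts G" "distinct tes" "set tes = temporal_edges G"
    and all: "list_all2 (\<lambda>(e, t) (i, j, l).
          i < length vs \<and> j < length vs \<and> joins e (vs ! i) (vs ! j) \<and> l = t) tes rs"
    and \<sigma>: "\<sigma> = (let xs = [length vs, length tes, s] @ concat (map (\<lambda>(i, j, l). [i, j, l]) rs)
         in (\<lambda>a. if a < length xs then xs ! a else 0))"
    using assms(2) unfolding encodes_def Let_def by blast
  let ?xs = "concat (map (\<lambda>(i, j, l). [i, j, l]) rs)"
  have len: "length rs = length tes" using all by (simp add: list_all2_lengthD)
  have concat: "length (concat (map (\<lambda>(i, j, l). [i, j, l]) rs)) = 3 * length rs \<and>
      (\<forall>x i j l. x < length rs \<longrightarrow> rs ! x = (i, j, l) \<longrightarrow>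
        concat (map (\<lambda>(i, j, l). [i, j, l]) rs) ! (3 * x) = i \<and>
        concat (map (\<lambda>(i, j, l). [i, j, l]) rs) ! Suc (3 * x) = j \<and>
        concat (map (\<lambda>(i, j, l). [i, j, l]) rs) ! Suc (Suc (3 * x)) = l)" for rs :: "(nat \<times> nat \<times> nat) list"
  proof (induction rs)
    case (Cons r rs)
    obtain a b c where r: "r = (a, b, c)" by (metis surj_pair)
    show ?case
    proof (intro conjI allI impI)
      fix x i j l assume x: "x < length (r # rs)" "(r # rs) ! x = (i, j, l)"
      let ?ys = "concat (map (\<lambda>(i, j, l). [i, j, l]) (r # rs))"
      have "?ys ! (3 * x) = i \<and> ?ys ! Suc (3 * x) = j \<and> ?ys ! Suc (Suc (3 * x)) = l"
      proof (cases x)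
        case 0
        then show ?thesis using x r by simp
      next
        case (Suc y)
        have "3 * Suc y = Suc (Suc (Suc (3 * y)))" by simp
        then show ?thesis using x r Suc Cons.IH by simp
      qed
      then show "?ys ! (3 * x) = i" "?ys ! Suc (3 * x) = j" "?ys ! Suc (Suc (3 * x)) = l" by auto
    qed (use Cons.IH r in simp)
  qed simp
  have tot: "length ?xs = 3 * length tes" using concat[of rs] len by simp
  have high: "\<sigma> (3 + y) = (if y < 3 * length tes then ?xs ! y else 0)" for y
    unfolding \<sigma> Let_def using tot by (simp add: nth_append)
  have "encoded directed G s \<sigma> vs tes"
  proof (unfold_locales; (fact G e)?)
    show "\<sigma> 0 = length vs" "\<sigma> 1 = length tes" "\<sigma> 2 = s" unfolding \<sigma> Let_def by simp_all
    fix x e l assume x: "x < length tes" "tes ! x = (e, l)"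
    obtain i j l' where r: "rs ! x = (i, j, l')" by (metis surj_pair)
    have v: "i < length vs \<and> j < length vs \<and> joins e (vs ! i) (vs ! j) \<and> l' = l"
      using list_all2_nthD[OF all x(1)] x(2) r by simp
    have c: "?xs ! (3 * x) = i" "?xs ! Suc (3 * x) = j" "?xs ! Suc (Suc (3 * x)) = l'"
      using concat[of rs] r x len by auto
    have "\<sigma> (3 + 3 * x) = i" using high[of "3 * x"] c x by simp
    moreover have "\<sigma> (4 + 3 * x) = j" using high[of "Suc (3 * x)"] c x by simp
    moreover have "\<sigma> (5 + 3 * x) = l'" using high[of "Suc (Suc (3 * x))"] c x by (simp add: eval_nat_numeral)
    ultimately show "\<sigma> (3 + 3 * x) < length vs \<and> \<sigma> (4 + 3 * x) < length vs \<and> \<sigma> (5 + 3 * x) = l \<and>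
      joins e (vs ! \<sigma> (3 + 3 * x)) (vs ! \<sigma> (4 + 3 * x))" using v by simp
  qed
  moreover have "\<sigma> x = 0" if "3 + 3 * length tes \<le> x" for x
  proof -
    have "\<not> x - 3 < 3 * length tes" "3 + (x - 3) = x" using that by auto
    then show ?thesis using high[of "x - 3"] by simp
  qed
  ultimately show thesis using that by blast
qed

theorem theorem26:
  fixes directed strict :: bool
  shows "\<exists>P c. \<forall>(G :: 'v tgraph) s \<sigma>.
    temporal_graph directed G \<and> encodes G s \<sigma> \<longrightarrow>
    (\<exists>t \<tau>. exec P \<sigma> t \<tau> \<and>
       \<tau> 0 = (if oTCC strict G s then 1 else 0) \<and>
       (card (verts G) \<ge> 1 \<longrightarrow> t \<le> c * card (verts G) ^ (2 * tpn strict G + 1)))"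
proof (rule exI, rule exI, intro allI impI)
  fix G :: "'v tgraph" and s \<sigma>
  assume *: "temporal_graph directed G \<and> encodes G s \<sigma>"
  then obtain vs tes where enc: "encoded directed G s \<sigma> vs tes"
    and zero: "\<And>x. 3 + 3 * length tes \<le> x \<Longrightarrow> \<sigma> x = 0"
    using encodes_encoded by metis
  interpret encoded directed strict G s \<sigma> vs tes by (rule enc)
  show "\<exists>t \<tau>. exec (main_com directed strict) \<sigma> t \<tau> \<and> \<tau> 0 = (if oTCC strict G s then 1 else 0) \<and>
       (card (verts G) \<ge> 1 \<longrightarrow> t \<le> 64 * main_cost directed strict * card (verts G) ^ (2 * tpn strict G + 1))"
  proof (cases "m = 0")
    case False
    then show ?thesis using exec_main_nontrivial zero unfolding card_verts by blast
  next
    case True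
    \<comment> \<open>This branch takes constant time, so it meets the bound whatever the exponent
      is, provided there is a vertex.\<close>
    obtain t \<tau> where t: "exec trivial_com \<sigma> t \<tau>" "t \<le> straight_cost trivial_com"
      "\<tau> 0 = (if \<sigma> 0 = 0 \<and> \<sigma> 2 = 0 \<or> \<sigma> 0 \<noteq> 0 \<and> \<sigma> 2 = 1 then 1 else 0)"
      using exec_trivial by blast
    have "\<not> holds (Less (Const 0) mE) \<sigma>" using True size by simp
    from exec.cond_false[OF this t(1)]
    have run: "exec (main_com directed strict) \<sigma> (1 + test_cost (Less (Const 0) mE) + t) \<tau>"
      unfolding main_com_def .
    have ans: "\<tau> 0 = (if oTCC strict G s then 1 else 0)"
      unfolding t(3) oTCC_trivial[OF True] using size by simp
    have "1 + test_cost (Less (Const 0) mE) + t \<le> main_cost directed strict"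
      using t(2) by (simp add: main_cost_def)
    moreover have "main_cost directed strict \<le> 64 * main_cost directed strict * n ^ (2 * tpn strict G + 1)" if "1 \<le> n"
      using that by simp
    ultimately have "1 + test_cost (Less (Const 0) mE) + t \<le> 64 * main_cost directed strict * n ^ (2 * tpn strict G + 1)"
      if "1 \<le> n" using that le_trans by blast
    then show ?thesis using run ans unfolding card_verts by blast
  qed
qed

end
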